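(* Let $f:U\to\mathbb{H}$ be a slice-meromorphic function, not identically zero, and let $V\subset U$ be the maximal axially symmetric open set such that $f$ is slice-regular on $V$; let $F$ be the associated meromorphic map. Let $\Omega\subset\mathcal{U}$ be a bounded open set with piecewise $C^1$ (positively oriented) boundary and $\overline\Omega\subset\mathcal{U}$, such that $f$ does not have zeros or poles on $b\Omega$ (i.e. for no $x+\iota y\in b\Omega$ does the sphere $\{x+vy:v\in\mathbb{S}\}$ carry a zero or a pole of $f$). Counting with multiplicities, let - $k_0$ be the number of isolated non-real zeros $q=x+vy$ of $f$ with $z=x+\iota y\in\Omega$ and $\bar z\in\Omega$; - $m_0$ be the number of (non-real) spherical zeros $[q]=\{x+vy: v\in\mathbb{S}\}$ of $f$ with $z=x+\iota y\in\Omega$ and $\bar z\in\Omega$; - $k_1$ be the number of isolated non-real zeros $q=x+vy$ of $f$ with $z=x+\iota y\in\Omega$ and $\bar z\notin\Omega$ (for one of the two ways $x+vy=x+(-v)(-y)$ of writing $q$); - $m_1$ be the number of spherical zeros $[q]=\{x+vy: v\in\mathbb{S}\}$ of $f$ with $z=x+\iota y\in\Omega$ and $\bar z\notin\Omega$ (for one of the two choices of sign of $y$); - $r$ be the number of real zeros $x$ of $f$ with $x\in\Omega$; - $p_0$ be the number of poles $[q]=\{x+vy: v\in\mathbb{S}\}$ of $f$ with $z=x+\iota y\in\Omega$ and $\bar z\in\Omega$; - $p_1$ be the number of poles $[q]=\{x+vy: v\in\mathbb{S}\}$ of $f$ with $z=x+\iota y\in\Omega$ and $\bar z\notin\Omega$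 (for one of the two choices of sign of $y$). Then $$\frac{1}{2\pi\iota}\int_{b\Omega}\frac{(\Phi\circ F)'(z)}{(\Phi\circ F)(z)}\,dz=2k_0+k_1+2r+4m_0+2m_1-2p_0-p_1.$$
   Context: $\mathbb{H}$ is the algebra of quaternions with standard basis $1,i,j,k$, $\mathbb{S}=\{q\in\mathbb{H}: q^2=-1\}$, and $\iota$ is the imaginary unit of $\mathbb{C}$. $\mathcal{U}\subset\mathbb{C}\cong\mathbb{R}^2$ is an open domain (connected) invariant under complex conjugation, and $U=\{x+vy: x+\iota y\in\mathcal{U},\ v\in\mathbb{S}\}$ (an axially, or spherically, symmetric set). A (left) slice-regular function on $U$ is $f:U\to\mathbb{H}$ with $f(x+vy)=\alpha(x,y)+v\beta(x,y)$ for all $x+\iota y\in\mathcal{U}$, $v\in\mathbb{S}$, where $\alpha,\beta:\mathcal{U}\to\mathbb{H}$ are differentiable with $\alpha(x,-y)=\alpha(x,y)$, $\beta(x,-y)=-\beta(x,y)$, $\partial_x\alpha=\partial_y\beta$, $\partial_y\alpha=-\partial_x\beta$. Writing $\alpha=\alpha_0+\alpha_1i+\alpha_2j+\alpha_3k$ and $\beta=\beta_0+\beta_1i+\beta_2j+\beta_3k$ with real components, the associated holomorphic map is $F=(f_0,f_1,f_2,f_3):\mathcal{U}\to\mathbb{C}^4$, $f_m(x+\iota y)=\alpha_m(x,y)+\iota\beta_m(x,y)$. Put $\Phi(z)=z_0^2+z_1^2+z_2^2+z_3^2$ on $\mathbb{C}^4$. The $\star$-product of $f=\alpha+v\beta$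 and $g=\gamma+v\delta$ is $(f\star g)(x+vy)=(\alpha\gamma-\beta\delta)(x,y)+v(\alpha\delta+\beta\gamma)(x,y)$. If $f\not\equiv0$, $f^{-\star}$ is its $\star$-inverse, whose associated map is $(f_0,-f_1,-f_2,-f_3)/(\Phi\circ F)$, defined where $\Phi\circ F\ne0$. A slice-meromorphic function on $U$ is a function of the form $f^{-\star}\star g$ with $f,g:U\to\mathbb{H}$ slice-regular, $f\not\equiv 0$. Its associated map to $\mathbb{C}^4$, obtained on the set where it is slice-regular by writing the function there as $\alpha(x,y)+v\beta(x,y)$, with $\alpha=\alpha_0+\alpha_1i+\alpha_2j+\alpha_3k$ and $\beta=\beta_0+\beta_1i+\beta_2j+\beta_3k$ with real components, and taking the map with components $\alpha_m(x,y)+\iota\beta_m(x,y)$, $m=0,1,2,3$, at $x+\iota y$, has components meromorphic on $\mathcal{U}$. Zeros, poles and multiplicities of a slice-meromorphic $f\not\equiv0$. Near a real point $x$, write $f(q)=(q-x)^n g(q)$ with $n\in\mathbb{Z}$, $g$ slice-regular, $g(x)\neq0$. If $n>0$, $x$ is a real zero of multiplicity $n$; if $n<0$, $x$ is a pole of order $-n$ (counted in $p_0$ when $x\in\Omega$). Near a non-real sphere $S=[x+vy]=\{x+wy:w\in\mathbb{S}\}$, $y\ne0$, write $$f(q)=\big((q-x)^2+y^2\big)^{m}\,\tilde f(q),\qquad \tilde f=(q-p_1)\star\cdots\star(q-p_n)\star g,$$ with $m\in\mathbb{Z}$, $n\ge0$, $\tilde f$ slice-regular and not identically zero on $S$, $p_1,\dots,p_n\in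 S$, and $g$ slice-regular without zeros on $S$. If $m>0$, $S$ is a spherical zero of multiplicity $m$; if $m<0$, $S$ is a pole of order $-2m$; if $n\geq1$, $S$ carries an isolated non-real zero of multiplicity $n$ (possibly in addition to a spherical zero or a pole). For example, $\frac{1}{q^2+1}(q^2+q(i-j)-k)$ has on the sphere $[i]$ an isolated zero of multiplicity $2$ and a pole of order $2$. Each zero or pole is counted once with its multiplicity or order, not once for each of its two representations by $z$ and $\bar z$. *)

theory Defs
  imports "HOL-Complex_Analysis.Complex_Analysis"
begin

section \<open>Quaternions\<close>

datatype quat = Quat (qre: real) (qi: real) (qj: real) (qk: real)

lemma quat_eqI: "qre p = qre q \<Longrightarrow> qi p = qi q \<Longrightarrow> qj p = qj q \<Longrightarrow> qk p = qk q \<Longrightarrow> p = q"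
  by (cases p; cases q) simp

lemma quat_eq_iff: "p = q \<longleftrightarrow> qre p = qre q \<and> qi p = qi q \<and> qj p = qj q \<and> qk p = qk q"
  by (auto intro: quat_eqI)

instantiation quat :: ab_group_add
begin
definition "0 = Quat 0 0 0 0"
definition "p + q = Quat (qre p + qre q) (qi p + qi q) (qj p + qj q) (qk p + qk q)"
definition "- p = Quat (- qre p) (- qi p) (- qj p) (- qk p)"
definition "p - (q::quat) = Quat (qre p - qre q) (qi p - qi q) (qj p - qj q) (qk p - qk q)"
instance
  by standard (simp_all add: quat_eq_iff zero_quat_def plus_quat_def uminus_quat_def minus_quat_def)
end

lemma quat_add_simps [simp]:
  "qre 0 = 0" "qi 0 = 0" "qj 0 = 0" "qk 0 = 0"
  "qre (p + q) = qre p + qre q" "qi (p + q) = qi p + qi q"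
  "qj (p + q) = qj p + qj q" "qk (p + q) = qk p + qk q"
  "qre (- p) = - qre p" "qi (- p) = - qi p" "qj (- p) = - qj p" "qk (- p) = - qk p"
  "qre (p - q) = qre p - qre q" "qi (p - q) = qi p - qi q"
  "qj (p - q) = qj p - qj q" "qk (p - q) = qk p - qk q"
  by (simp_all add: zero_quat_def plus_quat_def uminus_quat_def minus_quat_def)

instantiation quat :: real_algebra_1
begin
definition "1 = Quat 1 0 0 0"
definition "p * q = Quat
  (qre p * qre q - qi p * qi q - qj p * qj q - qk p * qk q)
  (qre p * qi q + qi p * qre q + qj p * qk q - qk p * qj q)
  (qre p * qj q - qi p * qk q + qj p * qre q + qk p * qi q)
  (qre p * qk q + qi p * qj q - qj p * qi q + qk p * qre q)"
definition "r *\<^sub>R p = Quat (r * qre p) (r * qi p) (r * qj p) (r * qk p)"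
instance
  by standard
    (simp_all add: quat_eq_iff one_quat_def times_quat_def scaleR_quat_def algebra_simps)
end

lemma quat_mult_simps [simp]:
  "qre 1 = 1" "qi 1 = 0" "qj 1 = 0" "qk 1 = 0"
  "qre (p * q) = qre p * qre q - qi p * qi q - qj p * qj q - qk p * qk q"
  "qi (p * q) = qre p * qi q + qi p * qre q + qj p * qk q - qk p * qj q"
  "qj (p * q) = qre p * qj q - qi p * qk q + qj p * qre q + qk p * qi q"
  "qk (p * q) = qre p * qk q + qi p * qj q - qj p * qi q + qk p * qre q"
  "qre (r *\<^sub>R p) = r * qre p" "qi (r *\<^sub>R p) = r * qi p"
  "qj (r *\<^sub>R p) = r * qj p" "qk (r *\<^sub>R p) = r * qk p"
  by (simp_all add: one_quat_def times_quat_def scaleR_quat_def)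

lemma quat_of_real_simps [simp]:
  "qre (of_real r) = r" "qi (of_real r) = 0" "qj (of_real r) = 0" "qk (of_real r) = 0"
  by (simp_all add: of_real_def)

instantiation quat :: real_inner
begin
definition "inner p q = qre p * qre q + qi p * qi q + qj p * qj q + qk p * qk q" for p q :: quat
definition "norm p = sqrt (inner p p)" for p :: quat
definition "sgn p = p /\<^sub>R norm p" for p :: quat
definition "dist p q = norm (p - q)" for p q :: quat
definition "uniformity = (INF e\<in>{0<..}. principal {(p::quat, q). dist p q < e})"
definition "open S \<longleftrightarrow> (\<forall>p\<in>S. \<forall>\<^sub>F (p', q) in uniformity. p' = p \<longrightarrow> q \<in> S)" for S :: "quat set"
instance
proof
  fix p q r :: quat and c :: real and S :: "quat set"
  show "dist p q = norm (p - q)" by (rule dist_quat_def)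
  show "sgn p = p /\<^sub>R norm p" by (rule sgn_quat_def)
  show "uniformity = (INF e\<in>{0<..}. principal {(p::quat, q). dist p q < e})"
    by (rule uniformity_quat_def)
  show "open S \<longleftrightarrow> (\<forall>p\<in>S. \<forall>\<^sub>F (p', q) in uniformity. p' = p \<longrightarrow> q \<in> S)"
    by (rule open_quat_def)
  show "inner p q = inner q p" by (simp add: inner_quat_def mult.commute)
  show "inner (p + q) r = inner p r + inner q r" by (simp add: inner_quat_def algebra_simps)
  show "inner (c *\<^sub>R p) q = c * inner p q" by (simp add: inner_quat_def algebra_simps)
  show "0 \<le> inner p p" by (simp add: inner_quat_def)
  show "inner p p = 0 \<longleftrightarrow> p = 0"
    by (auto simp: inner_quat_def quat_eq_iff add_nonneg_eq_0_iff)
  show "norm p = sqrt (inner p p)" by (rule norm_quat_def)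
qed
end

instantiation quat :: real_normed_div_algebra
begin
definition "inverse p = Quat (qre p) (- qi p) (- qj p) (- qk p) /\<^sub>R inner p p" for p :: quat
definition "p div (q::quat) = p * inverse q"
instance
proof
  fix p q :: quat
  show "p div q = p * inverse q" by (rule divide_quat_def)
  show "inverse (0::quat) = 0" by (simp add: inverse_quat_def)
  show "norm (p * q) = norm p * norm q"
    unfolding norm_quat_def inner_quat_def real_sqrt_mult [symmetric]
    by (rule arg_cong [where f = sqrt]) (simp add: algebra_simps)
  assume "p \<noteq> 0"
  then have *: "qre p * qre p + qi p * qi p + qj p * qj p + qk p * qk p \<noteq> 0"
    by (metis inner_quat_def inner_eq_zero_iff)
  show "inverse p * p = 1"
    using * by (simp add: quat_eq_iff inverse_quat_def inner_quat_def divide_simps)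
  show "p * inverse p = 1"
    using * by (simp add: quat_eq_iff inverse_quat_def inner_quat_def divide_simps)
qed
end

definition imag_units :: "quat set" where
  "imag_units = {v. v\<^sup>2 = - 1}"

lemma imag_units_iff:
  "v \<in> imag_units \<longleftrightarrow> qre v = 0 \<and> (qi v)\<^sup>2 + (qj v)\<^sup>2 + (qk v)\<^sup>2 = 1"
proof
  assume "v \<in> imag_units"
  then have *: "qre v * qre v - qi v * qi v - qj v * qj v - qk v * qk v = -1"
    "qre v * qi v = 0" "qre v * qj v = 0" "qre v * qk v = 0"
    by (auto simp: imag_units_def quat_eq_iff power2_eq_square)
  have "qre v = 0"
  proof (rule ccontr)
    assume "qre v \<noteq> 0"
    with * have "qre v * qre v = -1" by auto
    then show False by (metis zero_le_square neg_0_le_iff_le not_one_le_zero)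
  qed
  with * show "qre v = 0 \<and> (qi v)\<^sup>2 + (qj v)\<^sup>2 + (qk v)\<^sup>2 = 1"
    by (simp add: power2_eq_square)
next
  assume "qre v = 0 \<and> (qi v)\<^sup>2 + (qj v)\<^sup>2 + (qk v)\<^sup>2 = 1"
  then show "v \<in> imag_units"
    by (auto simp: imag_units_def quat_eq_iff power2_eq_square algebra_simps)
qed

section \<open>Slice functions\<close>

text \<open>The point \<open>x + v y\<close> of the quaternions, for \<open>z = x + \<i> y\<close>.\<close>

definition slice_pt :: "quat \<Rightarrow> complex \<Rightarrow> quat" where
  "slice_pt v z = of_real (Re z) + v * of_real (Im z)"

definition sphere_of :: "complex \<Rightarrow> quat set" where
  "sphere_of z = {slice_pt v z | v. v \<in> imag_units}"

definition axial :: "complex set \<Rightarrow> quat set" where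
  "axial D = {slice_pt v z | v z. v \<in> imag_units \<and> z \<in> D}"

definition sym_open :: "complex set \<Rightarrow> bool" where
  "sym_open D \<longleftrightarrow> open D \<and> (\<forall>z\<in>D. cnj z \<in> D)"

text \<open>The two partial derivatives of a function of \<open>z = x + \<i> y\<close> are the values of its real
  derivative at \<open>1\<close> and \<open>\<i>\<close>. The set \<open>D\<close> is not required to be connected here.\<close>

definition regular_stem :: "complex set \<Rightarrow> (complex \<Rightarrow> quat) \<Rightarrow> (complex \<Rightarrow> quat) \<Rightarrow> bool" where
  "regular_stem D \<alpha> \<beta> \<longleftrightarrow>
     (\<forall>z\<in>D. \<alpha> (cnj z) = \<alpha> z \<and> \<beta> (cnj z) = - \<beta> z) \<and>
     (\<forall>z\<in>D. \<alpha> differentiable (at z) \<and> \<beta> differentiable (at z)) \<and>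
     (\<forall>z\<in>D. frechet_derivative \<alpha> (at z) 1 = frechet_derivative \<beta> (at z) \<i> \<and>
             frechet_derivative \<alpha> (at z) \<i> = - frechet_derivative \<beta> (at z) 1)"

definition slice_regular :: "complex set \<Rightarrow> (quat \<Rightarrow> quat) \<Rightarrow> bool" where
  "slice_regular D f \<longleftrightarrow> sym_open D \<and>
     (\<exists>\<alpha> \<beta>. regular_stem D \<alpha> \<beta> \<and>
        (\<forall>z\<in>D. \<forall>v\<in>imag_units. f (slice_pt v z) = \<alpha> z + v * \<beta> z))"

text \<open>The functions \<open>\<alpha>\<close> and \<open>\<beta>\<close> of a slice function are determined by its values. They are
  recovered from those at \<open>x + v y\<close> and \<open>x - v y\<close> for any single imaginary unit \<open>v\<close>; here \<open>v\<close>
  is the basis element \<open>i\<close>. See \<open>stem_re_eq\<close> and \<open>stem_im_eq\<close> below.\<close>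

abbreviation quat_i :: quat where
  "quat_i \<equiv> Quat 0 1 0 0"

definition stem_re :: "(quat \<Rightarrow> quat) \<Rightarrow> complex \<Rightarrow> quat" where
  "stem_re f z = (1/2) *\<^sub>R (f (slice_pt quat_i z) + f (slice_pt quat_i (cnj z)))"

definition stem_im :: "(quat \<Rightarrow> quat) \<Rightarrow> complex \<Rightarrow> quat" where
  "stem_im f z = - (1/2) *\<^sub>R (quat_i * (f (slice_pt quat_i z) - f (slice_pt quat_i (cnj z))))"

text \<open>Conversely, \<open>slice_fun \<alpha> \<beta>\<close> is the function \<open>x + v y \<mapsto> \<alpha>(x,y) + v \<beta>(x,y)\<close>, where \<open>q\<close> is
  written as \<open>x + v y\<close> with \<open>y \<ge> 0\<close> (and \<open>v = 0\<close> when \<open>q\<close> is real, \<open>\<beta>\<close> being odd in \<open>y\<close>).\<close>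

definition slice_fun :: "(complex \<Rightarrow> quat) \<Rightarrow> (complex \<Rightarrow> quat) \<Rightarrow> quat \<Rightarrow> quat" where
  "slice_fun \<alpha> \<beta> q =
     (let w = q - of_real (qre q); z = Complex (qre q) (norm w)
      in \<alpha> z + sgn w * \<beta> z)"

definition star :: "(quat \<Rightarrow> quat) \<Rightarrow> (quat \<Rightarrow> quat) \<Rightarrow> quat \<Rightarrow> quat" (infixr "\<star>" 70) where
  "f \<star> g = slice_fun
     (\<lambda>z. stem_re f z * stem_re g z - stem_im f z * stem_im g z)
     (\<lambda>z. stem_re f z * stem_im g z + stem_im f z * stem_re g z)"

text \<open>The components \<open>z\<^sub>0, z\<^sub>1, z\<^sub>2, z\<^sub>3\<close> of a vector in \<open>\<complex>\<^sup>4\<close> are \<open>z $ 1, z $ 2, z $ 3, z $ 4\<close>.\<close>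

definition assoc_map :: "(quat \<Rightarrow> quat) \<Rightarrow> complex \<Rightarrow> complex ^ 4" where
  "assoc_map f z = (let a = stem_re f z; b = stem_im f z in
     vector [Complex (qre a) (qre b), Complex (qi a) (qi b),
             Complex (qj a) (qj b), Complex (qk a) (qk b)])"

definition Phi :: "complex ^ 4 \<Rightarrow> complex" where
  "Phi z = (z $ 1)\<^sup>2 + (z $ 2)\<^sup>2 + (z $ 3)\<^sup>2 + (z $ 4)\<^sup>2"

definition slice_of_map :: "(complex \<Rightarrow> complex ^ 4) \<Rightarrow> quat \<Rightarrow> quat" where
  "slice_of_map F = slice_fun
     (\<lambda>z. Quat (Re (F z $ 1)) (Re (F z $ 2)) (Re (F z $ 3)) (Re (F z $ 4)))
     (\<lambda>z. Quat (Im (F z $ 1)) (Im (F z $ 2)) (Im (F z $ 3)) (Im (F z $ 4)))"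

text \<open>Meaningful only at points \<open>x + v y\<close> with \<open>Phi (assoc_map f (x + \<i> y)) \<noteq> 0\<close>.\<close>

definition star_inverse :: "(quat \<Rightarrow> quat) \<Rightarrow> quat \<Rightarrow> quat" where
  "star_inverse f = slice_of_map (\<lambda>z. let F = assoc_map f z in
     vector [F $ 1 / Phi F, - (F $ 2) / Phi F, - (F $ 3) / Phi F, - (F $ 4) / Phi F])"

text \<open>A slice-meromorphic function is a partial function on \<open>axial U\<close>, represented by a total one.
  It equals \<open>star_inverse f \<star> g\<close> where this is defined, and it takes the values of the
  slice-regular extension on the spheres where this quotient has a removable singularity
  (the last clause; \<open>k\<close> is the extension). Its values on the polar spheres are arbitrary.\<close>

definition slice_meromorphic :: "complex set \<Rightarrow> (quat \<Rightarrow> quat) \<Rightarrow> bool" where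
  "slice_meromorphic U h \<longleftrightarrow>
     (\<exists>f g. slice_regular U f \<and> slice_regular U g \<and> (\<exists>q\<in>axial U. f q \<noteq> 0) \<and>
        (let W = {z \<in> U. Phi (assoc_map f z) \<noteq> 0} in
          (\<forall>q\<in>axial W. h q = (star_inverse f \<star> g) q) \<and>
          (\<forall>D k. D \<subseteq> U \<and> slice_regular D k \<and>
                 (\<forall>q\<in>axial (D \<inter> W). k q = (star_inverse f \<star> g) q)
             \<longrightarrow> (\<forall>q\<in>axial D. h q = k q))))"

subsection \<open>Consistency of the encoding\<close>

lemma slice_fun_slice_pt:
  assumes "\<alpha> (cnj z) = \<alpha> z" "\<beta> (cnj z) = - \<beta> z" "v \<in> imag_units"
  shows "slice_fun \<alpha> \<beta> (slice_pt v z) = \<alpha> z + v * \<beta> z"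
proof -
  have v: "qre v = 0" "(qi v)\<^sup>2 + (qj v)\<^sup>2 + (qk v)\<^sup>2 = 1"
    using assms(3) by (auto simp: imag_units_iff)
  then have nv: "norm v = 1"
    by (simp add: norm_quat_def inner_quat_def power2_eq_square)
  have re: "qre (slice_pt v z) = Re z" using v by (simp add: slice_pt_def)
  have w: "slice_pt v z - of_real (Re z) = Im z *\<^sub>R v"
    by (simp add: slice_pt_def scaleR_conv_of_real Reals_def quat_eq_iff)
  have sg: "sgn (Im z *\<^sub>R v) = sgn (Im z) *\<^sub>R v"
    using nv by (simp add: sgn_quat_def sgn_if)
  consider "Im z > 0" | "Im z = 0" | "Im z < 0" by linarith
  then show ?thesis
  proof cases
    case 1
    then have "Complex (Re z) \<bar>Im z\<bar> = z" by (simp add: complex_eq_iff)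
    with 1 show ?thesis unfolding slice_fun_def Let_def re w sg by (simp add: nv)
  next
    case 2
    then have z: "cnj z = z" "Complex (Re z) 0 = z" by (simp_all add: complex_eq_iff)
    then have "\<beta> z = - \<beta> z" using assms(2) by simp
    then have "\<beta> z = 0" by (simp add: quat_eq_iff)
    with 2 z show ?thesis unfolding slice_fun_def Let_def re w sg by (simp add: nv)
  next
    case 3
    then have "Complex (Re z) \<bar>Im z\<bar> = cnj z" by (simp add: complex_eq_iff)
    with 3 show ?thesis unfolding slice_fun_def Let_def re w sg by (simp add: nv assms)
  qed
qed

lemma quat_i_unit: "quat_i \<in> imag_units"
  by (simp add: imag_units_iff)

lemma
  assumes "\<alpha> (cnj z) = \<alpha> z" "\<beta> (cnj z) = - \<beta> z"
    and "\<And>v. v \<in> imag_units \<Longrightarrow> f (slice_pt v z) = \<alpha> z + v * \<beta> z"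
    and "\<And>v. v \<in> imag_units \<Longrightarrow> f (slice_pt v (cnj z)) = \<alpha> (cnj z) + v * \<beta> (cnj z)"
  shows stem_re_eq: "stem_re f z = \<alpha> z" and stem_im_eq: "stem_im f z = \<beta> z"
  unfolding stem_re_def stem_im_def assms(3,4)[OF quat_i_unit] assms(1,2)
  by (simp_all add: quat_eq_iff)

lemma stem_cnj: "stem_re f (cnj z) = stem_re f z" "stem_im f (cnj z) = - stem_im f z"
  by (simp_all add: stem_re_def stem_im_def quat_eq_iff field_simps)

lemma star_slice_pt:
  assumes "v \<in> imag_units"
  shows "(f \<star> g) (slice_pt v z) =
    (stem_re f z * stem_re g z - stem_im f z * stem_im g z)
      + v * (stem_re f z * stem_im g z + stem_im f z * stem_re g z)"
  unfolding star_def by (rule slice_fun_slice_pt) (simp_all add: stem_cnj assms)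

text \<open>The axially symmetric open sets of quaternions are the sets \<open>axial D\<close> with \<open>D\<close> open and
  invariant under conjugation.\<close>

lemma slice_pt_in_axial_iff:
  assumes "\<forall>z\<in>D. cnj z \<in> D" "v \<in> imag_units"
  shows "slice_pt v z \<in> axial D \<longleftrightarrow> z \<in> D"
proof
  assume "slice_pt v z \<in> axial D"
  then obtain w u where w: "w \<in> D" "u \<in> imag_units" "slice_pt v z = slice_pt u w"
    by (auto simp: axial_def)
  have pt: "qre (slice_pt u z) = Re z \<and> norm (slice_pt u z - of_real (Re z)) = \<bar>Im z\<bar>"
    if "u \<in> imag_units" for u z
  proof -
    have "qre u = 0" "norm u = 1"
      using that by (auto simp: imag_units_iff norm_quat_def inner_quat_def power2_eq_square)
    then show ?thesis by (simp add: slice_pt_def norm_mult)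
  qed
  have "Re z = Re w" "\<bar>Im z\<bar> = \<bar>Im w\<bar>"
    using pt[OF w(2), of w] pt[OF assms(2), of z] w(3) by auto
  then have "z = w \<or> z = cnj w" by (auto simp: complex_eq_iff abs_eq_iff)
  then show "z \<in> D" using w assms by auto
qed (use assms in \<open>auto simp: axial_def\<close>)

lemma continuous_qre: "continuous_on A qre"
proof -
  have *: "qre = (\<lambda>q. inner q 1)" by (auto simp: inner_quat_def)
  show ?thesis unfolding * by (intro continuous_intros)
qed

lemma axial_eq_vimage:
  assumes "\<forall>z\<in>D. cnj z \<in> D"
  shows "axial D = (\<lambda>q. Complex (qre q) (norm (q - of_real (qre q)))) -` D"
proof (intro equalityI subsetI)
  fix q assume "q \<in> axial D"
  then obtain w u where w: "w \<in> D" "u \<in> imag_units" "q = slice_pt u w"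
    by (auto simp: axial_def)
  have "qre u = 0" "norm u = 1"
    using w by (auto simp: imag_units_iff norm_quat_def inner_quat_def power2_eq_square)
  then have "Complex (qre q) (norm (q - of_real (qre q))) = Complex (Re w) \<bar>Im w\<bar>"
    by (simp add: w slice_pt_def norm_mult)
  also have "\<dots> = w \<or> \<dots> = cnj w" by (auto simp: complex_eq_iff)
  finally show "q \<in> (\<lambda>q. Complex (qre q) (norm (q - of_real (qre q)))) -` D"
    using w assms by auto
next
  fix q assume q: "q \<in> (\<lambda>q. Complex (qre q) (norm (q - of_real (qre q)))) -` D"
  define w where "w = q - of_real (qre q)"
  define u where "u = (if w = 0 then quat_i else sgn w)"
  have n: "norm w ^ 2 = (qi w)\<^sup>2 + (qj w)\<^sup>2 + (qk w)\<^sup>2"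
    by (simp add: w_def power2_norm_eq_inner) (simp add: inner_quat_def power2_eq_square)
  have "(qi w / norm w)\<^sup>2 + (qj w / norm w)\<^sup>2 + (qk w / norm w)\<^sup>2 = 1" if "w \<noteq> 0"
    using that by (simp add: power_divide n[symmetric] add_divide_distrib[symmetric])
  then have u: "u \<in> imag_units"
    by (auto simp: u_def imag_units_iff sgn_quat_def w_def divide_inverse mult.commute)
  have "w = u * of_real (norm w)"
    by (auto simp: u_def sgn_quat_def quat_eq_iff)
  then have "q = slice_pt u (Complex (qre q) (norm w))"
    by (simp add: slice_pt_def w_def)
  with q u show "q \<in> axial D" unfolding axial_def w_def by auto
qed

lemma open_axial_iff:
  assumes "\<forall>z\<in>D. cnj z \<in> D"
  shows "open (axial D) \<longleftrightarrow> open D"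
proof
  assume "open D"
  then show "open (axial D)"
    unfolding axial_eq_vimage[OF assms] Complex_eq
    by (intro open_vimage continuous_intros continuous_qre) auto
next
  assume "open (axial D)"
  moreover have "D = slice_pt quat_i -` axial D"
    using slice_pt_in_axial_iff[OF assms quat_i_unit] by auto
  moreover have "continuous_on UNIV (slice_pt quat_i)"
    unfolding slice_pt_def by (intro continuous_intros)
  ultimately show "open D" by (metis open_vimage)
qed

section \<open>Zeros and poles\<close>

text \<open>The factorizations are required off the point, respectively the sphere, under consideration,
  since \<open>f\<close> may have a pole there.\<close>

definition real_order :: "(quat \<Rightarrow> quat) \<Rightarrow> real \<Rightarrow> int \<Rightarrow> bool" where
  "real_order f x n \<longleftrightarrow>
     (\<exists>D g. of_real x \<in> D \<and> slice_regular D g \<and> g (of_real x) \<noteq> 0 \<and>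
        (\<forall>q\<in>axial D - {of_real x}. f q = (q - of_real x) powi n * g q))"

definition sphere_order :: "(quat \<Rightarrow> quat) \<Rightarrow> complex \<Rightarrow> int \<Rightarrow> nat \<Rightarrow> bool" where
  "sphere_order f z m n \<longleftrightarrow>
     (\<exists>D h g ps. z \<in> D \<and> slice_regular D h \<and> (\<exists>q\<in>sphere_of z. h q \<noteq> 0) \<and>
        (\<forall>q\<in>axial D - sphere_of z.
           f q = ((q - of_real (Re z))\<^sup>2 + (of_real (Im z))\<^sup>2) powi m * h q) \<and>
        slice_regular D g \<and> (\<forall>q\<in>sphere_of z. g q \<noteq> 0) \<and>
        length ps = n \<and> set ps \<subseteq> sphere_of z \<and>
        (\<forall>q\<in>axial D. h q = foldr (\<lambda>p k. (\<lambda>q. q - p) \<star> k) ps g q))"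

text \<open>At points of the domain of a slice-meromorphic \<open>f\<close> that is not identically zero, these
  factorizations exist and their integers are unique, so the descriptions below are proper.\<close>

definition real_mult :: "(quat \<Rightarrow> quat) \<Rightarrow> real \<Rightarrow> int" where
  "real_mult f x = (THE n. real_order f x n)"

definition spherical_mult :: "(quat \<Rightarrow> quat) \<Rightarrow> complex \<Rightarrow> int" where
  "spherical_mult f z = (THE m. \<exists>n. sphere_order f z m n)"

definition isolated_mult :: "(quat \<Rightarrow> quat) \<Rightarrow> complex \<Rightarrow> nat" where
  "isolated_mult f z = (THE n. \<exists>m. sphere_order f z m n)"

definition zero_or_pole :: "(quat \<Rightarrow> quat) \<Rightarrow> complex \<Rightarrow> bool" where
  "zero_or_pole f z \<longleftrightarrow>
     (if Im z = 0 then real_mult f (Re z) \<noteq> 0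
      else spherical_mult f z \<noteq> 0 \<or> isolated_mult f z > 0)"

text \<open>The non-real spheres with \<open>z\<close> and \<open>cnj z\<close> both in \<open>\<Omega>\<close>, each represented by its point in the
  upper half-plane, and those with exactly one of the two in \<open>\<Omega>\<close>, represented by that one.\<close>

definition paired :: "complex set \<Rightarrow> complex set" where
  "paired \<Omega> = {z. Im z > 0 \<and> z \<in> \<Omega> \<and> cnj z \<in> \<Omega>}"

definition unpaired :: "complex set \<Rightarrow> complex set" where
  "unpaired \<Omega> = {z. z \<in> \<Omega> \<and> cnj z \<notin> \<Omega>}"

text \<open>The sums below have finite index sets whenever the closure of \<open>\<Omega>\<close> is a compact subset of the
  domain, since zeros and poles are then discrete.\<close>

definition isolated_zeros :: "(quat \<Rightarrow> quat) \<Rightarrow> complex set \<Rightarrow> int" where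
  "isolated_zeros f Z = (\<Sum>z | z \<in> Z \<and> isolated_mult f z > 0. int (isolated_mult f z))"

definition spherical_zeros :: "(quat \<Rightarrow> quat) \<Rightarrow> complex set \<Rightarrow> int" where
  "spherical_zeros f Z = (\<Sum>z | z \<in> Z \<and> spherical_mult f z > 0. spherical_mult f z)"

definition spherical_poles :: "(quat \<Rightarrow> quat) \<Rightarrow> complex set \<Rightarrow> int" where
  "spherical_poles f Z = (\<Sum>z | z \<in> Z \<and> spherical_mult f z < 0. - 2 * spherical_mult f z)"

definition real_zeros :: "(quat \<Rightarrow> quat) \<Rightarrow> complex set \<Rightarrow> int" where
  "real_zeros f \<Omega> = (\<Sum>x | of_real x \<in> \<Omega> \<and> real_mult f x > 0. real_mult f x)"

definition real_poles :: "(quat \<Rightarrow> quat) \<Rightarrow> complex set \<Rightarrow> int" where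
  "real_poles f \<Omega> = (\<Sum>x | of_real x \<in> \<Omega> \<and> real_mult f x < 0. - real_mult f x)"

section \<open>Positively oriented piecewise \<open>C\<^sup>1\<close> boundaries\<close>

text \<open>The boundary of \<open>\<Omega>\<close> is the union of finitely many simple closed piecewise \<open>C\<^sup>1\<close> curves, any
  two of which meet in at most finitely many points. Apart from finitely many parameters each curve
  is regular, and has \<open>\<Omega>\<close> on its left and the exterior of \<open>\<Omega>\<close> on its right.\<close>

definition oriented_C1_boundary :: "complex set \<Rightarrow> (real \<Rightarrow> complex) list \<Rightarrow> bool" where
  "oriented_C1_boundary \<Omega> \<Gamma> \<longleftrightarrow>
     (\<forall>\<gamma>\<in>set \<Gamma>. valid_path \<gamma> \<and> simple_path \<gamma> \<and> pathfinish \<gamma> = pathstart \<gamma>) \<and>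
     (\<forall>i j. i < j \<and> j < length \<Gamma> \<longrightarrow> finite (path_image (\<Gamma> ! i) \<inter> path_image (\<Gamma> ! j))) \<and>
     frontier \<Omega> = (\<Union>\<gamma>\<in>set \<Gamma>. path_image \<gamma>) \<and>
     (\<forall>\<gamma>\<in>set \<Gamma>. \<exists>E. finite E \<and> (\<forall>t\<in>{0..1} - E. \<exists>d.
        d \<noteq> 0 \<and> (\<gamma> has_vector_derivative d) (at t) \<and>
        (\<forall>\<^sub>F \<epsilon> in at_right 0.
           \<gamma> t + of_real \<epsilon> * \<i> * d \<in> \<Omega> \<and> \<gamma> t - of_real \<epsilon> * \<i> * d \<notin> closure \<Omega>)))"

end

theory Submission
  imports Defs
begin

text \<open>
  A slice function is determined by its stem \<open>\<alpha> + \<i> \<beta>\<close>, a map into the quaternions with complex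
  coefficients, that is, into \<open>\<complex>\<^sup>4\<close>. For stems the star product is the pointwise product, and
  \<^const>\<open>Phi\<close> is the norm form of this algebra, so it is multiplicative. If \<open>f\<close> is the star quotient of
  \<open>b\<close> by \<open>a\<close>, then \<open>\<Phi> \<circ> F\<close> is the restriction of the meromorphic function \<open>A / B\<close>, where \<open>A\<close> and \<open>B\<close> are
  \<open>\<Phi>\<close> applied to the stems of \<open>b\<close> and \<open>a\<close>. Neither vanishes identically: a connected set that is
  symmetric under conjugation meets the real axis, where stems are real and \<open>\<Phi>\<close> is a sum of four
  squares (\<open>Phi_not_identically_zero\<close>). The integral is then computed by the argument principle, once two
  things are known: the order of \<open>A / B\<close> at each point, and the winding number of the boundary of
  \<open>\<Omega>\<close> around each point.

  The order is a local matter. For each \<open>z\<close> let \<open>\<nu> = node z\<close> be the monic real polynomial with simple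
  zeros exactly at \<open>z\<close> and its conjugate. The stem of \<open>f\<close> is \<open>\<nu>\<^sup>m H\<close> near \<open>z\<close>, with \<open>H\<close> holomorphic and
  \<open>H z \<noteq> 0\<close>. If \<open>z\<close> is real then \<open>H z\<close> is a nonzero real vector, so \<open>\<Phi> (H z) \<noteq> 0\<close>. If \<open>z\<close> is not real,
  \<open>\<alpha> + v \<beta> = 0\<close> has a solution \<open>v\<close> among the imaginary units exactly when \<open>\<Phi> (\<alpha> + \<i> \<beta>) = 0\<close>; each zero
  of \<open>\<Phi> \<circ> H\<close> at \<open>z\<close> therefore comes from a zero \<open>p\<close> on the sphere and splits off a factor \<open>q - p\<close>
  (\<open>extract_linear_factor\<close>), and \<open>\<Phi>\<close> of that linear factor is \<open>\<nu>\<close>, so that the order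
  drops by one. Hence the order is \<open>2 m + n\<close> at a non-real point of spherical multiplicity \<open>m\<close> and isolated
  multiplicity \<open>n\<close>, and \<open>2 m\<close> at a real point (\<open>stem_factor_zorder\<close>). Points \<open>z\<close> and their conjugates have the
  same order, and summing over \<open>\<Omega>\<close> counts a sphere twice or once according to whether both or only one
  of its two representations lie in \<open>\<Omega>\<close> (\<open>sum_of_orders\<close>).

  The winding number of the whole boundary is the indicator function of \<open>\<Omega>\<close>
  (\<open>boundary_winding_eq_indicator\<close>). At every regular point of the boundary the winding number
  increases by one from right to left (\<open>winding_number_jump\<close>), and so does the indicator function. Their
  difference is locally constant off a finite set, whose complement is connected, and it vanishes far out.
  The single boundary curves need not be null-homologous in the domain, only their sum is; since the
  domain is connected they can be joined to one loop (\<open>join_loops\<close>), to which the argument principle for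
  a single closed path applies.
\<close>

section \<open>Quaternions with complex coefficients\<close>

(* The symbol is used below for the components of vectors only. *)
no_notation fps_nth (infixl "$" 75)

lemma vector_4 [simp]:
  "(vector [a, b, c, d] :: 'a::zero ^ 4) $ 1 = a"
  "(vector [a, b, c, d] :: 'a::zero ^ 4) $ 2 = b"
  "(vector [a, b, c, d] :: 'a::zero ^ 4) $ 3 = c"
  "(vector [a, b, c, d] :: 'a::zero ^ 4) $ 4 = d"
  unfolding vector_def by simp_all

text \<open>The value \<open>\<alpha> + v \<beta>\<close> at the imaginary unit \<open>v\<close> of a slice function whose stem has the value
  \<open>\<alpha> + \<i> \<beta>\<close>.\<close>

definition quat_val :: "quat \<Rightarrow> complex ^ 4 \<Rightarrow> quat" where
  "quat_val v Z = Quat (Re (Z $ 1)) (Re (Z $ 2)) (Re (Z $ 3)) (Re (Z $ 4))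
     + v * Quat (Im (Z $ 1)) (Im (Z $ 2)) (Im (Z $ 3)) (Im (Z $ 4))"

text \<open>Multiplication of quaternions extended bilinearly to complex coefficients. The imaginary unit of the
  coefficients commutes with \<open>i, j, k\<close>, so there are zero divisors: a nonzero \<open>Z\<close> is one if
  and only if \<open>Phi Z = 0\<close>.\<close>

definition cq_mult :: "complex ^ 4 \<Rightarrow> complex ^ 4 \<Rightarrow> complex ^ 4" where
  "cq_mult Z W = vector
     [Z$1 * W$1 - Z$2 * W$2 - Z$3 * W$3 - Z$4 * W$4,
      Z$1 * W$2 + Z$2 * W$1 + Z$3 * W$4 - Z$4 * W$3,
      Z$1 * W$3 - Z$2 * W$4 + Z$3 * W$1 + Z$4 * W$2,
      Z$1 * W$4 + Z$2 * W$3 - Z$3 * W$2 + Z$4 * W$1]"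

definition cq_conj :: "complex ^ 4 \<Rightarrow> complex ^ 4" where
  "cq_conj Z = vector [Z$1, - (Z$2), - (Z$3), - (Z$4)]"

definition vec_cnj :: "complex ^ 'n \<Rightarrow> complex ^ 'n" where
  "vec_cnj Z = (\<chi> i. cnj (Z $ i))"

lemma vec_cnj_nth [simp]: "vec_cnj Z $ i = cnj (Z $ i)"
  by (simp add: vec_cnj_def)

text \<open>Euler's four-square identity, over the complex numbers.\<close>

lemma Phi_cq_mult: "Phi (cq_mult Z W) = Phi Z * Phi W"
  unfolding Phi_def cq_mult_def vector_4 by algebra

lemma Phi_cq_conj: "Phi (cq_conj Z) = Phi Z"
  by (simp add: Phi_def cq_conj_def)

lemma Phi_scale: "Phi (c *s Z) = c\<^sup>2 * Phi Z"
  by (simp add: Phi_def power_mult_distrib algebra_simps)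

lemma cq_mult_scale: "cq_mult Z (c *s W) = c *s cq_mult Z W" "cq_mult (c *s Z) W = c *s cq_mult Z W"
  unfolding cq_mult_def vec_eq_iff forall_4 vector_4 vector_smult_component by algebra+

lemma cq_mult_conj: "cq_mult Z (cq_mult (cq_conj Z) W) = Phi Z *s W"
  unfolding cq_mult_def cq_conj_def Phi_def vec_eq_iff forall_4 vector_4 vector_smult_component by algebra

lemma vec_cnj_cq: "vec_cnj (cq_mult Z W) = cq_mult (vec_cnj Z) (vec_cnj W)" "vec_cnj (cq_conj Z) = cq_conj (vec_cnj Z)"
  by (simp_all add: cq_mult_def cq_conj_def vec_eq_iff forall_4)

lemma Phi_vec_cnj: "Phi (vec_cnj Z) = cnj (Phi Z)"
  by (simp add: Phi_def)

lemma vec_cnj_scale: "vec_cnj (c *s Z) = cnj c *s vec_cnj Z"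
  by (simp add: vec_eq_iff)

section \<open>Slice functions and their stems\<close>

lemma imag_unit_square: "v \<in> imag_units \<Longrightarrow> v * v = - 1"
  unfolding imag_units_def power2_eq_square by blast

lemma imag_unit_uminus: "v \<in> imag_units \<Longrightarrow> - v \<in> imag_units"
  by (simp add: imag_units_iff)

lemma slice_pt_scaleR: "slice_pt v z = Re z *\<^sub>R 1 + Im z *\<^sub>R v"
  by (simp add: slice_pt_def quat_eq_iff)

text \<open>For a fixed imaginary unit \<open>v\<close>, \<open>x + \<i> y \<mapsto> x + v y\<close> embeds the complex numbers as a field
  into the quaternions. All scalar factors of stems, in particular powers with negative exponents, are
  carried over to quaternions by this embedding.\<close>

lemma slice_pt_mult: "v \<in> imag_units \<Longrightarrow> slice_pt v (a * b) = slice_pt v a * slice_pt v b"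
  by (simp add: slice_pt_scaleR algebra_simps imag_unit_square)

lemma slice_pt_simps: "slice_pt v 1 = 1" "slice_pt v 0 = 0" "slice_pt v (of_real r) = of_real r"
   "slice_pt v (a + b) = slice_pt v a + slice_pt v b" "slice_pt v (a - b) = slice_pt v a - slice_pt v b"
   "slice_pt (- v) z = slice_pt v (cnj z)"
  by (simp_all add: slice_pt_scaleR algebra_simps of_real_def)

lemma slice_pt_inverse:
  assumes "v \<in> imag_units"
  shows "slice_pt v (inverse a) = inverse (slice_pt v a)"
proof (cases "a = 0")
  case False
  then have "slice_pt v (inverse a) * slice_pt v a = 1"
    using slice_pt_mult[OF assms, of "inverse a" a] by (simp add: slice_pt_simps)
  then show ?thesis by (metis inverse_unique mult_zero_right zero_neq_one left_inverse mult.assoc mult_1_right right_inverse)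
qed (simp add: slice_pt_simps)

lemma slice_pt_power: "v \<in> imag_units \<Longrightarrow> slice_pt v (a ^ n) = slice_pt v a ^ n"
  by (induction n) (simp_all add: slice_pt_simps slice_pt_mult)

lemma slice_pt_powi: "v \<in> imag_units \<Longrightarrow> slice_pt v (a powi m) = slice_pt v a powi m"
  by (simp add: power_int_def slice_pt_power slice_pt_inverse)

lemma quat_val_scale:
  assumes "v \<in> imag_units"
  shows "quat_val v (c *s Z) = slice_pt v c * quat_val v Z"
proof -
  define A B where "A = Quat (Re (Z $ 1)) (Re (Z $ 2)) (Re (Z $ 3)) (Re (Z $ 4))"
    and "B = Quat (Im (Z $ 1)) (Im (Z $ 2)) (Im (Z $ 3)) (Im (Z $ 4))"
  have "quat_val v (c *s Z) = (Re c *\<^sub>R A - Im c *\<^sub>R B) + v * (Re c *\<^sub>R B + Im c *\<^sub>R A)"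
    unfolding quat_val_def by (intro arg_cong2[of _ _ _ _ "(+)"] arg_cong[of _ _ "(*) v"]) (simp_all add: A_def B_def quat_eq_iff)
  also have "\<dots> = slice_pt v c * (A + v * B)"
  proof -
    have "v * (v * B) = - B" using imag_unit_square[OF assms] by (simp flip: mult.assoc)
    then show ?thesis by (simp add: slice_pt_scaleR algebra_simps)
  qed
  finally show ?thesis by (simp add: quat_val_def A_def B_def)
qed

lemma quat_val_0 [simp]: "quat_val v 0 = 0"
  by (simp add: quat_val_def quat_eq_iff)

lemma assoc_map_nth:
  "assoc_map f z $ 1 = Complex (qre (stem_re f z)) (qre (stem_im f z))"
  "assoc_map f z $ 2 = Complex (qi (stem_re f z)) (qi (stem_im f z))"
  "assoc_map f z $ 3 = Complex (qj (stem_re f z)) (qj (stem_im f z))"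
  "assoc_map f z $ 4 = Complex (qk (stem_re f z)) (qk (stem_im f z))"
  by (simp_all add: assoc_map_def Let_def)

lemma assoc_map_cnj: "assoc_map f (cnj z) = vec_cnj (assoc_map f z)"
  by (simp add: vec_eq_iff forall_4 assoc_map_nth stem_cnj complex_eq_iff)

lemma quat_val_assoc_map: "quat_val v (assoc_map f z) = stem_re f z + v * stem_im f z"
  by (simp add: quat_val_def assoc_map_nth)

lemma assoc_map_eqI:
  assumes "\<And>v. v \<in> imag_units \<Longrightarrow> f (slice_pt v z) = quat_val v Z"
    and "\<And>v. v \<in> imag_units \<Longrightarrow> f (slice_pt v (cnj z)) = quat_val v (vec_cnj Z)"
  shows "assoc_map f z = Z"
  using assms[OF quat_i_unit]
  by (simp add: vec_eq_iff forall_4 assoc_map_nth complex_eq_iff stem_re_def stem_im_def quat_val_def)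

lemma assoc_map_cong:
  assumes "\<And>v. v \<in> imag_units \<Longrightarrow> f (slice_pt v z) = g (slice_pt v z)"
    and "\<And>v. v \<in> imag_units \<Longrightarrow> f (slice_pt v (cnj z)) = g (slice_pt v (cnj z))"
  shows "assoc_map f z = assoc_map g z"
  using assms[OF quat_i_unit] by (simp add: assoc_map_def stem_re_def stem_im_def)

lemma star_quat_val:
  assumes "v \<in> imag_units"
  shows "(f \<star> g) (slice_pt v z) = quat_val v (cq_mult (assoc_map f z) (assoc_map g z))"
  unfolding star_slice_pt[OF assms] quat_val_def
  by (intro arg_cong2[of _ _ _ _ "(+)"] arg_cong[of _ _ "(*) v"])
     (simp_all add: quat_eq_iff cq_mult_def assoc_map_nth algebra_simps)

text \<open>This holds for arbitrary functions, since the star product is defined by the stems of its factors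
  and every product of stems again has the symmetry of a stem.\<close>

lemma assoc_map_star: "assoc_map (f \<star> g) z = cq_mult (assoc_map f z) (assoc_map g z)"
  by (rule assoc_map_eqI) (simp_all add: star_quat_val assoc_map_cnj vec_cnj_cq)

lemma slice_of_map_val:
  assumes "F (cnj z) = vec_cnj (F z)" "v \<in> imag_units"
  shows "slice_of_map F (slice_pt v z) = quat_val v (F z)"
  unfolding slice_of_map_def quat_val_def using assms
  by (intro slice_fun_slice_pt) (simp_all add: quat_eq_iff)

lemma assoc_map_slice_of_map:
  assumes "F (cnj z) = vec_cnj (F z)"
  shows "assoc_map (slice_of_map F) z = F z"
proof (rule assoc_map_eqI)
  have "F (cnj (cnj z)) = vec_cnj (F (cnj z))" using assms by (simp add: vec_eq_iff)
  then show "slice_of_map F (slice_pt v (cnj z)) = quat_val v (vec_cnj (F z))" if "v \<in> imag_units" for v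
    using slice_of_map_val[of F "cnj z" v] that assms by simp
qed (use assms in \<open>simp add: slice_of_map_val\<close>)

lemma assoc_map_star_inverse:
  "assoc_map (star_inverse f) z = (1 / Phi (assoc_map f z)) *s cq_conj (assoc_map f z)"
proof -
  define F where "F = (\<lambda>z. (1 / Phi (assoc_map f z)) *s cq_conj (assoc_map f z))"
  have "star_inverse f = slice_of_map F"
    unfolding star_inverse_def F_def
    by (intro arg_cong[of _ _ slice_of_map] ext) (simp add: Let_def vec_eq_iff forall_4 cq_conj_def)
  moreover have "F (cnj z) = vec_cnj (F z)" for z
    by (simp add: F_def assoc_map_cnj Phi_vec_cnj vec_cnj_scale vec_cnj_cq)
  ultimately show ?thesis by (simp add: assoc_map_slice_of_map) (simp add: F_def)
qed

lemma assoc_map_linear: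
  "assoc_map (\<lambda>q. q - p) w = vector [w - of_real (qre p), - of_real (qi p), - of_real (qj p), - of_real (qk p)]"
  by (rule assoc_map_eqI) (simp_all add: quat_val_def slice_pt_def quat_eq_iff complex_eq_iff)

text \<open>The maps that are associated with slice-regular functions on \<open>D\<close>. Other finite dimensions occur
  when scalar functions are treated as vectors of length one.\<close>

definition holo_stem :: "complex set \<Rightarrow> (complex \<Rightarrow> complex ^ 'n) \<Rightarrow> bool" where
  "holo_stem D K \<longleftrightarrow> (\<forall>i. (\<lambda>z. K z $ i) holomorphic_on D) \<and> (\<forall>z\<in>D. K (cnj z) = vec_cnj (K z))"

lemma has_derivative_Quat:
  assumes "(a has_derivative a') F" "(b has_derivative b') F" "(c has_derivative c') F" "(d has_derivative d') F"
  shows "((\<lambda>x. Quat (a x) (b x) (c x) (d x)) has_derivative (\<lambda>h. Quat (a' h) (b' h) (c' h) (d' h))) F"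
proof -
  have *: "Quat p q r s = p *\<^sub>R Quat 1 0 0 0 + q *\<^sub>R Quat 0 1 0 0 + r *\<^sub>R Quat 0 0 1 0 + s *\<^sub>R Quat 0 0 0 1" for p q r s
    by (simp add: quat_eq_iff)
  show ?thesis
    by (subst (1 2) *) (intro derivative_intros assms)
qed

lemma bounded_linear_quat_coords:
  "bounded_linear qre" "bounded_linear qi" "bounded_linear qj" "bounded_linear qk"
proof -
  have *: "qre = (\<lambda>q. inner q (Quat 1 0 0 0))" "qi = (\<lambda>q. inner q (Quat 0 1 0 0))"
    "qj = (\<lambda>q. inner q (Quat 0 0 1 0))" "qk = (\<lambda>q. inner q (Quat 0 0 0 1))"
    by (auto simp: inner_quat_def)
  show "bounded_linear qre" "bounded_linear qi" "bounded_linear qj" "bounded_linear qk"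
    by (subst *; rule bounded_linear_inner_left)+
qed

text \<open>The equations required of a stem are the Cauchy--Riemann equations for each of the four real
  components; \<open>l\<close> is one of the coordinate functionals.\<close>

lemma stem_component_differentiable:
  fixes \<alpha> \<beta> :: "complex \<Rightarrow> quat"
  assumes l: "bounded_linear l" and d: "\<alpha> differentiable (at z)" "\<beta> differentiable (at z)"
    and cr: "frechet_derivative \<alpha> (at z) 1 = frechet_derivative \<beta> (at z) \<i>"
      "frechet_derivative \<alpha> (at z) \<i> = - frechet_derivative \<beta> (at z) 1"
  shows "(\<lambda>w. Complex (l (\<alpha> w)) (l (\<beta> w))) field_differentiable (at z)"
proof -
  define L M where "L = frechet_derivative \<alpha> (at z)" and "M = frechet_derivative \<beta> (at z)"
  have L: "(\<alpha> has_derivative L) (at z)" and M: "(\<beta> has_derivative M) (at z)"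
    using d by (auto simp: L_def M_def frechet_derivative_works)
  interpret l: bounded_linear l by fact
  interpret L: bounded_linear L using L by (rule has_derivative_bounded_linear)
  interpret M: bounded_linear M using M by (rule has_derivative_bounded_linear)
  define c where "c = Complex (l (L 1)) (l (M 1))"
  have LM: "L h = Re h *\<^sub>R L 1 + Im h *\<^sub>R L \<i>" "M h = Re h *\<^sub>R M 1 + Im h *\<^sub>R M \<i>" for h
  proof -
    have h: "h = Re h *\<^sub>R 1 + Im h *\<^sub>R \<i>" by (simp add: complex_eq_iff)
    show "L h = Re h *\<^sub>R L 1 + Im h *\<^sub>R L \<i>" by (subst h) (simp only: L.add L.scaleR)
    show "M h = Re h *\<^sub>R M 1 + Im h *\<^sub>R M \<i>" by (subst h) (simp only: M.add M.scaleR)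
  qed
  have "((\<lambda>w. of_real (l (\<alpha> w)) + \<i> * of_real (l (\<beta> w))) has_derivative
      (\<lambda>h. of_real (l (L h)) + \<i> * of_real (l (M h)))) (at z)"
    by (intro has_derivative_add has_derivative_mult_right has_derivative_of_real
        bounded_linear.has_derivative[OF l L] bounded_linear.has_derivative[OF l M])
  also have "(\<lambda>h. of_real (l (L h)) + \<i> * of_real (l (M h))) = (*) c"
  proof
    fix h
    have "l (L h) = Re h * l (L 1) - Im h * l (M 1)" "l (M h) = Re h * l (M 1) + Im h * l (L 1)"
      using cr by (simp_all add: LM[of h] L_def[symmetric] M_def[symmetric] l.add l.diff l.scaleR l.neg)
    then show "of_real (l (L h)) + \<i> * of_real (l (M h)) = c * h"
      by (simp add: c_def complex_eq_iff algebra_simps)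
  qed
  also have "(\<lambda>w. of_real (l (\<alpha> w)) + \<i> * of_real (l (\<beta> w))) = (\<lambda>w. Complex (l (\<alpha> w)) (l (\<beta> w)))"
    by (auto simp: complex_eq_iff)
  finally show ?thesis unfolding field_differentiable_def has_field_derivative_def by blast
qed

lemma slice_regular_assoc_map:
  assumes "slice_regular D f"
  shows "sym_open D" "holo_stem D (assoc_map f)"
    "\<And>z v. z \<in> D \<Longrightarrow> v \<in> imag_units \<Longrightarrow> f (slice_pt v z) = quat_val v (assoc_map f z)"
proof -
  show D: "sym_open D" using assms by (simp add: slice_regular_def)
  obtain \<alpha> \<beta> where st: "regular_stem D \<alpha> \<beta>"
    and val: "\<forall>z\<in>D. \<forall>v\<in>imag_units. f (slice_pt v z) = \<alpha> z + v * \<beta> z"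
    using assms unfolding slice_regular_def by blast
  have eq: "stem_re f z = \<alpha> z" "stem_im f z = \<beta> z" if z: "z \<in> D" for z
  proof -
    have sym: "\<alpha> (cnj z) = \<alpha> z" "\<beta> (cnj z) = - \<beta> z" using st z by (auto simp: regular_stem_def)
    have "cnj z \<in> D" using D z by (simp add: sym_open_def)
    then have vals: "\<And>v. v \<in> imag_units \<Longrightarrow> f (slice_pt v z) = \<alpha> z + v * \<beta> z"
      "\<And>v. v \<in> imag_units \<Longrightarrow> f (slice_pt v (cnj z)) = \<alpha> (cnj z) + v * \<beta> (cnj z)"
      using val z by blast+
    show "stem_re f z = \<alpha> z" by (rule stem_re_eq[OF sym vals])
    show "stem_im f z = \<beta> z" by (rule stem_im_eq[OF sym vals])
  qed
  show "f (slice_pt v z) = quat_val v (assoc_map f z)" if "z \<in> D" "v \<in> imag_units" for z v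
    using val that by (simp add: quat_val_assoc_map eq)
  have hol: "(\<lambda>w. Complex (l (\<alpha> w)) (l (\<beta> w))) holomorphic_on D" if "bounded_linear l" for l
  proof -
    have "(\<lambda>w. Complex (l (\<alpha> w)) (l (\<beta> w))) field_differentiable (at z)" if "z \<in> D" for z
      using st that unfolding regular_stem_def
      by (intro stem_component_differentiable[OF \<open>bounded_linear l\<close>]) simp_all
    then show ?thesis by (simp add: field_differentiable_at_within holomorphic_on_def)
  qed
  have "\<forall>i. (\<lambda>z. assoc_map f z $ i) holomorphic_on D"
    unfolding forall_4 by (intro conjI;
      rule holomorphic_transform[OF hol[OF bounded_linear_quat_coords(1)]]
        holomorphic_transform[OF hol[OF bounded_linear_quat_coords(2)]]
        holomorphic_transform[OF hol[OF bounded_linear_quat_coords(3)]]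
        holomorphic_transform[OF hol[OF bounded_linear_quat_coords(4)]];
      simp add: assoc_map_nth eq)
  then show "holo_stem D (assoc_map f)" by (simp add: holo_stem_def assoc_map_cnj)
qed

lemma slice_regularI:
  assumes D: "sym_open D" and K: "holo_stem D K"
    and val: "\<And>z v. z \<in> D \<Longrightarrow> v \<in> imag_units \<Longrightarrow> f (slice_pt v z) = quat_val v (K z)"
  shows "slice_regular D f"
proof -
  define \<alpha> \<beta> where "\<alpha> z = Quat (Re (K z $ 1)) (Re (K z $ 2)) (Re (K z $ 3)) (Re (K z $ 4))"
    and "\<beta> z = Quat (Im (K z $ 1)) (Im (K z $ 2)) (Im (K z $ 3)) (Im (K z $ 4))" for z
  have sym: "K (cnj z) = vec_cnj (K z)" if "z \<in> D" for z using K that by (simp add: holo_stem_def)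
  have "\<exists>d. \<forall>i. ((\<lambda>z. K z $ i) has_field_derivative d i) (at z)" if "z \<in> D" for z
    using K that D unfolding holo_stem_def sym_open_def
    by (intro choice allI) (metis field_differentiable_def holomorphic_on_imp_differentiable_at)
  then obtain d where d: "\<And>z i. z \<in> D \<Longrightarrow> ((\<lambda>z. K z $ i) has_field_derivative d z i) (at z)" by metis
  have \<alpha>': "(\<alpha> has_derivative (\<lambda>h. Quat (Re (d z 1 * h)) (Re (d z 2 * h)) (Re (d z 3 * h)) (Re (d z 4 * h)))) (at z)"
    and \<beta>': "(\<beta> has_derivative (\<lambda>h. Quat (Im (d z 1 * h)) (Im (d z 2 * h)) (Im (d z 3 * h)) (Im (d z 4 * h)))) (at z)"
    if "z \<in> D" for z
    unfolding \<alpha>_def \<beta>_def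
    by (rule has_derivative_Quat; rule bounded_linear.has_derivative[OF bounded_linear_Re]
          bounded_linear.has_derivative[OF bounded_linear_Im];
        rule d[OF that, unfolded has_field_derivative_def])+
  have "regular_stem D \<alpha> \<beta>"
    unfolding regular_stem_def
  proof (intro conjI ballI)
    fix z assume z: "z \<in> D"
    show "\<alpha> (cnj z) = \<alpha> z" "\<beta> (cnj z) = - \<beta> z"
      using sym[OF z] by (simp_all add: \<alpha>_def \<beta>_def quat_eq_iff)
    show "\<alpha> differentiable (at z)" "\<beta> differentiable (at z)"
      using \<alpha>'[OF z] \<beta>'[OF z] by (auto intro: differentiableI)
    show "frechet_derivative \<alpha> (at z) 1 = frechet_derivative \<beta> (at z) \<i>"
      "frechet_derivative \<alpha> (at z) \<i> = - frechet_derivative \<beta> (at z) 1"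
      unfolding frechet_derivative_at[OF \<alpha>'[OF z], symmetric] frechet_derivative_at[OF \<beta>'[OF z], symmetric]
      by (simp_all add: quat_eq_iff)
  qed
  moreover have "\<forall>z\<in>D. \<forall>v\<in>imag_units. f (slice_pt v z) = \<alpha> z + v * \<beta> z"
    using val by (simp add: quat_val_def \<alpha>_def \<beta>_def)
  ultimately show ?thesis using D unfolding slice_regular_def by blast
qed

lemma slice_regular_slice_of_map:
  assumes "sym_open D" "holo_stem D K"
  shows "slice_regular D (slice_of_map K)"
  using assms by (intro slice_regularI[OF assms]) (auto simp: holo_stem_def slice_of_map_val)

lemma sphere_of_cnj: "sphere_of (cnj z) = sphere_of z"
  unfolding sphere_of_def using imag_unit_uminus slice_pt_simps(6) by (metis (no_types, lifting) complex_cnj_cnj)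

lemma slice_pt_in_sphere_iff:
  assumes "v \<in> imag_units"
  shows "slice_pt v w \<in> sphere_of z \<longleftrightarrow> w = z \<or> w = cnj z"
proof -
  have "axial {z, cnj z} = sphere_of z"
    using sphere_of_cnj[of z] by (auto simp: axial_def sphere_of_def)
  then show ?thesis using slice_pt_in_axial_iff[of "{z, cnj z}" v w] assms by auto
qed

section \<open>Order of a stem at a sphere\<close>

text \<open>The monic real polynomial of least degree that vanishes at \<open>z\<close>. Treating the real point and the
  non-real sphere by one polynomial with a simple zero at \<open>z\<close> avoids a separate theory for real points.\<close>

definition node :: "complex \<Rightarrow> complex \<Rightarrow> complex" where
  "node z w = (w - z) * (if Im z = 0 then 1 else w - cnj z)"

lemma node_eq_0_iff: "node z w = 0 \<longleftrightarrow> w = z \<or> w = cnj z"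
proof (cases "Im z = 0")
  case True
  then have "cnj z = z" by (simp add: complex_eq_iff)
  then show ?thesis using True by (simp add: node_def)
qed (simp add: node_def)

lemma node_cnj: "node z (cnj w) = cnj (node z w)"
proof (cases "Im z = 0")
  case True
  then have "cnj z = z" by (simp add: complex_eq_iff)
  then show ?thesis using True by (simp add: node_def)
qed (simp add: node_def)

lemma node_holomorphic [holomorphic_intros]: "node z holomorphic_on D"
  unfolding node_def by (cases "Im z = 0") (auto intro!: holomorphic_intros)

lemma node_nonreal:
  assumes "Im z \<noteq> 0"
  shows "node z w = (w - of_real (Re z))\<^sup>2 + (of_real (Im z))\<^sup>2"
  using assms by (simp add: node_def complex_eq_iff power2_eq_square algebra_simps)

lemma sym_openD: "sym_open D \<Longrightarrow> open D" "sym_open D \<Longrightarrow> z \<in> D \<Longrightarrow> cnj z \<in> D"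
  by (auto simp: sym_open_def)

text \<open>Cancelling \<^const>\<open>node\<close> proves identities away from \<open>z\<close> and its conjugate only; continuity
  supplies these two points.\<close>

lemma eq_off_finite:
  fixes f g :: "complex \<Rightarrow> complex"
  assumes "open D" "finite X" "continuous_on D f" "continuous_on D g"
    and eq: "\<And>w. w \<in> D - X \<Longrightarrow> f w = g w" and w: "w \<in> D"
  shows "f w = g w"
proof -
  have "\<forall>\<^sub>F x in at w. x \<notin> X"
    using islimpt_finite[OF assms(2), of w] by (simp add: islimpt_iff_eventually)
  moreover have "\<forall>\<^sub>F x in at w. x \<in> D"
    by (rule eventually_at_in_open'[OF assms(1) w])
  ultimately have ev: "\<forall>\<^sub>F x in at w. f x = g x"
    by eventually_elim (rule eq, simp)
  have "(f \<longlongrightarrow> f w) (at w)" "(g \<longlongrightarrow> g w) (at w)"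
    using assms(3,4) continuous_on_eq_continuous_at[OF assms(1)] w unfolding isCont_def by blast+
  then have "(g \<longlongrightarrow> f w) (at w)" "(g \<longlongrightarrow> g w) (at w)"
    using Lim_transform_eventually[OF _ ev] by blast+
  then show ?thesis by (rule tendsto_unique[rotated]) simp
qed

lemma eq_off_finite_vec:
  fixes K L :: "complex \<Rightarrow> complex ^ 'n"
  assumes "open D" "finite X" "\<And>i. continuous_on D (\<lambda>w. K w $ i)" "\<And>i. continuous_on D (\<lambda>w. L w $ i)"
    and "\<And>w. w \<in> D - X \<Longrightarrow> K w = L w" "w \<in> D"
  shows "K w = L w"
proof -
  have "K w $ i = L w $ i" for i
    by (rule eq_off_finite[OF assms(1-4) _ assms(6)]) (simp add: assms(5))
  then show ?thesis by (simp add: vec_eq_iff)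
qed

lemma holo_stem_continuous: "holo_stem D K \<Longrightarrow> continuous_on D (\<lambda>w. K w $ i)"
  by (simp add: holo_stem_def holomorphic_on_imp_continuous_on)

lemma holomorphic_divide_node:
  assumes D: "open D" and f: "f holomorphic_on D" "f z = 0" "f (cnj z) = 0" and z: "z \<in> D" "cnj z \<in> D"
  shows "\<exists>g. g holomorphic_on D \<and> (\<forall>w\<in>D. f w = node z w * g w)"
proof -
  have div: "\<exists>g. g holomorphic_on D \<and> (\<forall>w. f w = (w - a) * g w)"
    if "f holomorphic_on D" "f a = 0" for f :: "complex \<Rightarrow> complex" and a
  proof (intro exI conjI)
    show "(\<lambda>w. if w = a then deriv f a else f w / (w - a)) holomorphic_on D"
      by (rule pole_theorem_open_0[OF that(1) D, of a]) (use that in auto)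
  qed (use that in auto)
  obtain g where g: "g holomorphic_on D" "\<forall>w. f w = (w - z) * g w" using div[OF f(1,2)] by blast
  show ?thesis
  proof (cases "Im z = 0")
    case True then show ?thesis using g by (auto simp: node_def)
  next
    case False
    then have "g (cnj z) = 0" using g(2) f(3) by (auto simp: complex_eq_iff)
    then obtain h where h: "h holomorphic_on D" "\<forall>w. g w = (w - cnj z) * h w" using div[OF g(1)] by blast
    have "\<forall>w\<in>D. f w = node z w * h w" using g(2) h(2) False by (simp add: node_def)
    then show ?thesis using h(1) by blast
  qed
qed

text \<open>A stem that vanishes at \<open>z\<close> also vanishes at the conjugate of \<open>z\<close>, and the quotient is again
  symmetric because \<^const>\<open>node\<close> is real.\<close>

lemma holo_stem_divide_node:
  assumes D: "sym_open D" "z \<in> D" and K: "holo_stem D K" "K z = 0"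
  obtains L where "holo_stem D L" "\<And>w. w \<in> D \<Longrightarrow> K w = node z w *s L w"
proof -
  have cz: "cnj z \<in> D" "K (cnj z) = 0"
    using D K by (auto simp: holo_stem_def sym_open_def vec_eq_iff)
  have "\<exists>g. g holomorphic_on D \<and> (\<forall>w\<in>D. K w $ i = node z w * g w)" for i
    using K D cz by (intro holomorphic_divide_node) (auto simp: holo_stem_def sym_open_def)
  then obtain g where g: "\<And>i. g i holomorphic_on D" "\<And>i w. w \<in> D \<Longrightarrow> K w $ i = node z w * g i w" by metis
  define L where "L w = (\<chi> i. g i w)" for w
  have KL: "K w = node z w *s L w" if "w \<in> D" for w
    using g(2)[OF that] by (simp add: L_def vec_eq_iff)
  have contL: "continuous_on D (\<lambda>w. L w $ i)" for i
    using g(1) by (simp add: L_def holomorphic_on_imp_continuous_on)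
  have "L (cnj w) = vec_cnj (L w)" if "w \<in> D" for w
  proof (rule eq_off_finite_vec[of D "{z, cnj z}" "\<lambda>w. L (cnj w)" "\<lambda>w. vec_cnj (L w)"])
    show "continuous_on D (\<lambda>w. L (cnj w) $ i)" for i
      using contL D(1) by (intro continuous_on_compose2[OF contL]) (auto intro!: continuous_intros simp: sym_open_def)
    show "continuous_on D (\<lambda>w. vec_cnj (L w) $ i)" for i
      using contL by (auto intro!: continuous_intros)
    fix w assume w: "w \<in> D - {z, cnj z}"
    then have "node z w \<noteq> 0" "cnj w \<in> D" using D by (auto simp: node_eq_0_iff sym_open_def)
    moreover have "node z (cnj w) *s L (cnj w) = vec_cnj (node z w *s L w)"
      using KL[of w] KL[of "cnj w"] K(1) w \<open>cnj w \<in> D\<close> by (simp add: holo_stem_def)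
    ultimately show "L (cnj w) = vec_cnj (L w)"
      by (simp add: vec_cnj_scale node_cnj vec_eq_iff)
  qed (use D that in \<open>auto simp: sym_open_def\<close>)
  then have "holo_stem D L" using g(1) by (simp add: holo_stem_def L_def)
  then show ?thesis using KL that by blast
qed

lemma zorder_node: "zorder (node z) z = 1"
proof (rule zorder_eqI[of UNIV z "\<lambda>w. if Im z = 0 then 1 else w - cnj z"])
  show "(\<lambda>w. if Im z = 0 then 1 else w - cnj z) holomorphic_on UNIV" by (cases "Im z = 0") (auto intro!: holomorphic_intros)
qed (auto simp: node_def complex_eq_iff)

lemma analytic_eventually_nonzero:
  assumes "f analytic_on {z}" "\<exists>\<^sub>F w in at z. f w \<noteq> 0"
  shows "\<forall>\<^sub>F w in at z. f w \<noteq> 0"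
  by (rule non_zero_neighbour[OF isolated_singularity_at_analytic[OF assms(1)] not_essential_analytic[OF assms(1)] assms(2)])

text \<open>Division by \<^const>\<open>node\<close> lowers the order at \<open>z\<close> of a component that does not vanish
  identically, so it can be repeated only finitely often.\<close>

lemma holo_stem_strip_node:
  fixes K :: "complex \<Rightarrow> complex ^ 'n"
  assumes D: "sym_open D" "z \<in> D" and K: "holo_stem D K" "\<exists>\<^sub>F w in at z. K w $ i \<noteq> 0"
  shows "\<exists>k L. holo_stem D L \<and> L z \<noteq> 0 \<and> (\<forall>w\<in>D. K w = node z w ^ k *s L w)"
  using K
proof (induction "nat (zorder (\<lambda>w. K w $ i) z)" arbitrary: K rule: less_induct)
  case (less K)
  have oD: "open D" using D by (simp add: sym_open_def)
  show ?case
  proof (cases "K z = 0")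
    case False
    then show ?thesis using less.prems by (intro exI[of _ 0] exI[of _ K]) auto
  next
    case True
    obtain L where L: "holo_stem D L" and KL: "\<And>w. w \<in> D \<Longrightarrow> K w = node z w *s L w"
      using holo_stem_divide_node[OF D less.prems(1) True] by blast
    have an: "(\<lambda>w. L w $ i) analytic_on {z}" "(\<lambda>w. K w $ i) analytic_on {z}" "node z analytic_on {z}"
      using L less.prems(1) D oD by (auto simp: holo_stem_def analytic_at intro!: node_holomorphic)
    have inD: "\<forall>\<^sub>F w in at z. w \<in> D" using eventually_at_in_open'[OF oD D(2)] .
    then have KLev: "\<forall>\<^sub>F w in at z. K w $ i = node z w * L w $ i"
      by eventually_elim (simp add: KL)
    have nzK: "\<forall>\<^sub>F w in at z. K w $ i \<noteq> 0"
      using analytic_eventually_nonzero[OF an(2) less.prems(2)] .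
    then have nz: "\<forall>\<^sub>F w in at z. node z w * L w $ i \<noteq> 0"
      using KLev by eventually_elim simp
    then have nzL: "\<exists>\<^sub>F w in at z. L w $ i \<noteq> 0"
      by (intro eventually_frequently) (auto elim: eventually_mono)
    have "zorder (\<lambda>w. K w $ i) z = zorder (\<lambda>w. node z w * L w $ i) z"
      using KLev by (intro zorder_cong) auto
    also have "\<dots> = 1 + zorder (\<lambda>w. L w $ i) z"
      using zorder_times_analytic[OF an(3,1) nz] by (simp add: zorder_node)
    finally have "nat (zorder (\<lambda>w. L w $ i) z) < nat (zorder (\<lambda>w. K w $ i) z)"
      using zorder_ge_0[OF an(1) nzL] by simp
    from less.hyps[OF this L nzL] obtain k M where
      "holo_stem D M" "M z \<noteq> 0" "\<forall>w\<in>D. L w = node z w ^ k *s M w" by blast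
    then show ?thesis using KL by (intro exI[of _ "Suc k"] exI[of _ M]) (simp add: vec_eq_iff algebra_simps)
  qed
qed

text \<open>The case of vectors of length one.\<close>

lemma holomorphic_strip_node:
  assumes D: "sym_open D" "z \<in> D" and f: "f holomorphic_on D" "\<And>w. w \<in> D \<Longrightarrow> f (cnj w) = cnj (f w)"
    "\<exists>\<^sub>F w in at z. f w \<noteq> 0"
  shows "\<exists>k g. g holomorphic_on D \<and> (\<forall>w\<in>D. g (cnj w) = cnj (g w)) \<and> g z \<noteq> 0 \<and> (\<forall>w\<in>D. f w = node z w ^ k * g w)"
proof -
  define K :: "complex \<Rightarrow> complex ^ 1" where "K w = (\<chi> i. f w)" for w
  have "holo_stem D K" using f by (simp add: holo_stem_def K_def vec_eq_iff)
  moreover have "\<exists>\<^sub>F w in at z. K w $ 1 \<noteq> 0" using f by (simp add: K_def)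
  ultimately obtain k L where "holo_stem D L" "L z \<noteq> 0" "\<forall>w\<in>D. K w = node z w ^ k *s L w"
    using holo_stem_strip_node[OF D] by blast
  then show ?thesis
    by (intro exI[of _ k] exI[of _ "\<lambda>w. L w $ 1"]) (auto simp: holo_stem_def K_def vec_eq_iff forall_1)
qed

lemma Phi_holomorphic:
  assumes "holo_stem D K"
  shows "(\<lambda>w. Phi (K w)) holomorphic_on D"
  unfolding Phi_def using assms by (auto simp: holo_stem_def intro!: holomorphic_intros)

lemma Phi_sym: "holo_stem D K \<Longrightarrow> w \<in> D \<Longrightarrow> Phi (K (cnj w)) = cnj (Phi (K w))"
  by (simp add: holo_stem_def Phi_vec_cnj)

lemma holo_stem_cq_mult:
  assumes "holo_stem D K" "holo_stem D L"
  shows "holo_stem D (\<lambda>w. cq_mult (K w) (L w))"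
  using assms unfolding holo_stem_def forall_4
  by (auto simp: vec_cnj_cq) (auto simp: cq_mult_def intro!: holomorphic_intros)

lemma holo_stem_cq_conj:
  assumes "holo_stem D K"
  shows "holo_stem D (\<lambda>w. cq_conj (K w))"
  using assms unfolding holo_stem_def forall_4
  by (auto simp: vec_cnj_cq) (auto simp: cq_conj_def intro!: holomorphic_intros)

lemma holo_stem_scale:
  assumes "holo_stem D K" "f holomorphic_on D" "\<And>w. w \<in> D \<Longrightarrow> f (cnj w) = cnj (f w)"
  shows "holo_stem D (\<lambda>w. f w *s K w)"
  using assms unfolding holo_stem_def by (auto simp: vec_cnj_scale intro!: holomorphic_intros)

lemma holo_stem_subset: "holo_stem D K \<Longrightarrow> E \<subseteq> D \<Longrightarrow> holo_stem E K"
  unfolding holo_stem_def by (auto intro: holomorphic_on_subset)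

section \<open>Linear factors and multiplicities\<close>

text \<open>Write \<open>Z = \<alpha> + \<i> \<beta>\<close>. The real and imaginary parts of \<open>\<Phi> Z = 0\<close> say that \<open>\<alpha>\<close> and \<open>\<beta>\<close> have the
  same length and are orthogonal, so \<open>v = - \<alpha> \<beta>\<^sup>-\<^sup>1\<close> has length one and real part zero.\<close>

lemma quat_val_zero_of_isotropic:
  assumes "Z \<noteq> 0" "Phi Z = 0"
  obtains v where "v \<in> imag_units" "quat_val v Z = 0"
proof -
  define A B where "A = Quat (Re (Z $ 1)) (Re (Z $ 2)) (Re (Z $ 3)) (Re (Z $ 4))"
    and "B = Quat (Im (Z $ 1)) (Im (Z $ 2)) (Im (Z $ 3)) (Im (Z $ 4))"
  have "Re (Phi Z) = inner A A - inner B B" "Im (Phi Z) = 2 * inner A B"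
    by (simp_all add: Phi_def A_def B_def inner_quat_def power2_eq_square)
  then have AB: "inner A A = inner B B" "inner A B = 0" using assms(2) by simp_all
  have "B \<noteq> 0"
  proof
    assume "B = 0"
    then have "A = 0" using AB(1) by simp
    then have "Z = 0" using \<open>B = 0\<close>
      by (simp add: A_def B_def quat_eq_iff vec_eq_iff forall_4 complex_eq_iff)
    then show False using assms(1) by simp
  qed
  define v where "v = - (A * inverse B)"
  have "qre (A * inverse B) = inner A B / inner B B"
    by (simp add: inverse_quat_def inner_quat_def divide_inverse algebra_simps)
  then have re: "qre v = 0" using AB(2) by (simp add: v_def)
  have "norm A = norm B" using AB(1) by (simp add: norm_quat_def)
  then have "norm v = 1" using \<open>B \<noteq> 0\<close> by (simp add: v_def norm_mult norm_inverse)
  then have "inner v v = 1" by (simp add: norm_quat_def)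
  then have "v \<in> imag_units" using re by (simp add: imag_units_iff inner_quat_def power2_eq_square)
  moreover have "quat_val v Z = 0"
    using \<open>B \<noteq> 0\<close> by (simp add: quat_val_def v_def mult.assoc flip: A_def B_def)
  ultimately show ?thesis using that by blast
qed

text \<open>At \<open>z = x + \<i> y\<close> the conjugate of \<open>q - (x + v y)\<close> has the value \<open>y (\<i> + v)\<close>, and
  \<open>(\<i> + v) (\<alpha> + \<i> \<beta>) = (v + \<i>) (\<alpha> + v \<beta>)\<close> because \<open>v\<^sup>2 = - 1\<close>.\<close>

lemma conj_linear_kills_zero:
  assumes v: "v \<in> imag_units" and Z: "quat_val v Z = 0"
  shows "cq_mult (cq_conj (assoc_map (\<lambda>q. q - slice_pt v z) z)) Z = 0"
proof -
  have v0: "qre v = 0" and v1: "qi v * qi v + qj v * qj v + qk v * qk v = 1"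
    using v by (simp_all add: imag_units_iff power2_eq_square)
  define a b c where "a = qi v" "b = qj v" "c = qk v"
  have abc: "a * a + b * b + c * c = 1" using v1 by (simp add: a_b_c_def)
  have e1: "Re (Z $ 1) = a * Im (Z $ 2) + b * Im (Z $ 3) + c * Im (Z $ 4)"
    and e2: "Re (Z $ 2) = - (a * Im (Z $ 1) + b * Im (Z $ 4) - c * Im (Z $ 3))"
    and e3: "Re (Z $ 3) = - (- a * Im (Z $ 4) + b * Im (Z $ 1) + c * Im (Z $ 2))"
    and e4: "Re (Z $ 4) = - (a * Im (Z $ 3) - b * Im (Z $ 2) + c * Im (Z $ 1))"
    using Z v0 by (simp_all add: quat_val_def quat_eq_iff a_b_c_def)
  have "cq_conj (assoc_map (\<lambda>q. q - slice_pt v z) z) = of_real (Im z) *s vector [\<i>, of_real a, of_real b, of_real c]"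
    unfolding assoc_map_linear
    by (simp add: cq_conj_def vec_eq_iff forall_4 slice_pt_def complex_eq_iff v0 a_b_c_def)
  moreover have "cq_mult (vector [\<i>, of_real a, of_real b, of_real c]) Z = 0"
    unfolding vec_eq_iff forall_4 cq_mult_def vector_4 complex_eq_iff
    by (simp add: e1 e2 e3 e4) (use abc in \<open>safe; algebra\<close>)
  ultimately show ?thesis by (simp add: cq_mult_scale)
qed

lemma Phi_linear:
  assumes "Im z \<noteq> 0" "p \<in> sphere_of z"
  shows "Phi (assoc_map (\<lambda>q. q - p) w) = node z w"
proof -
  obtain v where v: "v \<in> imag_units" "p = slice_pt v z" using assms by (auto simp: sphere_of_def)
  have v0: "qre v = 0" and "(qi v)\<^sup>2 + (qj v)\<^sup>2 + (qk v)\<^sup>2 = 1" using v(1) by (auto simp: imag_units_iff)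
  then have "of_real ((qi v)\<^sup>2 + (qj v)\<^sup>2 + (qk v)\<^sup>2) = (1 :: complex)" by (simp only: of_real_1)
  then have s: "(of_real (qi v))\<^sup>2 + (of_real (qj v))\<^sup>2 + (of_real (qk v))\<^sup>2 = (1 :: complex)"
    by (simp only: of_real_add of_real_power)
  have "Phi (assoc_map (\<lambda>q. q - p) w) = (w - of_real (Re z))\<^sup>2 + (of_real (qi v) * of_real (Im z))\<^sup>2
      + (of_real (qj v) * of_real (Im z))\<^sup>2 + (of_real (qk v) * of_real (Im z))\<^sup>2"
    unfolding assoc_map_linear Phi_def vector_4 by (simp add: v(2) slice_pt_def v0)
  also have "\<dots> = (w - of_real (Re z))\<^sup>2 + (of_real (Im z))\<^sup>2"
    using s by algebra
  finally show ?thesis unfolding node_nonreal[OF assms(1)] .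
qed

lemma holo_stem_linear: "holo_stem D (assoc_map (\<lambda>q. q - p))"
  unfolding holo_stem_def forall_4 assoc_map_cnj
  by (auto simp: assoc_map_linear intro!: holomorphic_intros)

lemma cq_mult_zero: "cq_mult Z 0 = 0"
  by (simp add: cq_mult_def vec_eq_iff forall_4)

text \<open>If \<open>p\<close> is the zero of \<open>H\<close> on the sphere, the product of \<open>H\<close> with the conjugate of \<open>q - p\<close>
  vanishes at \<open>z\<close> and is divisible by \<^const>\<open>node\<close>, which is the product of \<open>q - p\<close> with its
  conjugate. The quotient is the cofactor.\<close>

lemma extract_linear_factor:
  assumes z: "Im z \<noteq> 0" and D: "sym_open D" "z \<in> D" and H: "holo_stem D H" "H z \<noteq> 0" "Phi (H z) = 0"
  obtains p L where "p \<in> sphere_of z" "holo_stem D L" "\<And>w. w \<in> D \<Longrightarrow> H w = cq_mult (assoc_map (\<lambda>q. q - p) w) (L w)"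
proof -
  obtain v where v: "v \<in> imag_units" "quat_val v (H z) = 0"
    using quat_val_zero_of_isotropic[OF H(2,3)] by blast
  define p where "p = slice_pt v z"
  have p: "p \<in> sphere_of z" using v by (auto simp: p_def sphere_of_def)
  define l where "l = assoc_map (\<lambda>q. q - p)"
  have l: "holo_stem D l" unfolding l_def by (rule holo_stem_linear)
  define M where "M w = cq_mult (cq_conj (l w)) (H w)" for w
  have "holo_stem D M" unfolding M_def by (intro holo_stem_cq_mult holo_stem_cq_conj l H)
  moreover have "M z = 0" unfolding M_def l_def p_def by (rule conj_linear_kills_zero[OF v])
  ultimately obtain L where L: "holo_stem D L" "\<And>w. w \<in> D \<Longrightarrow> M w = node z w *s L w"
    using holo_stem_divide_node[OF D] by blast
  have lL: "holo_stem D (\<lambda>w. cq_mult (l w) (L w))" by (intro holo_stem_cq_mult l L)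
  have "H w = cq_mult (l w) (L w)" if w: "w \<in> D" for w
  proof (rule eq_off_finite_vec[OF sym_openD(1)[OF D(1)] _ holo_stem_continuous[OF H(1)] holo_stem_continuous[OF lL] _ w, of "{z, cnj z}"])
    fix x assume x: "x \<in> D - {z, cnj z}"
    have "node z x *s H x = cq_mult (l x) (M x)"
      using Phi_linear[OF z p, of x] unfolding M_def cq_mult_conj l_def by simp
    also have "\<dots> = node z x *s cq_mult (l x) (L x)" using L(2) x by (simp add: cq_mult_scale)
    finally show "H x = cq_mult (l x) (L x)" using x by (simp add: vec_eq_iff node_eq_0_iff)
  qed simp
  then show ?thesis using that p L(1) unfolding l_def by blast
qed

lemma factor_linear:
  assumes z: "Im z \<noteq> 0" and D: "sym_open D" "z \<in> D" and H: "holo_stem D H" "H z \<noteq> 0"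
    and c: "c holomorphic_on D" "c z \<noteq> 0" "\<And>w. w \<in> D \<Longrightarrow> Phi (H w) = node z w ^ n * c w"
  shows "\<exists>ps G. length ps = n \<and> set ps \<subseteq> sphere_of z \<and> holo_stem D G \<and> Phi (G z) \<noteq> 0 \<and>
    (\<forall>w\<in>D. H w = foldr (\<lambda>p. cq_mult (assoc_map (\<lambda>q. q - p) w)) ps (G w))"
  using H c(3)
proof (induction n arbitrary: H)
  case 0
  have "Phi (H z) \<noteq> 0" using 0(3)[OF D(2)] c(2) by simp
  then show ?case using 0 by (intro exI[of _ "[]"] exI[of _ H]) simp
next
  case (Suc n)
  have "Phi (H z) = 0" using Suc.prems(3)[OF D(2)] by (simp add: node_eq_0_iff)
  then obtain p L where p: "p \<in> sphere_of z" and L: "holo_stem D L"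
    and HL: "\<And>w. w \<in> D \<Longrightarrow> H w = cq_mult (assoc_map (\<lambda>q. q - p) w) (L w)"
    using extract_linear_factor[OF z D Suc.prems(1,2)] by blast
  have "L z \<noteq> 0" using HL[OF D(2)] Suc.prems(2) by (auto simp: cq_mult_zero)
  moreover have "Phi (L w) = node z w ^ n * c w" if w: "w \<in> D" for w
  proof (rule eq_off_finite[OF sym_openD(1)[OF D(1)] _ _ _ _ w, of "{z, cnj z}"])
    fix x assume x: "x \<in> D - {z, cnj z}"
    have "node z x * Phi (L x) = node z x ^ Suc n * c x"
      using HL[of x] Suc.prems(3)[of x] x Phi_linear[OF z p, of x] by (simp add: Phi_cq_mult)
    then show "Phi (L x) = node z x ^ n * c x" using x by (simp add: node_eq_0_iff)
  qed (auto intro!: holomorphic_on_imp_continuous_on Phi_holomorphic L holomorphic_intros c)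
  ultimately obtain ps G where "length ps = n" "set ps \<subseteq> sphere_of z" "holo_stem D G" "Phi (G z) \<noteq> 0"
    "\<forall>w\<in>D. L w = foldr (\<lambda>p. cq_mult (assoc_map (\<lambda>q. q - p) w)) ps (G w)"
    using Suc.IH[OF L] by blast
  then show ?case using p HL by (intro exI[of _ "p # ps"] exI[of _ G]) simp
qed

text \<open>The two definitions of order, at real points and at spheres, in terms of stems: \<open>m\<close> is the exponent
  of \<^const>\<open>node\<close> in the stem and \<open>n\<close> the exponent in \<open>\<Phi>\<close> of the remaining factor.\<close>

definition stem_factor :: "(complex \<Rightarrow> complex ^ 4) \<Rightarrow> complex \<Rightarrow> int \<Rightarrow> nat \<Rightarrow> complex set \<Rightarrow> (complex \<Rightarrow> complex ^ 4) \<Rightarrow> bool" where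
  "stem_factor K z m n D H \<longleftrightarrow> sym_open D \<and> z \<in> D \<and> holo_stem D H \<and> H z \<noteq> 0 \<and>
     (\<forall>w\<in>D - {z, cnj z}. K w = (node z w powi m) *s H w) \<and>
     (\<exists>c. c holomorphic_on D \<and> c z \<noteq> 0 \<and> (\<forall>w\<in>D. Phi (H w) = node z w ^ n * c w))"

lemma stem_factor_zorder:
  assumes "stem_factor K z m n D H"
  shows "zorder (\<lambda>w. Phi (K w)) z = 2 * m + int n"
proof -
  obtain c where c: "c holomorphic_on D" "c z \<noteq> 0" "\<And>w. w \<in> D \<Longrightarrow> Phi (H w) = node z w ^ n * c w"
    using assms unfolding stem_factor_def by blast
  have D: "sym_open D" "open D" "z \<in> D" and K: "\<And>w. w \<in> D - {z, cnj z} \<Longrightarrow> K w = (node z w powi m) *s H w"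
    using assms by (auto simp: stem_factor_def sym_open_def)
  define e where "e w = (if Im z = 0 then 1 else w - cnj z)" for w
  have e: "e holomorphic_on A" for A unfolding e_def by (cases "Im z = 0") (auto intro!: holomorphic_intros)
  have ez: "e z \<noteq> 0" by (auto simp: e_def complex_eq_iff)
  define S where "S = D \<inter> e -` (- {0})"
  show ?thesis
  proof (rule zorder_eqI[of S z "\<lambda>w. e w powi (2 * m + int n) * c w"])
    show "open S" unfolding S_def
      by (intro continuous_open_preimage holomorphic_on_imp_continuous_on e D) auto
    show "z \<in> S" using D ez by (simp add: S_def)
    show "(\<lambda>w. e w powi (2 * m + int n) * c w) holomorphic_on S"
      using c(1) by (intro holomorphic_intros e) (auto simp: S_def elim: holomorphic_on_subset)
    show "e z powi (2 * m + int n) * c z \<noteq> 0" using ez c by simp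
    fix w assume w: "w \<in> S" "w \<noteq> z"
    have nw: "node z w = (w - z) * e w" by (simp add: node_def e_def)
    then have n0: "node z w \<noteq> 0" using w by (simp add: S_def)
    then have "w \<in> D - {z, cnj z}" using w by (auto simp: S_def node_eq_0_iff)
    then have "Phi (K w) = (node z w powi m)\<^sup>2 * (node z w ^ n * c w)"
      using K c(3) by (simp add: Phi_scale)
    also have "(node z w powi m)\<^sup>2 = node z w powi (2 * m)"
      by (simp add: power_int_mult mult.commute flip: power_int_power')
    also have "\<dots> * (node z w ^ n * c w) = node z w powi (2 * m + int n) * c w"
      using n0 by (simp add: power_int_add)
    finally show "Phi (K w) = e w powi (2 * m + int n) * c w * (w - z) powi (2 * m + int n)"
      by (simp add: nw power_int_mult_distrib)
  qed
qed

text \<open>Two exponents \<open>m < m'\<close> would make \<open>H\<close> a multiple of \<^const>\<open>node\<close> and so \<open>H z = 0\<close>. Once \<open>m\<close> is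
  known, \<open>n\<close> is determined by the order of \<open>\<Phi> \<circ> K\<close>.\<close>

lemma stem_factor_unique:
  assumes 1: "stem_factor K z m n D H" and 2: "stem_factor K z m' n' D' H'"
  shows "m = m'" "n = n'"
proof -
  have le: "m' \<le> m" if "stem_factor K z m n D H" "stem_factor K z m' n' D' H'" for m n D H m' n' D' H'
  proof (rule ccontr)
    assume "\<not> m' \<le> m"
    define k where "k = nat (m' - m)"
    have k: "m' = m + int k" "k > 0" using \<open>\<not> m' \<le> m\<close> by (auto simp: k_def)
    define E where "E = D \<inter> D'"
    have E: "open E" "z \<in> E" using that by (auto simp: E_def stem_factor_def sym_open_def)
    have hs: "holo_stem E H" "holo_stem E H'"
      using that holo_stem_subset[of D H E] holo_stem_subset[of D' H' E] by (auto simp: E_def stem_factor_def)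
    have "H z = node z z ^ k *s H' z"
    proof (rule eq_off_finite_vec[where L = "\<lambda>w. node z w ^ k *s H' w", OF E(1) _ holo_stem_continuous[OF hs(1)] _ _ E(2), of "{z, cnj z}"])
      show "continuous_on E (\<lambda>w. (node z w ^ k *s H' w) $ i)" for i
        using holo_stem_continuous[OF hs(2), of i]
        by (auto intro!: continuous_intros holomorphic_on_imp_continuous_on[OF node_holomorphic])
      fix x assume x: "x \<in> E - {z, cnj z}"
      then have n0: "node z x \<noteq> 0" by (simp add: node_eq_0_iff)
      have "x \<in> D - {z, cnj z}" "x \<in> D' - {z, cnj z}" using x by (auto simp: E_def)
      then have "K x = (node z x powi m) *s H x" "K x = (node z x powi m') *s H' x"
        using that unfolding stem_factor_def by blast+
      then have "(node z x powi m) *s H x = (node z x powi m') *s H' x" by simp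
      also have "node z x powi m' = node z x powi m * node z x ^ k"
        using n0 by (simp add: k power_int_add)
      finally show "H x = node z x ^ k *s H' x" using n0 by (simp add: vec_eq_iff)
    qed simp
    then have "H z = 0" using k(2) by (simp add: node_eq_0_iff vec_eq_iff)
    then show False using that by (simp add: stem_factor_def)
  qed
  show "m = m'" using le[OF 1 2] le[OF 2 1] by simp
  then show "n = n'" using stem_factor_zorder[OF 1] stem_factor_zorder[OF 2] by simp
qed

text \<open>The exponents are found separately in the numerator, in the denominator, and in \<open>\<Phi>\<close> of the
  reduced quotient. The common factors of \<open>N\<close> and \<open>B\<close> need not be cancelled, only the power of
  \<^const>\<open>node\<close> in each.\<close>

lemma stem_factor_exists:
  assumes U: "sym_open U" "z \<in> U" and N: "holo_stem U N" "\<exists>\<^sub>F w in at z. Phi (N w) \<noteq> 0"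
    and B: "B holomorphic_on U" "\<And>w. w \<in> U \<Longrightarrow> B (cnj w) = cnj (B w)" "\<exists>\<^sub>F w in at z. B w \<noteq> 0"
    and K: "\<And>w. w \<in> U \<Longrightarrow> B w \<noteq> 0 \<Longrightarrow> K w = (1 / B w) *s N w"
  obtains m n D H where "stem_factor K z m n D H" "D \<subseteq> U" "\<And>w. w \<in> D - {z, cnj z} \<Longrightarrow> B w \<noteq> 0"
proof -
  have "\<exists>i. \<exists>\<^sub>F w in at z. N w $ i \<noteq> 0"
  proof (rule ccontr)
    assume "\<not> (\<exists>i. \<exists>\<^sub>F w in at z. N w $ i \<noteq> 0)"
    then have "\<forall>\<^sub>F w in at z. \<forall>i. N w $ i = 0"
      by (intro eventually_all_finite) (auto simp: frequently_def)
    then have "\<forall>\<^sub>F w in at z. Phi (N w) = 0" by eventually_elim (simp add: Phi_def)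
    then show False using N(2) by (simp add: frequently_def)
  qed
  then obtain a M where M: "holo_stem U M" "M z \<noteq> 0" "\<And>w. w \<in> U \<Longrightarrow> N w = node z w ^ a *s M w"
    using holo_stem_strip_node[OF U N(1)] by metis
  obtain b b' where b': "b' holomorphic_on U" "\<And>w. w \<in> U \<Longrightarrow> b' (cnj w) = cnj (b' w)" "b' z \<noteq> 0"
    "\<And>w. w \<in> U \<Longrightarrow> B w = node z w ^ b * b' w"
    using holomorphic_strip_node[OF U B] by metis
  define D where "D = U \<inter> b' -` (- {0})"
  have D: "sym_open D" "z \<in> D" "D \<subseteq> U"
    unfolding sym_open_def
    using continuous_open_preimage[OF holomorphic_on_imp_continuous_on[OF b'(1)] sym_openD(1)[OF U(1)], of "- {0}"]
      b' U by (auto simp: D_def sym_open_def)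
  have b'0: "b' w \<noteq> 0" if "w \<in> D" for w using that by (simp add: D_def)
  have "(\<lambda>w. 1 / b' w) holomorphic_on D"
    using b'(1) D(3) b'0 by (auto intro!: holomorphic_intros elim: holomorphic_on_subset)
  then have H: "holo_stem D (\<lambda>w. (1 / b' w) *s M w)" (is "holo_stem D ?H")
    using b'(2) D(3) by (intro holo_stem_scale holo_stem_subset[OF M(1) D(3)]) auto
  have B0: "B w \<noteq> 0" if "w \<in> D - {z, cnj z}" for w
    using that b'(4)[of w] b'0[of w] D(3) by (auto simp: node_eq_0_iff)
  have "\<forall>w\<in>D - {z, cnj z}. K w = (node z w powi (int a - int b)) *s ?H w"
  proof
    fix w assume w: "w \<in> D - {z, cnj z}"
    then have "w \<in> U" "node z w \<noteq> 0" using D(3) by (auto simp: node_eq_0_iff)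
    then show "K w = (node z w powi (int a - int b)) *s ?H w"
      using K[OF _ B0[OF w]] M(3) b'(4) by (simp add: power_int_diff vec_eq_iff)
  qed
  moreover have "?H z \<noteq> 0" using M(2) b'(3) by (simp add: vec_eq_iff)
  moreover have "\<exists>\<^sub>F w in at z. Phi (?H w) \<noteq> 0"
  proof -
    have "\<forall>\<^sub>F w in at z. w \<in> D" using eventually_at_in_open'[OF sym_openD(1)[OF D(1)] D(2)] .
    then have "\<forall>\<^sub>F w in at z. Phi (N w) \<noteq> 0 \<longrightarrow> Phi (?H w) \<noteq> 0"
    proof eventually_elim
      case (elim w)
      then have "w \<in> U" "b' w \<noteq> 0" using D(3) b'0 by auto
      then show ?case by (simp add: M(3) Phi_scale)
    qed
    then show ?thesis using N(2) by (rule frequently_rev_mp[rotated])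
  qed
  then obtain n c where "c holomorphic_on D" "c z \<noteq> 0" "\<forall>w\<in>D. Phi (?H w) = node z w ^ n * c w"
    using holomorphic_strip_node[OF D(1,2) Phi_holomorphic[OF H] Phi_sym[OF H]] by blast
  ultimately have "stem_factor K z (int a - int b) n D ?H"
    using D H unfolding stem_factor_def by blast
  then show ?thesis using that D(3) B0 by blast
qed

lemma assoc_map_foldr_star:
  "assoc_map (foldr (\<lambda>p k. (\<lambda>q. q - p) \<star> k) ps g) w = foldr (\<lambda>p. cq_mult (assoc_map (\<lambda>q. q - p) w)) ps (assoc_map g w)"
  by (induction ps) (simp_all add: assoc_map_star)

lemma Phi_foldr_linear:
  assumes "Im z \<noteq> 0" "set ps \<subseteq> sphere_of z"
  shows "Phi (foldr (\<lambda>p. cq_mult (assoc_map (\<lambda>q. q - p) w)) ps Z) = node z w ^ length ps * Phi Z"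
  using assms(2) by (induction ps) (simp_all add: Phi_cq_mult Phi_linear[OF assms(1)])

text \<open>A solution of \<open>\<alpha> = - v \<beta>\<close> with an imaginary unit \<open>v\<close> makes \<open>\<alpha>\<close> and \<open>\<beta>\<close> orthogonal and of
  equal length.\<close>

lemma zero_on_sphere_iff:
  "(\<exists>v\<in>imag_units. quat_val v Z = 0) \<longleftrightarrow> Phi Z = 0"
proof
  define A B where "A = Quat (Re (Z $ 1)) (Re (Z $ 2)) (Re (Z $ 3)) (Re (Z $ 4))"
    and "B = Quat (Im (Z $ 1)) (Im (Z $ 2)) (Im (Z $ 3)) (Im (Z $ 4))"
  assume "\<exists>v\<in>imag_units. quat_val v Z = 0"
  then obtain v where v: "v \<in> imag_units" "quat_val v Z = 0" by blast
  then have A: "A = - (v * B)" by (simp add: quat_val_def eq_neg_iff_add_eq_0 flip: A_def B_def)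
  have v0: "qre v = 0" "inner v v = 1" using v(1) by (simp_all add: imag_units_iff inner_quat_def power2_eq_square)
  then have "norm A = norm B" unfolding A norm_minus_cancel norm_mult by (simp add: norm_quat_def)
  then have "inner A A = inner B B" by (simp add: norm_eq)
  moreover have "inner A B = 0"
    unfolding A inner_minus_left using v0(1) by (simp add: inner_quat_def algebra_simps)
  moreover have "Re (Phi Z) = inner A A - inner B B" "Im (Phi Z) = 2 * inner A B"
    by (simp_all add: Phi_def A_def B_def inner_quat_def power2_eq_square)
  ultimately show "Phi Z = 0" by (simp add: complex_eq_iff)
next
  assume "Phi Z = 0"
  then show "\<exists>v\<in>imag_units. quat_val v Z = 0"
    using quat_val_zero_of_isotropic[of Z] quat_i_unit by (cases "Z = 0") auto
qed

lemma nonzero_on_sphere_iff: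
  "(\<exists>v\<in>imag_units. quat_val v Z \<noteq> 0) \<longleftrightarrow> Z \<noteq> 0"
proof
  assume "Z \<noteq> 0"
  show "\<exists>v\<in>imag_units. quat_val v Z \<noteq> 0"
  proof (rule ccontr)
    assume "\<not> ?thesis"
    then have "quat_val quat_i Z = 0" "quat_val (- quat_i) Z = 0"
      using quat_i_unit imag_unit_uminus[OF quat_i_unit] by blast+
    then have "Z = 0" by (simp add: quat_val_def quat_eq_iff vec_eq_iff forall_4 complex_eq_iff)
    then show False using \<open>Z \<noteq> 0\<close> by simp
  qed
qed auto

lemma assoc_map_scaled:
  assumes D: "sym_open D" "w \<in> D" and h: "slice_regular D h" and c: "c (cnj w) = cnj (c w)"
    and f: "\<And>v u. v \<in> imag_units \<Longrightarrow> u \<in> {w, cnj w} \<Longrightarrow> f (slice_pt v u) = slice_pt v (c u) * h (slice_pt v u)"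
  shows "assoc_map f w = c w *s assoc_map h w"
proof -
  have val: "f (slice_pt v u) = quat_val v (c u *s assoc_map h u)" if "v \<in> imag_units" "u \<in> {w, cnj w}" for v u
    using f[OF that] slice_regular_assoc_map(3)[OF h _ that(1), of u] that D by (auto simp: quat_val_scale sym_open_def)
  show ?thesis
  proof (rule assoc_map_eqI)
    show "f (slice_pt v w) = quat_val v (c w *s assoc_map h w)" if "v \<in> imag_units" for v
      using val[OF that] by simp
    show "f (slice_pt v (cnj w)) = quat_val v (vec_cnj (c w *s assoc_map h w))" if "v \<in> imag_units" for v
      using val[OF that, of "cnj w"] by (simp add: vec_cnj_scale assoc_map_cnj c)
  qed
qed

lemma slice_pt_node:
  assumes "Im z \<noteq> 0" "v \<in> imag_units"
  shows "(slice_pt v w - of_real (Re z))\<^sup>2 + (of_real (Im z))\<^sup>2 = slice_pt v (node z w)"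
  by (simp only: node_nonreal[OF assms(1)] slice_pt_simps slice_pt_power[OF assms(2)])

lemma axialE:
  assumes "q \<in> axial D"
  obtains v w where "v \<in> imag_units" "w \<in> D" "q = slice_pt v w"
  using assms by (auto simp: axial_def)

lemma axialI: "v \<in> imag_units \<Longrightarrow> w \<in> D \<Longrightarrow> slice_pt v w \<in> axial D"
  by (auto simp: axial_def)

lemma sphere_order_imp_stem_factor:
  assumes z: "Im z \<noteq> 0" and f: "sphere_order f z m n"
  obtains D h where "stem_factor (assoc_map f) z m n D (assoc_map h)" "slice_regular D h"
    "\<And>q. q \<in> axial D - sphere_of z \<Longrightarrow> f q = ((q - of_real (Re z))\<^sup>2 + (of_real (Im z))\<^sup>2) powi m * h q"
proof -
  obtain D h g ps where D: "z \<in> D" "slice_regular D h" "\<exists>q\<in>sphere_of z. h q \<noteq> 0"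
    and fh: "\<And>q. q \<in> axial D - sphere_of z \<Longrightarrow> f q = ((q - of_real (Re z))\<^sup>2 + (of_real (Im z))\<^sup>2) powi m * h q"
    and g: "slice_regular D g" "\<forall>q\<in>sphere_of z. g q \<noteq> 0" and ps: "length ps = n" "set ps \<subseteq> sphere_of z"
    and hg: "\<And>q. q \<in> axial D \<Longrightarrow> h q = foldr (\<lambda>p k. (\<lambda>q. q - p) \<star> k) ps g q"
    using f unfolding sphere_order_def by blast
  note h = slice_regular_assoc_map[OF D(2)] and g' = slice_regular_assoc_map[OF g(1)]
  have "assoc_map f w = (node z w powi m) *s assoc_map h w" if w: "w \<in> D - {z, cnj z}" for w
  proof (rule assoc_map_scaled[OF h(1) _ D(2), of w "\<lambda>w. node z w powi m"])
    fix v u assume v: "v \<in> imag_units" and u: "u \<in> {w, cnj w}"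
    have "u \<in> D" "u \<noteq> z" "u \<noteq> cnj z" using u w h(1) by (auto simp: sym_open_def)
    then have "slice_pt v u \<in> axial D - sphere_of z" using v by (simp add: axialI slice_pt_in_sphere_iff)
    from fh[OF this] show "f (slice_pt v u) = slice_pt v (node z u powi m) * h (slice_pt v u)"
      using v by (simp add: slice_pt_node[OF z] slice_pt_powi)
  qed (use w in \<open>auto simp: node_cnj\<close>)
  moreover have "assoc_map h z \<noteq> 0"
  proof -
    obtain v where "v \<in> imag_units" "h (slice_pt v z) \<noteq> 0" using D(3) by (auto simp: sphere_of_def)
    then show ?thesis using h(3)[OF D(1)] by auto
  qed
  moreover have "Phi (assoc_map g z) \<noteq> 0"
    unfolding zero_on_sphere_iff[symmetric] using g(2) g'(3)[OF D(1)] by (auto simp: sphere_of_def)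
  moreover have "Phi (assoc_map h w) = node z w ^ n * Phi (assoc_map g w)" if "w \<in> D" for w
  proof -
    have "assoc_map h w = assoc_map (foldr (\<lambda>p k. (\<lambda>q. q - p) \<star> k) ps g) w"
      using that h(1) by (intro assoc_map_cong hg axialI) (auto simp: sym_open_def)
    then show ?thesis using Phi_foldr_linear[OF z ps(2)] ps(1) by (simp add: assoc_map_foldr_star)
  qed
  ultimately have "stem_factor (assoc_map f) z m n D (assoc_map h)"
    unfolding stem_factor_def using h(1,2) D(1) Phi_holomorphic[OF g'(2)] by blast
  then show ?thesis using that fh D(2) by blast
qed

text \<open>The case distinction on the list of linear factors is needed because the value of a star product
  is computed from the stems, whereas the value of \<open>g\<close> itself is not a star product.\<close>

lemma sphere_order_of_stem_factor:
  assumes z: "Im z \<noteq> 0" and sf: "stem_factor (assoc_map f) z m n D H"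
    and slice: "\<And>w v. w \<in> D - {z, cnj z} \<Longrightarrow> v \<in> imag_units \<Longrightarrow> f (slice_pt v w) = quat_val v (assoc_map f w)"
  shows "sphere_order f z m n"
proof -
  obtain c where c: "c holomorphic_on D" "c z \<noteq> 0" "\<And>w. w \<in> D \<Longrightarrow> Phi (H w) = node z w ^ n * c w"
    using sf unfolding stem_factor_def by blast
  have D: "sym_open D" "z \<in> D" and H: "holo_stem D H" "H z \<noteq> 0"
    and K: "\<And>w. w \<in> D - {z, cnj z} \<Longrightarrow> assoc_map f w = (node z w powi m) *s H w"
    using sf by (auto simp: stem_factor_def)
  obtain ps G where ps: "length ps = n" "set ps \<subseteq> sphere_of z" and G: "holo_stem D G" "Phi (G z) \<noteq> 0"
    and HG: "\<And>w. w \<in> D \<Longrightarrow> H w = foldr (\<lambda>p. cq_mult (assoc_map (\<lambda>q. q - p) w)) ps (G w)"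
    using factor_linear[OF z D H c] by blast
  define h g where "h = slice_of_map H" and "g = slice_of_map G"
  have h: "slice_regular D h" and g: "slice_regular D g"
    unfolding h_def g_def by (intro slice_regular_slice_of_map D H G)+
  have valh: "h (slice_pt v w) = quat_val v (H w)" and valg: "g (slice_pt v w) = quat_val v (G w)"
    if "w \<in> D" "v \<in> imag_units" for v w
    using that H(1) G(1) unfolding h_def g_def by (simp_all add: slice_of_map_val holo_stem_def)
  have "assoc_map g w = G w" if "w \<in> D" for w
    using that G(1) unfolding g_def by (simp add: assoc_map_slice_of_map holo_stem_def)
  then have fold: "assoc_map (foldr (\<lambda>p k. (\<lambda>q. q - p) \<star> k) ps g) w = H w" if "w \<in> D" for w
    using that by (simp add: assoc_map_foldr_star HG)
  show ?thesis
    unfolding sphere_order_def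
  proof (intro exI conjI ballI)
    show "z \<in> D" "slice_regular D h" "slice_regular D g" "length ps = n" "set ps \<subseteq> sphere_of z" by fact+
    show "\<exists>q\<in>sphere_of z. h q \<noteq> 0"
      using nonzero_on_sphere_iff[of "H z"] H(2) valh[OF D(2)] unfolding sphere_of_def by fastforce
    show "f q = ((q - of_real (Re z))\<^sup>2 + (of_real (Im z))\<^sup>2) powi m * h q" if qD: "q \<in> axial D - sphere_of z" for q
    proof -
      obtain v w where q: "v \<in> imag_units" "w \<in> D" "q = slice_pt v w" using qD by (auto elim: axialE)
      then have "w \<in> D - {z, cnj z}" using qD by (simp add: slice_pt_in_sphere_iff)
      then show ?thesis
        unfolding q(3) using slice[OF _ q(1)] K valh[OF q(2,1)]
        by (simp add: slice_pt_node[OF z q(1)] slice_pt_powi[OF q(1)] quat_val_scale[OF q(1)])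
    qed
    show "g q \<noteq> 0" if "q \<in> sphere_of z" for q
      using that valg[OF D(2)] G(2) zero_on_sphere_iff[of "G z"] by (auto simp: sphere_of_def)
    show "h q = foldr (\<lambda>p k. (\<lambda>q. q - p) \<star> k) ps g q" if qD: "q \<in> axial D" for q
    proof -
      obtain v w where q: "v \<in> imag_units" "w \<in> D" "q = slice_pt v w" using qD by (auto elim: axialE)
      show ?thesis
      proof (cases ps)
        case Nil
        then show ?thesis using q valh valg HG by simp
      next
        case (Cons p ps')
        then show ?thesis
          using fold[OF q(2)] valh[OF q(2,1)] q by (simp add: star_quat_val assoc_map_star)
      qed
    qed
  qed
qed

text \<open>A stem is real at a real point, so there \<open>\<Phi>\<close> vanishes only with the stem, and the second exponent
  is zero.\<close>

lemma real_order_imp_stem_factor: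
  assumes "real_order f x n"
  obtains D h where "stem_factor (assoc_map f) (of_real x) n 0 D (assoc_map h)" "slice_regular D h"
    "\<And>q. q \<in> axial D - {of_real x} \<Longrightarrow> f q = (q - of_real x) powi n * h q"
proof -
  obtain D h where D: "of_real x \<in> D" "slice_regular D h" "h (of_real x) \<noteq> 0"
    and fh: "\<And>q. q \<in> axial D - {of_real x} \<Longrightarrow> f q = (q - of_real x) powi n * h q"
    using assms unfolding real_order_def by blast
  note h = slice_regular_assoc_map[OF D(2)]
  let ?z = "complex_of_real x"
  have spt: "slice_pt v ?z = of_real x" for v by (simp add: slice_pt_simps)
  have nd: "node ?z w = w - ?z" for w by (simp add: node_def)
  have "assoc_map f w = (node ?z w powi n) *s assoc_map h w" if w: "w \<in> D - {?z, cnj ?z}" for w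
  proof (rule assoc_map_scaled[OF h(1) _ D(2), of w "\<lambda>w. node ?z w powi n"])
    fix v u assume v: "v \<in> imag_units" and u: "u \<in> {w, cnj w}"
    have "cnj w \<noteq> ?z" using w by (metis DiffE complex_cnj_cnj complex_cnj_complex_of_real insertI1)
    then have u': "u \<in> D" "u \<noteq> ?z" using u w h(1) by (auto simp: sym_open_def)
    then have "slice_pt v u \<notin> sphere_of ?z" using v by (simp add: slice_pt_in_sphere_iff)
    then have "slice_pt v u \<noteq> of_real x" using spt[of v] v by (auto simp: sphere_of_def)
    then have "slice_pt v u \<in> axial D - {of_real x}" using v u' by (simp add: axialI)
    from fh[OF this] show "f (slice_pt v u) = slice_pt v (node ?z u powi n) * h (slice_pt v u)"
      using v by (simp add: nd slice_pt_powi slice_pt_simps)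
  qed (use w in \<open>auto simp: node_cnj\<close>)
  moreover have hv: "quat_val v (assoc_map h ?z) \<noteq> 0" if "v \<in> imag_units" for v
    using h(3)[OF D(1) that] D(3) by (simp add: spt)
  then have "Phi (assoc_map h ?z) \<noteq> 0"
    unfolding zero_on_sphere_iff[symmetric] by blast
  moreover have "assoc_map h ?z \<noteq> 0" using hv[OF quat_i_unit] by auto
  ultimately have "stem_factor (assoc_map f) ?z n 0 D (assoc_map h)"
    unfolding stem_factor_def using h(1,2) D(1) Phi_holomorphic[OF h(2)] by (intro conjI exI[of _ "\<lambda>w. Phi (assoc_map h w)"]) auto
  then show ?thesis using that fh D(2) by blast
qed

lemma real_order_of_stem_factor:
  assumes sf: "stem_factor (assoc_map f) (of_real x) m n D H"
    and slice: "\<And>w v. w \<in> D - {of_real x} \<Longrightarrow> v \<in> imag_units \<Longrightarrow> f (slice_pt v w) = quat_val v (assoc_map f w)"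
  shows "real_order f x m"
proof -
  let ?z = "complex_of_real x"
  have D: "sym_open D" "?z \<in> D" and H: "holo_stem D H" "H ?z \<noteq> 0"
    and K: "\<And>w. w \<in> D - {?z} \<Longrightarrow> assoc_map f w = (node ?z w powi m) *s H w"
    using sf by (auto simp: stem_factor_def)
  define h where "h = slice_of_map H"
  have valh: "h (slice_pt v w) = quat_val v (H w)" if "w \<in> D" "v \<in> imag_units" for v w
    using that H(1) unfolding h_def by (simp add: slice_of_map_val holo_stem_def)
  have spt: "slice_pt v ?z = of_real x" for v by (simp add: slice_pt_simps)
  show ?thesis
    unfolding real_order_def
  proof (intro exI conjI ballI)
    show "?z \<in> D" by fact
    show "slice_regular D h" unfolding h_def by (intro slice_regular_slice_of_map D H)
    obtain v where "v \<in> imag_units" "quat_val v (H ?z) \<noteq> 0" using nonzero_on_sphere_iff[of "H ?z"] H(2) by blast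
    then show "h (of_real x) \<noteq> 0" using valh[OF D(2), of v] by (simp add: spt)
    show "f q = (q - of_real x) powi m * h q" if qD: "q \<in> axial D - {of_real x}" for q
    proof -
      obtain v w where q: "v \<in> imag_units" "w \<in> D" "q = slice_pt v w" using qD by (auto elim: axialE)
      then have w: "w \<in> D - {?z}" using qD spt[of v] by auto
      have "slice_pt v w - of_real x = slice_pt v (node ?z w)" by (simp add: node_def slice_pt_simps)
      then show ?thesis
        unfolding q(3) using slice[OF w q(1)] K[OF w] valh[OF q(2,1)]
        by (simp add: slice_pt_powi[OF q(1)] quat_val_scale[OF q(1)])
    qed
  qed
qed

section \<open>A curve near a regular point\<close>

text \<open>The mean value inequality for \<open>\<gamma> t / D t0 - t\<close>, whose derivative is continuous and vanishes at
  \<open>t0\<close>. In the coordinate \<open>(w - \<gamma> t0) / D t0\<close> the curve near \<open>t0\<close> is then a graph of slope at most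
  \<open>1 / 3\<close> over the real axis.\<close>

lemma C1_curve_near_tangent:
  fixes \<gamma> D :: "real \<Rightarrow> complex"
  assumes "open I" "t0 \<in> I" and der: "\<And>t. t \<in> I \<Longrightarrow> (\<gamma> has_vector_derivative D t) (at t)"
    and cont: "continuous_on I D" and d: "D t0 \<noteq> 0"
  obtains \<delta> where "\<delta> > 0" "cball t0 \<delta> \<subseteq> I"
    "\<And>s t. s \<in> cball t0 \<delta> \<Longrightarrow> t \<in> cball t0 \<delta> \<Longrightarrow>
       cmod ((\<gamma> t - \<gamma> s) / D t0 - of_real (t - s)) \<le> \<bar>t - s\<bar> / 4"
proof -
  have "continuous (at t0) (\<lambda>t. D t / D t0 - 1)"
    using cont assms(1,2) d by (intro continuous_intros) (auto simp: continuous_on_eq_continuous_at)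
  then have "\<forall>\<^sub>F t in nhds t0. dist (D t / D t0 - 1) 0 < 1 / 4"
    using d by (intro tendstoD) (auto simp: isCont_def tendsto_nhds_iff)
  moreover have "\<forall>\<^sub>F t in nhds t0. t \<in> I"
    using assms(1,2) by (rule eventually_nhds_in_open)
  ultimately have "\<forall>\<^sub>F t in nhds t0. dist (D t / D t0 - 1) 0 < 1 / 4 \<and> t \<in> I"
    by eventually_elim auto
  then obtain e where e: "e > 0" "\<And>t. dist t t0 < e \<Longrightarrow> dist (D t / D t0 - 1) 0 < 1 / 4 \<and> t \<in> I"
    by (auto simp: eventually_nhds_metric)
  define \<phi> where "\<phi> t = \<gamma> t / D t0 - of_real t" for t
  have "norm (\<phi> t - \<phi> s) \<le> 1 / 4 * norm (t - s)"
    if "s \<in> cball t0 (e/2)" "t \<in> cball t0 (e/2)" for s t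
  proof (rule differentiable_bound[OF convex_cball _ _ that(2,1)])
    fix x assume x: "x \<in> cball t0 (e/2)"
    then have x': "dist x t0 < e" using e(1) by (simp add: dist_commute)
    have "(\<phi> has_vector_derivative (D x / D t0 - 1)) (at x)"
      unfolding \<phi>_def using der e(2)[OF x']
      by (auto intro!: derivative_eq_intros has_vector_derivative_divide)
    then show "(\<phi> has_derivative (\<lambda>h. h *\<^sub>R (D x / D t0 - 1))) (at x within cball t0 (e/2))"
      by (simp add: has_vector_derivative_def has_derivative_at_withinI)
    show "onorm (\<lambda>h. h *\<^sub>R (D x / D t0 - 1)) \<le> 1 / 4"
      using e(2)[OF x'] mult_left_mono[of "cmod (D x / D t0 - 1)" "1/4" "\<bar>_\<bar>"] by (intro onorm_le) fastforce
  qed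
  then have "cmod ((\<gamma> t - \<gamma> s) / D t0 - of_real (t - s)) \<le> \<bar>t - s\<bar> / 4"
    if "s \<in> cball t0 (e/2)" "t \<in> cball t0 (e/2)" for s t
    using that by (simp add: \<phi>_def algebra_simps diff_divide_distrib)
  moreover have "cball t0 (e/2) \<subseteq> I" using e by (auto simp: dist_commute)
  ultimately show ?thesis using that[of "e/2"] e(1) by auto
qed

lemma graph_estimates:
  fixes u :: complex
  assumes "cmod (u - of_real h) \<le> \<bar>h\<bar> / 4"
  shows "\<bar>Im u\<bar> \<le> \<bar>Re u\<bar> / 3" "h \<ge> 0 \<Longrightarrow> Re u \<ge> 3 / 4 * h" "h \<le> 0 \<Longrightarrow> Re u \<le> 3 / 4 * h"
    "Re u = 0 \<Longrightarrow> h = 0"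
proof -
  have 1: "\<bar>Re u - h\<bar> \<le> \<bar>h\<bar> / 4" "\<bar>Im u\<bar> \<le> \<bar>h\<bar> / 4"
    using abs_Re_le_cmod[of "u - of_real h"] abs_Im_le_cmod[of "u - of_real h"] assms by simp_all
  then show "h \<ge> 0 \<Longrightarrow> Re u \<ge> 3 / 4 * h" "h \<le> 0 \<Longrightarrow> Re u \<le> 3 / 4 * h"
    "Re u = 0 \<Longrightarrow> h = 0"
    by linarith+
  show "\<bar>Im u\<bar> \<le> \<bar>Re u\<bar> / 3" using 1 by linarith
qed

text \<open>An open square centred at \<open>z0\<close> with a pair of sides parallel to \<open>d\<close>.\<close>

definition tangent_box :: "complex \<Rightarrow> complex \<Rightarrow> real \<Rightarrow> complex set" where
  "tangent_box z0 d \<rho> = {w. \<bar>Re ((w - z0) / d)\<bar> < \<rho> \<and> \<bar>Im ((w - z0) / d)\<bar> < \<rho>}"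

lemma tangent_box_point:
  assumes "d \<noteq> 0"
  shows "z0 + d * Complex x y \<in> tangent_box z0 d \<rho> \<longleftrightarrow> \<bar>x\<bar> < \<rho> \<and> \<bar>y\<bar> < \<rho>"
  using assms by (simp add: tangent_box_def)

lemma open_tangent_box: "d \<noteq> 0 \<Longrightarrow> open (tangent_box z0 d \<rho>)"
  unfolding tangent_box_def by (intro open_Collect_conj open_Collect_less continuous_intros) auto

lemma connected_tangent_box:
  assumes "d \<noteq> 0"
  shows "connected (tangent_box z0 d \<rho>)"
proof -
  have "tangent_box z0 d \<rho> = (\<lambda>w. z0 + d * w) ` ({w. \<bar>Re w\<bar> < \<rho>} \<inter> {w. \<bar>Im w\<bar> < \<rho>})"
    using assms by (auto simp: tangent_box_def image_iff intro!: bexI[of _ "(_ - z0) / d"])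
  moreover have "{w. \<bar>Re w\<bar> < \<rho>} \<inter> {w. \<bar>Im w\<bar> < \<rho>} = box (Complex (-\<rho>) (-\<rho>)) (Complex \<rho> \<rho>)"
    by (auto simp: box_def Basis_complex_def)
  ultimately show ?thesis
    by (simp only:) (intro connected_continuous_image convex_connected convex_box continuous_intros)
qed

lemma tangent_box_small:
  assumes "d \<noteq> 0" "closed K" "z0 \<notin> K" "r > 0"
  obtains \<rho> where "\<rho> > 0" "\<rho> \<le> r" "tangent_box z0 d \<rho> \<inter> K = {}"
proof -
  have "open (-K)" "z0 \<in> -K" using assms by auto
  then obtain e where e: "e > 0" "ball z0 e \<subseteq> -K" by (auto simp: open_contains_ball)
  define \<rho> where "\<rho> = e / (2 * cmod d)"
  have "tangent_box z0 d (min r \<rho>) \<subseteq> ball z0 e"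
  proof
    fix w assume "w \<in> tangent_box z0 d (min r \<rho>)"
    then have "cmod ((w - z0) / d) < \<rho> + \<rho>"
      using cmod_le[of "(w - z0) / d"] by (auto simp: tangent_box_def)
    then show "w \<in> ball z0 e"
      using assms(1) by (simp add: \<rho>_def norm_divide dist_norm norm_minus_commute field_simps)
  qed
  moreover have "\<rho> > 0" using e assms by (simp add: \<rho>_def)
  ultimately show ?thesis using e assms(4) by (intro that[of "min r \<rho>"]) auto
qed

text \<open>Above (\<open>e = 1\<close>) or below (\<open>e = - 1\<close>) the graph, every point of the square can be joined to the
  reference point on the vertical axis without meeting \<open>K\<close>: first vertically to the height \<open>\<rho> / 2\<close>, which
  the graph of slope at most \<open>1 / 3\<close> does not reach, then horizontally.\<close>

lemma graph_side_constant:
  fixes \<gamma> :: "real \<Rightarrow> complex" and M :: "complex \<Rightarrow> 'b"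
  assumes graph: "\<And>s t. s \<in> J \<Longrightarrow> t \<in> J \<Longrightarrow>
       cmod ((\<gamma> t - \<gamma> s) / d - of_real (t - s)) \<le> \<bar>t - s\<bar> / 4"
    and t0: "t0 \<in> J" "\<gamma> t0 = z0" and d: "d \<noteq> 0"
    and K: "K \<inter> tangent_box z0 d \<rho> \<subseteq> \<gamma> ` J"
    and M: "\<And>S. connected S \<Longrightarrow> S \<inter> K = {} \<Longrightarrow> M constant_on S"
    and w: "w \<in> tangent_box z0 d \<rho>" and t: "t \<in> J" "Re ((w - z0) / d) = Re ((\<gamma> t - z0) / d)"
    and e: "\<bar>e\<bar> = 1" "e * (Im ((w - z0) / d) - Im ((\<gamma> t - z0) / d)) > 0"
  shows "M w = M (z0 + d * Complex 0 (e * \<rho> / 2))"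
proof -
  define P where "P x y = z0 + d * Complex x y" for x y
  have uP: "(P x y - z0) / d = Complex x y" for x y using d by (simp add: P_def)
  define x y g where "x = Re ((w - z0) / d)" and "y = Im ((w - z0) / d)" and "g = Im ((\<gamma> t - z0) / d)"
  have "Complex x y = (w - z0) / d" by (simp add: x_def y_def)
  then have wP: "w = P x y" using d by (simp add: P_def)
  have xy: "\<bar>x\<bar> < \<rho>" "\<bar>y\<bar> < \<rho>" using w by (auto simp: tangent_box_def x_def y_def)
  have low: "\<bar>Im ((\<gamma> s - z0) / d)\<bar> \<le> \<bar>Re ((\<gamma> s - z0) / d)\<bar> / 3" if "s \<in> J" for s
    using graph[OF t0(1) that] graph_estimates(1) t0(2) by blast
  have g: "\<bar>g\<bar> < \<rho> / 3" using low[OF t(1)] t(2) xy by (simp add: g_def x_def)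
  have inj: "s = t" if "s \<in> J" "Re ((\<gamma> s - z0) / d) = x" for s
  proof -
    have "Re ((\<gamma> s - \<gamma> t) / d) = 0"
      using that t(2) by (simp add: x_def diff_divide_distrib)
    then show ?thesis using graph_estimates(4)[OF graph[OF t(1) that(1)]] by simp
  qed
  define S1 S2 where "S1 = (\<lambda>s. P x s) ` closed_segment y (e * \<rho> / 2)"
    and "S2 = (\<lambda>s. P s (e * \<rho> / 2)) ` closed_segment x 0"
  have contP: "continuous_on X (\<lambda>s. P x s)" "continuous_on X (\<lambda>s. P s y)" for X x y
    unfolding P_def Complex_eq by (auto intro!: continuous_intros)
  have e': "e = 1 \<or> e = -1" using e(1) by linarith
  have "S1 \<inter> K = {}"
  proof (rule ccontr)
    assume "S1 \<inter> K \<noteq> {}"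
    then obtain s where s: "s \<in> closed_segment y (e * \<rho> / 2)" "P x s \<in> K" by (auto simp: S1_def)
    have "e * s \<ge> min (e * y) (\<rho> / 2)" "\<bar>s\<bar> < \<rho>"
      using s(1) e' xy by (auto simp: closed_segment_eq_real_ivl split: if_splits)
    moreover have "e * y > e * g" using e(2) by (simp add: y_def g_def algebra_simps)
    ultimately have "e * s > e * g" "\<bar>s\<bar> < \<rho>" using g e' by auto
    moreover from this s(2) have "P x s \<in> \<gamma> ` J"
      using K xy tangent_box_point[OF d] by (auto simp: P_def)
    then obtain s' where s': "s' \<in> J" "P x s = \<gamma> s'" by auto
    then have "s' = t" using inj[of s'] uP[of x s] by simp
    then have "s = g" using s' uP[of x s] by (simp add: g_def)
    ultimately show False by simp
  qed
  then have "M constant_on S1"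
    by (intro M) (auto simp: S1_def intro!: connected_continuous_image contP)
  then have 1: "M (P x y) = M (P x (e * \<rho> / 2))"
    by (auto simp: S1_def constant_on_def)
  have "S2 \<inter> K = {}"
  proof (rule ccontr)
    assume "S2 \<inter> K \<noteq> {}"
    then obtain s where s: "s \<in> closed_segment x 0" "P s (e * \<rho> / 2) \<in> K" by (auto simp: S2_def)
    have "\<bar>s\<bar> < \<rho>" using s(1) xy by (auto simp: closed_segment_eq_real_ivl split: if_splits)
    moreover from this have "P s (e * \<rho> / 2) \<in> \<gamma> ` J"
      using s(2) K e' tangent_box_point[OF d] by (auto simp: P_def)
    then obtain s' where s': "s' \<in> J" "P s (e * \<rho> / 2) = \<gamma> s'" by auto
    ultimately show False using low[OF s'(1)] uP[of s "e * \<rho> / 2"] e' by auto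
  qed
  then have "M constant_on S2"
    by (intro M) (auto simp: S2_def intro!: connected_continuous_image contP)
  then have "M (P x (e * \<rho> / 2)) = M (P 0 (e * \<rho> / 2))"
    by (auto simp: S2_def constant_on_def)
  with 1 wP show ?thesis by (simp add: P_def)
qed

text \<open>Only the arc near \<open>t0\<close> matters, since the winding number of the rest of the path is continuous at
  \<open>z0\<close>. On the arc the integral is a difference of logarithms. The branch cuts for the two sides point in
  opposite directions, so in the limit the two differences of logarithms at the end points differ by
  \<open>Ln w - Ln (- w) = \<plusminus> \<pi> \<i>\<close>, with opposite signs at the two ends.\<close>

lemma winding_number_jump:
  fixes \<gamma> :: "real \<Rightarrow> complex"
  assumes vp: "valid_path \<gamma>" and \<delta>: "\<delta> > 0" "0 \<le> t0 - \<delta>" "t0 + \<delta> \<le> 1"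
    and graph: "\<And>s t. s \<in> cball t0 \<delta> \<Longrightarrow> t \<in> cball t0 \<delta> \<Longrightarrow>
       cmod ((\<gamma> t - \<gamma> s) / d - of_real (t - s)) \<le> \<bar>t - s\<bar> / 4"
    and d: "d \<noteq> 0" and z0: "\<gamma> t0 = z0"
    and inj: "\<And>t. t \<in> {0..1} \<Longrightarrow> t \<noteq> t0 \<Longrightarrow> \<gamma> t \<noteq> z0"
    and off: "\<forall>\<^sub>F \<epsilon> in at_right 0. z0 + d * Complex 0 \<epsilon> \<notin> path_image \<gamma> \<and> z0 + d * Complex 0 (-\<epsilon>) \<notin> path_image \<gamma>"
  shows "((\<lambda>\<epsilon>. winding_number \<gamma> (z0 + d * Complex 0 \<epsilon>) - winding_number \<gamma> (z0 + d * Complex 0 (-\<epsilon>)))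
            \<longlongrightarrow> 1) (at_right 0)"
proof -
  define t1 t2 where "t1 = t0 - \<delta>" and "t2 = t0 + \<delta>"
  have t12: "t1 \<in> {0..1}" "t2 \<in> {0..1}" "t1 < t0" "t0 < t2" using \<delta> by (auto simp: t1_def t2_def)
  have J: "cball t0 \<delta> = {t1..t2}" by (auto simp: t1_def t2_def dist_real_def)
  define u where "u t = (\<gamma> t - z0) / d" for t
  have u1: "Re (u t1) < 0"
    using graph_estimates(3)[OF graph[of t0 t1]] t12 by (auto simp: J z0 u_def)
  have u2: "Re (u t2) > 0"
    using graph_estimates(2)[OF graph[of t0 t2]] t12 by (auto simp: J z0 u_def)
  have u0: "t = t0" if "Re (u t) = 0" "t \<in> {t1..t2}" for t
    using graph_estimates(4)[OF graph[of t0 t]] that t12 by (simp add: J z0 u_def)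
  have vp': "valid_path (subpath a b \<gamma>)" if "a \<in> {0..1}" "b \<in> {0..1}" for a b
    using vp that by (rule valid_path_subpath)
  have path: "path \<gamma>" using vp by (rule valid_path_imp_path)
  \<comment> \<open>Seen from \<open>z0 + \<epsilon> e \<i> d\<close>, the middle arc avoids the ray that leads away from it on the
    same side of the curve, so a branch of the logarithm cut along this ray is a primitive.\<close>
  define L where "L e \<epsilon> t = Ln (e * \<i> * u t + of_real \<epsilon>)" for e :: complex and \<epsilon> :: real and t
  have mid: "winding_number (subpath t1 t2 \<gamma>) (z0 + d * (e * \<i> * \<epsilon>)) = (L e \<epsilon> t2 - L e \<epsilon> t1) / (2 * pi * \<i>)"
    if e: "e = 1 \<or> e = -1" and \<epsilon>: "\<epsilon> > 0" and noton: "z0 + d * (e * \<i> * \<epsilon>) \<notin> path_image \<gamma>" for e :: complex and \<epsilon> :: real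
  proof -
    define p where "p = z0 + d * (e * \<i> * of_real \<epsilon>)"
    have ee: "e * e = 1" using e by auto
    have arg: "e * \<i> * ((\<gamma> t - p) / d) = e * \<i> * u t + of_real \<epsilon>" for t
      using d e by (auto simp: p_def u_def field_simps)
    have pi: "path_image (subpath t1 t2 \<gamma>) = \<gamma> ` {t1..t2}"
      using t12 by (auto simp: path_image_subpath)
    have "((\<lambda>z. 1 / (z - p)) has_contour_integral
       (Ln (e * \<i> * ((pathfinish (subpath t1 t2 \<gamma>) - p) / d)) - Ln (e * \<i> * ((pathstart (subpath t1 t2 \<gamma>) - p) / d))))
       (subpath t1 t2 \<gamma>)"
    proof (rule contour_integral_primitive[where S = "path_image (subpath t1 t2 \<gamma>)"])
      fix z assume "z \<in> path_image (subpath t1 t2 \<gamma>)"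
      then obtain t where t: "t \<in> {t1..t2}" "z = \<gamma> t" by (auto simp: pi)
      have "e * \<i> * ((\<gamma> t - p) / d) \<notin> \<real>\<^sub>\<le>\<^sub>0"
      proof
        assume *: "e * \<i> * ((\<gamma> t - p) / d) \<in> \<real>\<^sub>\<le>\<^sub>0"
        then have *: "e * \<i> * u t + of_real \<epsilon> \<in> \<real>\<^sub>\<le>\<^sub>0" unfolding arg .
        then have "Re (u t) = 0" using e by (auto simp: complex_nonpos_Reals_iff)
        then have "t = t0" using t u0 by auto
        then show False using * \<epsilon> by (simp add: complex_nonpos_Reals_iff u_def z0)
      qed
      moreover from this have "z \<noteq> p" using t by auto
      ultimately show "((\<lambda>z. Ln (e * \<i> * ((z - p) / d))) has_field_derivative 1 / (z - p)) (at z within path_image (subpath t1 t2 \<gamma>))"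
        using d e by (auto intro!: derivative_eq_intros simp: t(2) field_simps)
    qed (use t12 vp' in auto)
    then have "contour_integral (subpath t1 t2 \<gamma>) (\<lambda>z. 1 / (z - p)) = L e \<epsilon> t2 - L e \<epsilon> t1"
      by (simp add: contour_integral_unique L_def flip: arg)
    moreover have "p \<notin> path_image (subpath t1 t2 \<gamma>)"
      using noton t12 path_image_subpath_subset[of t1 t2 \<gamma>] by (auto simp: p_def)
    ultimately show ?thesis
      using winding_number_valid_path[OF vp'[OF t12(1,2)], of p] by (simp add: p_def)
  qed
  define R where "R p = winding_number (subpath 0 t1 \<gamma>) p + winding_number (subpath t2 1 \<gamma>) p" for p
  have split: "winding_number \<gamma> p = R p + winding_number (subpath t1 t2 \<gamma>) p" if "p \<notin> path_image \<gamma>" for p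
  proof -
    have "winding_number \<gamma> p = (winding_number (subpath 0 t1 \<gamma>) p + winding_number (subpath t1 t2 \<gamma>) p)
        + winding_number (subpath t2 1 \<gamma>) p"
      using winding_number_subpath_combine[OF path that, of 0 t1 t2]
        winding_number_subpath_combine[OF path that, of 0 t2 1] t12 by simp
    then show ?thesis by (simp add: R_def)
  qed
  have "\<gamma> x \<noteq> z0" if "x \<in> {0..t1} \<union> {t2..1}" for x
    using inj[of x] t12 that by auto
  then have z0R: "z0 \<notin> path_image (subpath 0 t1 \<gamma>)" "z0 \<notin> path_image (subpath t2 1 \<gamma>)"
    using t12 by (force simp: path_image_subpath)+
  have contR: "isCont R z0"
    unfolding R_def using z0R t12 path
    by (intro continuous_intros continuous_at_winding_number) (auto intro!: path_subpath)
  have lim: "((\<lambda>\<epsilon>. z0 + d * Complex 0 (c * \<epsilon>)) \<longlongrightarrow> z0) (at_right 0)" for c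
    unfolding Complex_eq by (auto intro!: tendsto_eq_intros)
  have Rlim: "((\<lambda>\<epsilon>. R (z0 + d * Complex 0 (c * \<epsilon>))) \<longlongrightarrow> R z0) (at_right 0)" for c
    using isCont_tendsto_compose[OF contR lim] .
  have Llim: "((\<lambda>\<epsilon>. L e \<epsilon> t) \<longlongrightarrow> Ln (e * \<i> * u t)) (at_right 0)"
    if "Re (u t) \<noteq> 0" "e = 1 \<or> e = -1" for e t
    unfolding L_def using that
    by (intro tendsto_Ln) (auto intro!: tendsto_eq_intros simp: complex_nonpos_Reals_iff)
  have Ln2: "Ln (- (\<i> * u t2)) = Ln (\<i> * u t2) - \<i> * pi" and Ln1: "Ln (- (\<i> * u t1)) = Ln (\<i> * u t1) + \<i> * pi"
    using u1 u2 by (subst Ln_minus; auto simp: complex_eq_iff)+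
  have "((\<lambda>\<epsilon>. R (z0 + d * Complex 0 (1 * \<epsilon>)) - R (z0 + d * Complex 0 (-1 * \<epsilon>))
        + ((L 1 \<epsilon> t2 - L 1 \<epsilon> t1) - (L (-1) \<epsilon> t2 - L (-1) \<epsilon> t1)) / (2 * pi * \<i>)) \<longlongrightarrow>
      R z0 - R z0 + ((Ln (1 * \<i> * u t2) - Ln (1 * \<i> * u t1)) - (Ln (-1 * \<i> * u t2) - Ln (-1 * \<i> * u t1))) / (2 * pi * \<i>)) (at_right 0)"
    using u1 u2 by (intro tendsto_intros Rlim Llim) auto
  also have "R z0 - R z0 + ((Ln (1 * \<i> * u t2) - Ln (1 * \<i> * u t1)) - (Ln (-1 * \<i> * u t2) - Ln (-1 * \<i> * u t1))) / (2 * pi * \<i>) = 1"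
    by (simp add: Ln1 Ln2 field_simps)
  finally show ?thesis
  proof (rule Lim_transform_eventually)
    show "\<forall>\<^sub>F \<epsilon> in at_right 0. R (z0 + d * Complex 0 (1 * \<epsilon>)) - R (z0 + d * Complex 0 (-1 * \<epsilon>))
        + ((L 1 \<epsilon> t2 - L 1 \<epsilon> t1) - (L (-1) \<epsilon> t2 - L (-1) \<epsilon> t1)) / (2 * pi * \<i>)
        = winding_number \<gamma> (z0 + d * Complex 0 \<epsilon>) - winding_number \<gamma> (z0 + d * Complex 0 (-\<epsilon>))"
      using off eventually_at_right_less[of 0]
    proof eventually_elim
      case (elim \<epsilon>)
      have c: "Complex 0 \<epsilon> = 1 * \<i> * \<epsilon>" "Complex 0 (-\<epsilon>) = -1 * \<i> * \<epsilon>" by (simp_all add: complex_eq_iff)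
      have "winding_number (subpath t1 t2 \<gamma>) (z0 + d * Complex 0 \<epsilon>) = (L 1 \<epsilon> t2 - L 1 \<epsilon> t1) / (2 * pi * \<i>)"
        using mid[of 1 \<epsilon>] elim unfolding c by simp
      moreover have "winding_number (subpath t1 t2 \<gamma>) (z0 + d * Complex 0 (-\<epsilon>)) = (L (-1) \<epsilon> t2 - L (-1) \<epsilon> t1) / (2 * pi * \<i>)"
        using mid[of "-1" \<epsilon>] elim unfolding c by simp
      ultimately show ?case using elim split by (simp add: diff_divide_distrib)
    qed
  qed
qed

section \<open>Winding number of an oriented boundary\<close>

definition boundary_winding :: "(real \<Rightarrow> complex) list \<Rightarrow> complex \<Rightarrow> complex" where
  "boundary_winding \<Gamma> p = (\<Sum>\<gamma>\<leftarrow>\<Gamma>. winding_number \<gamma> p)"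

lemma constant_on_sum_list:
  assumes "\<And>x. x \<in> set xs \<Longrightarrow> f x constant_on S"
  shows "(\<lambda>w. \<Sum>x\<leftarrow>xs. f x w :: 'b :: comm_monoid_add) constant_on S"
  using assms
proof (induction xs)
  case (Cons x xs)
  then have "f x constant_on S" "(\<lambda>w. \<Sum>x\<leftarrow>xs. f x w) constant_on S" by auto
  then obtain a b where "\<forall>w\<in>S. f x w = a" "\<forall>w\<in>S. (\<Sum>x\<leftarrow>xs. f x w) = b"
    unfolding constant_on_def by blast
  then have "\<forall>w\<in>S. (\<Sum>x\<leftarrow>x # xs. f x w) = a + b" by simp
  then show ?case unfolding constant_on_def by blast
qed (auto simp: constant_on_def)

lemma boundary_winding_constant_on:
  assumes "\<And>\<gamma>. \<gamma> \<in> set \<Gamma> \<Longrightarrow> path \<gamma> \<and> pathfinish \<gamma> = pathstart \<gamma>"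
    and "connected S" "S \<inter> (\<Union>\<gamma>\<in>set \<Gamma>. path_image \<gamma>) = {}"
  shows "boundary_winding \<Gamma> constant_on S"
proof -
  have "(\<lambda>p. \<Sum>\<gamma>\<leftarrow>\<Gamma>. winding_number \<gamma> p) constant_on S"
    using assms by (intro constant_on_sum_list winding_number_constant) auto
  then show ?thesis unfolding boundary_winding_def[abs_def] .
qed

lemma connected_disjoint_frontier:
  assumes "connected S" "S \<inter> frontier \<Omega> = {}"
  shows "S \<subseteq> \<Omega> \<or> S \<inter> \<Omega> = {}"
  using connected_Int_frontier[OF assms(1), of \<Omega>] assms(2) by blast

text \<open>Near a point off \<open>E\<close> the value \<open>c\<close> is unique because \<open>K\<close> has no interior points, so \<open>M\<close>
  extends to a locally constant function on the complement of \<open>E\<close>, which is connected.\<close>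

lemma locally_constant_extends:
  fixes M :: "complex \<Rightarrow> 'b"
  assumes K: "interior K = {}" and E: "finite E"
    and loc: "\<And>z. z \<notin> E \<Longrightarrow> \<exists>B c. open B \<and> z \<in> B \<and> (\<forall>w\<in>B - K. M w = c)"
    and pq: "p \<notin> E" "p \<notin> K" "q \<notin> E" "q \<notin> K"
  shows "M p = M q"
proof -
  define X where "X P = {z. \<exists>B c. open B \<and> z \<in> B \<and> (\<forall>w\<in>B - K. M w = c) \<and> P c}" for P
  have op: "open (X P)" for P
  proof (subst open_subopen, intro ballI)
    fix z assume "z \<in> X P"
    then obtain B c where "open B" "z \<in> B" "\<forall>w\<in>B - K. M w = c" "P c" by (auto simp: X_def)
    then show "\<exists>T. open T \<and> z \<in> T \<and> T \<subseteq> X P"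
      unfolding X_def by (intro exI[of _ B]) blast
  qed
  define A A' where "A = X (\<lambda>c. c = M p)" and "A' = X (\<lambda>c. c \<noteq> M p)"
  have "connected (- E)"
    using connected_open_delete_finite[OF open_UNIV connected_UNIV _ E] by (simp add: Compl_eq_Diff_UNIV)
  moreover have "open A" "open A'" using op by (auto simp: A_def A'_def)
  moreover have cover: "- E \<subseteq> A \<union> A'"
  proof
    fix z assume "z \<in> - E"
    then obtain B c where "open B" "z \<in> B" "\<forall>w\<in>B - K. M w = c" using loc[of z] by auto
    then show "z \<in> A \<union> A'"
      unfolding A_def A'_def X_def by (cases "c = M p") blast+
  qed
  moreover have "A \<inter> A' = {}"
  proof (rule ccontr)
    assume "A \<inter> A' \<noteq> {}"
    then obtain z B B' c' where z: "z \<in> B" "z \<in> B'" "open B" "open B'"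
      "\<forall>w\<in>B - K. M w = M p" "\<forall>w\<in>B' - K. M w = c'" "c' \<noteq> M p"
      by (auto simp: A_def A'_def X_def)
    have "\<not> B \<inter> B' \<subseteq> K"
      using K interior_maximal[of "B \<inter> B'" K] z by blast
    then show False using z by auto
  qed
  moreover have "p \<in> A"
  proof -
    obtain B c where B: "open B" "p \<in> B" "\<forall>w\<in>B - K. M w = c" using loc[OF pq(1)] by auto
    then have "c = M p" using pq(2) by auto
    then show ?thesis using B unfolding A_def X_def by blast
  qed
  ultimately have "A' \<inter> - E = {}"
    using pq(1) connectedD[of "- E" A A'] by auto
  then have "q \<in> A" using cover pq by auto
  then show ?thesis using pq by (auto simp: A_def X_def)
qed

text \<open>In a small square around a regular boundary point that lies on one boundary curve only, the winding
  number and membership in \<open>\<Omega>\<close> are constant on each side of the curve, and both drop by one from the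
  left to the right.\<close>

lemma oriented_boundary_locally_constant:
  fixes \<gamma> :: "real \<Rightarrow> complex"
  assumes \<gamma>: "valid_path \<gamma>" "simple_path \<gamma>" "pathfinish \<gamma> = pathstart \<gamma>"
    and \<Gamma>: "\<And>\<gamma>. \<gamma> \<in> set \<Gamma> \<Longrightarrow> path \<gamma> \<and> pathfinish \<gamma> = pathstart \<gamma>"
    and mem: "\<Gamma> = as @ \<gamma> # bs"
    and fr: "frontier \<Omega> = (\<Union>\<gamma>\<in>set \<Gamma>. path_image \<gamma>)"
    and I: "open I" "t0 \<in> I" "I \<subseteq> {0<..<1}"
    and der: "\<And>t. t \<in> I \<Longrightarrow> (\<gamma> has_vector_derivative D t) (at t)" "continuous_on I D"
    and d: "D t0 = d" "d \<noteq> 0"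
    and other: "\<And>\<eta>. \<eta> \<in> set (as @ bs) \<Longrightarrow> \<gamma> t0 \<notin> path_image \<eta>"
    and orient: "\<forall>\<^sub>F \<epsilon> in at_right 0.
           \<gamma> t0 + of_real \<epsilon> * \<i> * d \<in> \<Omega> \<and> \<gamma> t0 - of_real \<epsilon> * \<i> * d \<notin> closure \<Omega>"
  shows "\<exists>B c. open B \<and> \<gamma> t0 \<in> B \<and> (\<forall>w\<in>B - frontier \<Omega>. boundary_winding \<Gamma> w - of_bool (w \<in> \<Omega>) = c)"
proof -
  define z0 where "z0 = \<gamma> t0"
  obtain \<delta> where \<delta>: "\<delta> > 0" "cball t0 \<delta> \<subseteq> I" and
    graph: "\<And>s t. s \<in> cball t0 \<delta> \<Longrightarrow> t \<in> cball t0 \<delta> \<Longrightarrow>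
       cmod ((\<gamma> t - \<gamma> s) / d - of_real (t - s)) \<le> \<bar>t - s\<bar> / 4"
    using C1_curve_near_tangent[OF I(1,2) der] d by metis
  have J: "cball t0 \<delta> = {t0-\<delta>..t0+\<delta>}" by (auto simp: dist_real_def)
  have J01: "t0 - \<delta> > 0" "t0 + \<delta> < 1"
  proof -
    have "t0 - \<delta> \<in> I" "t0 + \<delta> \<in> I" using \<delta> by (auto simp: J)
    then show "t0 - \<delta> > 0" "t0 + \<delta> < 1" using I(3) by auto
  qed
  have path: "path \<gamma>" using \<gamma>(1) by (rule valid_path_imp_path)
  have inj: "\<gamma> t \<noteq> z0" if "t \<in> {0..1}" "t \<noteq> t0" for t
    using \<gamma>(2) that J01 \<delta>(1) unfolding simple_path_def loop_free_def z0_def by fastforce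
  define K0 where "K0 = \<gamma> ` ({0..1} - ball t0 \<delta>) \<union> (\<Union>\<eta>\<in>set (as @ bs). path_image \<eta>)"
  have "compact (\<gamma> ` ({0..1} - ball t0 \<delta>))"
    using path by (intro compact_continuous_image compact_diff) (auto simp: path_def intro: continuous_on_subset)
  moreover have "closed (path_image \<eta>)" if "\<eta> \<in> set (as @ bs)" for \<eta>
    using that \<Gamma> mem by (intro closed_path_image) auto
  ultimately have "closed K0"
    unfolding K0_def by (intro closed_Un closed_UN compact_imp_closed) auto
  moreover
  have "z0 \<noteq> \<gamma> x" if "x \<in> {0..1} - ball t0 \<delta>" for x
    using inj[of x] that \<delta>(1) by force
  then have "z0 \<notin> \<gamma> ` ({0..1} - ball t0 \<delta>)" by blast
  then have "z0 \<notin> K0" using other by (simp add: K0_def z0_def)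
  ultimately obtain \<rho> where \<rho>: "\<rho> > 0" "\<rho> \<le> \<delta> / 2" "tangent_box z0 d \<rho> \<inter> K0 = {}"
    using tangent_box_small[OF d(2), of K0 z0 "\<delta>/2"] \<delta>(1) by auto
  let ?B = "tangent_box z0 d \<rho>"
  have fr': "frontier \<Omega> = path_image \<gamma> \<union> (\<Union>\<eta>\<in>set (as @ bs). path_image \<eta>)"
    unfolding fr mem by auto
  have arc: "frontier \<Omega> \<inter> ?B \<subseteq> \<gamma> ` cball t0 \<delta>"
  proof
    fix w assume w: "w \<in> frontier \<Omega> \<inter> ?B"
    then have "w \<notin> K0" using \<rho>(3) by auto
    then have "w \<in> \<gamma> ` {0..1} - \<gamma> ` ({0..1} - ball t0 \<delta>)"
      using w by (auto simp: fr' K0_def path_image_def[of \<gamma>])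
    then show "w \<in> \<gamma> ` cball t0 \<delta>" using ball_subset_cball by blast
  qed
  define p where "p e = z0 + d * Complex 0 (e * \<rho> / 2)" for e
  have side: "(\<exists>e\<in>{1,-1}. M w = M (p e))"
    if M: "\<And>S. connected S \<Longrightarrow> S \<inter> frontier \<Omega> = {} \<Longrightarrow> M constant_on S" and w: "w \<in> ?B - frontier \<Omega>" for M :: "complex \<Rightarrow> complex \<times> bool" and w
  proof -
    define x where "x = Re ((w - z0) / d)"
    have x: "\<bar>x\<bar> < \<rho>" using w by (simp add: tangent_box_def x_def)
    have "\<exists>t. t0 - \<delta> \<le> t \<and> t \<le> t0 + \<delta> \<and> Re ((\<gamma> t - z0) / d) = x"
    proof (rule IVT')
      show "Re ((\<gamma> (t0 - \<delta>) - z0) / d) \<le> x"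
        using graph_estimates(3)[OF graph[of t0 "t0 - \<delta>"]] \<delta>(1) \<rho>(2) x by (simp add: J z0_def)
      show "x \<le> Re ((\<gamma> (t0 + \<delta>) - z0) / d)"
        using graph_estimates(2)[OF graph[of t0 "t0 + \<delta>"]] \<delta>(1) \<rho>(2) x by (simp add: J z0_def)
      have "continuous_on {t0 - \<delta>..t0 + \<delta>} \<gamma>"
        using path J01 unfolding path_def by (auto intro: continuous_on_subset)
      then show "continuous_on {t0 - \<delta>..t0 + \<delta>} (\<lambda>t. Re ((\<gamma> t - z0) / d))"
        using d(2) by (intro continuous_intros) auto
    qed (use \<delta>(1) in simp)
    then obtain t where t: "t \<in> cball t0 \<delta>" "Re ((\<gamma> t - z0) / d) = x" by (auto simp: J)
    define y where "y = Im ((w - z0) / d) - Im ((\<gamma> t - z0) / d)"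
    have "y \<noteq> 0"
    proof
      assume "y = 0"
      then have "(w - z0) / d = (\<gamma> t - z0) / d" using t(2) by (intro complex_eqI) (simp_all add: x_def y_def)
      then have "w = \<gamma> t" using d(2) by simp
      moreover have "\<gamma> t \<in> path_image \<gamma>" using t(1) J01 by (auto simp: path_image_def J)
      ultimately show False using w by (auto simp: fr')
    qed
    then have "\<bar>sgn y\<bar> = 1" "sgn y * y > 0" "sgn y \<in> {1, -1}" by (auto simp: sgn_if)
    moreover from this have "M w = M (p (sgn y))"
      unfolding p_def using t w \<delta>(1)
      by (intro graph_side_constant[where ?t0.0 = t0 and ?t = t, OF graph _ _ d(2) arc M])
         (auto simp: z0_def x_def y_def)
    ultimately show ?thesis by blast
  qed
  have normal: "M (z0 + d * Complex 0 (e * \<epsilon>)) = M (p e)"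
    if M: "\<And>S. connected S \<Longrightarrow> S \<inter> frontier \<Omega> = {} \<Longrightarrow> M constant_on S" and e: "e = 1 \<or> e = -1"
      and \<epsilon>: "\<epsilon> \<in> {0<..<\<rho>}" for M :: "complex \<Rightarrow> complex \<times> bool" and e \<epsilon>
    unfolding p_def
  proof (rule graph_side_constant[where ?t0.0 = t0 and ?t = t0, OF graph _ _ d(2) arc M])
    show "z0 + d * Complex 0 (e * \<epsilon>) \<in> tangent_box z0 d \<rho>"
      using e \<epsilon> tangent_box_point[OF d(2)] by auto
    show "\<bar>e\<bar> = 1" using e by auto
    show "0 < e * (Im ((z0 + d * Complex 0 (e * \<epsilon>) - z0) / d) - Im ((\<gamma> t0 - z0) / d))"
      using e \<epsilon> d(2) by (auto simp: z0_def)
  qed (use \<delta>(1) d(2) in \<open>auto simp: z0_def\<close>)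
  define M where "M w = (boundary_winding \<Gamma> w, w \<in> \<Omega>)" for w
  have M: "M constant_on S" if S: "connected S" "S \<inter> frontier \<Omega> = {}" for S
  proof -
    have "boundary_winding \<Gamma> constant_on S"
      using S \<Gamma> by (intro boundary_winding_constant_on) (auto simp: fr)
    moreover have "(\<lambda>w. w \<in> \<Omega>) constant_on S"
      using connected_disjoint_frontier[OF S] by (auto simp: constant_on_def)
    ultimately obtain a b where "\<forall>w\<in>S. boundary_winding \<Gamma> w = a" "\<forall>w\<in>S. (w \<in> \<Omega>) = b"
      unfolding constant_on_def by blast
    then have "\<forall>w\<in>S. M w = (a, b)" by (simp add: M_def)
    then show ?thesis unfolding constant_on_def by blast
  qed
  have near0: "\<forall>\<^sub>F \<epsilon> in at_right 0. \<epsilon> \<in> {0<..<\<rho>}"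
    using \<rho>(1) by (rule eventually_at_right_real)
  have "\<forall>\<^sub>F \<epsilon> in at_right (0::real). p 1 \<in> \<Omega> \<and> p (-1) \<notin> \<Omega>"
    using orient near0
  proof eventually_elim
    case (elim \<epsilon>)
    have "z0 + d * Complex 0 (1 * \<epsilon>) = \<gamma> t0 + of_real \<epsilon> * \<i> * d" "z0 + d * Complex 0 (-1 * \<epsilon>) = \<gamma> t0 - of_real \<epsilon> * \<i> * d"
      by (simp_all add: z0_def complex_eq_iff)
    moreover have "M (z0 + d * Complex 0 (1 * \<epsilon>)) = M (p 1)" "M (z0 + d * Complex 0 (-1 * \<epsilon>)) = M (p (-1))"
      using normal[OF M _ elim(2), of 1] normal[OF M _ elim(2), of "-1"] by simp_all
    ultimately show ?case
      using elim(1) closure_subset[of \<Omega>] by (auto simp: M_def)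
  qed
  then have p\<Omega>: "p 1 \<in> \<Omega>" "p (-1) \<notin> \<Omega>"
    by (auto simp: eventually_const_iff dest: eventually_happens')
  have "((\<lambda>\<epsilon>. winding_number \<gamma> (z0 + d * Complex 0 \<epsilon>) - winding_number \<gamma> (z0 + d * Complex 0 (-\<epsilon>)))
            \<longlongrightarrow> 1) (at_right 0)"
  proof (rule winding_number_jump[OF \<gamma>(1) \<delta>(1) _ _ graph d(2) _ inj])
    show "\<forall>\<^sub>F \<epsilon> in at_right 0. z0 + d * Complex 0 \<epsilon> \<notin> path_image \<gamma> \<and> z0 + d * Complex 0 (-\<epsilon>) \<notin> path_image \<gamma>"
      using near0
    proof eventually_elim
      case (elim \<epsilon>)
      have "z0 + d * Complex 0 s \<notin> path_image \<gamma>" if s: "s \<noteq> 0" "\<bar>s\<bar> < \<rho>" for s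
      proof
        assume "z0 + d * Complex 0 s \<in> path_image \<gamma>"
        then have "z0 + d * Complex 0 s \<in> frontier \<Omega> \<inter> ?B"
          using s tangent_box_point[OF d(2), of z0 0 s \<rho>] by (auto simp: fr')
        then obtain t where t: "t \<in> cball t0 \<delta>" "z0 + d * Complex 0 s = \<gamma> t" using arc by auto
        then have *: "(\<gamma> t - \<gamma> t0) / d = Complex 0 s" using d(2) by (simp add: z0_def field_simps)
        then have "t = t0" using graph_estimates(4)[OF graph[of t0 t]] t(1) \<delta>(1) by simp
        then show False using * s by (simp add: complex_eq_iff)
      qed
      then show ?case using elim by auto
    qed
  qed (use J01 in \<open>auto simp: z0_def\<close>)
  moreover have "\<forall>\<^sub>F \<epsilon> in at_right 0. winding_number \<gamma> (z0 + d * Complex 0 \<epsilon>) - winding_number \<gamma> (z0 + d * Complex 0 (-\<epsilon>))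
      = boundary_winding \<Gamma> (p 1) - boundary_winding \<Gamma> (p (-1))"
    using near0
  proof eventually_elim
    case (elim \<epsilon>)
    have "boundary_winding (as @ bs) constant_on ?B"
      using \<Gamma> \<rho>(3) mem by (intro boundary_winding_constant_on connected_tangent_box d(2)) (auto simp: K0_def)
    moreover have "z0 + d * Complex 0 \<epsilon> \<in> ?B" "z0 + d * Complex 0 (-\<epsilon>) \<in> ?B"
      using elim tangent_box_point[OF d(2)] by auto
    ultimately have "boundary_winding (as @ bs) (z0 + d * Complex 0 \<epsilon>) = boundary_winding (as @ bs) (z0 + d * Complex 0 (-\<epsilon>))"
      unfolding constant_on_def by metis
    moreover have "winding_number \<gamma> w = boundary_winding \<Gamma> w - boundary_winding (as @ bs) w" for w
      by (simp add: boundary_winding_def mem)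
    moreover have "M (z0 + d * Complex 0 (1 * \<epsilon>)) = M (p 1)" "M (z0 + d * Complex 0 (-1 * \<epsilon>)) = M (p (-1))"
      using normal[OF M _ elim, of 1] normal[OF M _ elim, of "-1"] by simp_all
    ultimately show ?case by (simp add: M_def)
  qed
  ultimately have "((\<lambda>\<epsilon>::real. boundary_winding \<Gamma> (p 1) - boundary_winding \<Gamma> (p (-1))) \<longlongrightarrow> 1) (at_right 0)"
    by (rule Lim_transform_eventually)
  then have jump: "boundary_winding \<Gamma> (p 1) - boundary_winding \<Gamma> (p (-1)) = 1"
    by (simp add: tendsto_const_iff)
  have "boundary_winding \<Gamma> w - of_bool (w \<in> \<Omega>) = boundary_winding \<Gamma> (p (-1))" if "w \<in> ?B - frontier \<Omega>" for w
    using side[OF M that] p\<Omega> jump by (auto simp: M_def algebra_simps)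
  moreover have "z0 \<in> ?B" using \<rho>(1) by (simp add: tangent_box_def)
  ultimately show ?thesis using open_tangent_box[OF d(2)] unfolding z0_def by blast
qed


text \<open>Off the finite set \<open>X\<close>, the continuous derivative that a piecewise \<open>C\<^sup>1\<close> path has and the nonzero
  tangent vector with \<open>\<Omega>\<close> on its left are the same vector.\<close>

definition regular_off :: "complex set \<Rightarrow> (real \<Rightarrow> complex) \<Rightarrow> real set \<Rightarrow> (real \<Rightarrow> complex) \<Rightarrow> bool" where
  "regular_off \<Omega> \<gamma> X D \<longleftrightarrow> finite X \<and> {0, 1} \<subseteq> X \<and> X \<subseteq> {0..1} \<and> continuous_on ({0<..<1} - X) D \<and>
     (\<forall>t\<in>{0<..<1} - X. (\<gamma> has_vector_derivative D t) (at t) \<and> D t \<noteq> 0 \<and> (\<forall>\<^sub>F \<epsilon> in at_right 0.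
           \<gamma> t + of_real \<epsilon> * \<i> * D t \<in> \<Omega> \<and> \<gamma> t - of_real \<epsilon> * \<i> * D t \<notin> closure \<Omega>))"

lemma regular_off_exists:
  assumes "oriented_C1_boundary \<Omega> \<Gamma>" and mem: "\<gamma> \<in> set \<Gamma>"
  shows "\<exists>X D. regular_off \<Omega> \<gamma> X D"
proof -
    obtain X1 where X1: "finite X1" "\<And>t. t \<in> {0..1} - X1 \<Longrightarrow> \<exists>d. d \<noteq> 0 \<and> (\<gamma> has_vector_derivative d) (at t) \<and>
        (\<forall>\<^sub>F \<epsilon> in at_right 0.
           \<gamma> t + of_real \<epsilon> * \<i> * d \<in> \<Omega> \<and> \<gamma> t - of_real \<epsilon> * \<i> * d \<notin> closure \<Omega>)"
      using assms(1) mem unfolding oriented_C1_boundary_def by meson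
    obtain X2 D where X2: "finite X2" "\<And>t. t \<in> {0..1} - X2 \<Longrightarrow> (\<gamma> has_vector_derivative D t) (at t)"
      "continuous_on ({0..1} - X2) D"
      using assms(1) mem unfolding oriented_C1_boundary_def valid_path_def piecewise_C1_differentiable_on_def C1_differentiable_on_def by metis
    have "(\<gamma> has_vector_derivative D t) (at t) \<and> D t \<noteq> 0 \<and> (\<forall>\<^sub>F \<epsilon> in at_right 0.
           \<gamma> t + of_real \<epsilon> * \<i> * D t \<in> \<Omega> \<and> \<gamma> t - of_real \<epsilon> * \<i> * D t \<notin> closure \<Omega>)"
      if "t \<in> {0<..<1} - ({0,1} \<union> (X1 \<union> X2) \<inter> {0..1})" for t
    proof -
      obtain d where d: "d \<noteq> 0" "(\<gamma> has_vector_derivative d) (at t)" "\<forall>\<^sub>F \<epsilon> in at_right 0.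
           \<gamma> t + of_real \<epsilon> * \<i> * d \<in> \<Omega> \<and> \<gamma> t - of_real \<epsilon> * \<i> * d \<notin> closure \<Omega>"
        using X1(2)[of t] \<open>t \<in> _\<close> by auto
      moreover have D: "(\<gamma> has_vector_derivative D t) (at t)" using X2(2)[of t] \<open>t \<in> _\<close> by auto
      ultimately have "d = D t" by (metis vector_derivative_at)
      then show ?thesis using d D by simp
    qed
    then show ?thesis unfolding regular_off_def using X1(1) X2(1,3)
      by (intro exI[of _ "{0,1} \<union> (X1 \<union> X2) \<inter> {0..1}"] exI[of _ D]) (auto intro: continuous_on_subset)
qed

text \<open>The exceptional set consists of the images of the exceptional parameters and the common points of
  two boundary curves.\<close>

theorem boundary_winding_eq_indicator:
  assumes "open \<Omega>" "bounded \<Omega>" "oriented_C1_boundary \<Omega> \<Gamma>" "p \<notin> frontier \<Omega>"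
  shows "boundary_winding \<Gamma> p = of_bool (p \<in> \<Omega>)"
proof -
  have \<Gamma>: "valid_path \<gamma>" "simple_path \<gamma>" "pathfinish \<gamma> = pathstart \<gamma>" "path \<gamma>" if "\<gamma> \<in> set \<Gamma>" for \<gamma>
    using assms(3) that by (auto simp: oriented_C1_boundary_def valid_path_imp_path)
  have fin: "finite (path_image (\<Gamma> ! i) \<inter> path_image (\<Gamma> ! j))" if "i < j" "j < length \<Gamma>" for i j
    using assms(3) that by (auto simp: oriented_C1_boundary_def)
  have fr: "frontier \<Omega> = (\<Union>\<gamma>\<in>set \<Gamma>. path_image \<gamma>)"
    using assms(3) by (auto simp: oriented_C1_boundary_def)
  have "\<exists>X D. regular_off \<Omega> \<gamma> X D" if "\<gamma> \<in> set \<Gamma>" for \<gamma>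
    using regular_off_exists[OF assms(3) that] .
  then obtain X D where reg: "\<And>\<gamma>. \<gamma> \<in> set \<Gamma> \<Longrightarrow> regular_off \<Omega> \<gamma> (X \<gamma>) (D \<gamma>)"
    by metis
  then have X: "finite (X \<gamma>)" "{0, 1} \<subseteq> X \<gamma>" "X \<gamma> \<subseteq> {0..1}" "continuous_on ({0<..<1} - X \<gamma>) (D \<gamma>)"
    and der: "\<And>t. t \<in> {0<..<1} - X \<gamma> \<Longrightarrow>
        (\<gamma> has_vector_derivative D \<gamma> t) (at t) \<and> D \<gamma> t \<noteq> 0 \<and> (\<forall>\<^sub>F \<epsilon> in at_right 0.
           \<gamma> t + of_real \<epsilon> * \<i> * D \<gamma> t \<in> \<Omega> \<and> \<gamma> t - of_real \<epsilon> * \<i> * D \<gamma> t \<notin> closure \<Omega>)"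
    if "\<gamma> \<in> set \<Gamma>" for \<gamma>
    using reg[OF that] unfolding regular_off_def by blast+
  define E where "E = (\<Union>\<gamma>\<in>set \<Gamma>. \<gamma> ` X \<gamma>) \<union>
     (\<Union>j<length \<Gamma>. \<Union>i<j. path_image (\<Gamma> ! i) \<inter> path_image (\<Gamma> ! j))"
  have "finite E" unfolding E_def using X(1) fin by (intro finite_UnI finite_UN_I) auto
  have "E \<subseteq> frontier \<Omega>"
    using X(3) unfolding E_def fr path_image_def by fastforce
  define M where "M w = boundary_winding \<Gamma> w - of_bool (w \<in> \<Omega>)" for w
  have loc: "\<exists>B c. open B \<and> z \<in> B \<and> (\<forall>w\<in>B - frontier \<Omega>. M w = c)" if z: "z \<notin> E" for z
  proof (cases "z \<in> frontier \<Omega>")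
    case False
    then have "open (- frontier \<Omega>)" "z \<in> - frontier \<Omega>" by (auto simp: open_Compl)
    then obtain e where e: "e > 0" "ball z e \<subseteq> - frontier \<Omega>" by (auto simp: open_contains_ball)
    have "boundary_winding \<Gamma> constant_on ball z e"
      using \<Gamma> e by (intro boundary_winding_constant_on) (auto simp: fr)
    moreover have "ball z e \<subseteq> \<Omega> \<or> ball z e \<inter> \<Omega> = {}"
      using e by (intro connected_disjoint_frontier) auto
    ultimately have "M constant_on ball z e"
      by (auto simp: M_def constant_on_def)
    then show ?thesis using e(1) unfolding constant_on_def by (intro exI[of _ "ball z e"]) auto
  next
    case True
    then obtain \<gamma> where \<gamma>: "\<gamma> \<in> set \<Gamma>" "z \<in> path_image \<gamma>" by (auto simp: fr)
    then obtain j where j: "j < length \<Gamma>" "\<Gamma> ! j = \<gamma>" by (auto simp: in_set_conv_nth)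
    obtain t where t: "t \<in> {0..1}" "z = \<gamma> t" using \<gamma> by (auto simp: path_image_def)
    then have tX: "t \<notin> X \<gamma>" using z \<gamma> by (auto simp: E_def)
    then have "t \<noteq> 0" "t \<noteq> 1" using X(2)[OF \<gamma>(1)] by auto
    then have tI: "t \<in> {0<..<1} - X \<gamma>" using t tX by auto
    have "\<gamma> t \<notin> path_image \<eta>" if \<eta>: "\<eta> \<in> set (take j \<Gamma> @ drop (Suc j) \<Gamma>)" for \<eta>
    proof -
      obtain i where i: "i < length \<Gamma>" "i \<noteq> j" "\<Gamma> ! i = \<eta>"
      proof -
        have "\<exists>i. i < length \<Gamma> \<and> i \<noteq> j \<and> \<Gamma> ! i = \<eta>"
        proof (cases "\<eta> \<in> set (take j \<Gamma>)")
          case True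
          then obtain i where "i < j" "\<Gamma> ! i = \<eta>" using j by (auto simp: in_set_conv_nth)
          then show ?thesis using j by (intro exI[of _ i]) auto
        next
          case False
          then obtain i where "i < length \<Gamma> - Suc j" "\<Gamma> ! (Suc j + i) = \<eta>"
            using \<eta> j by (auto simp: in_set_conv_nth)
          then show ?thesis by (intro exI[of _ "Suc j + i"]) auto
        qed
        then show thesis using that by blast
      qed
      show ?thesis
      proof
        assume "\<gamma> t \<in> path_image \<eta>"
        then have *: "z \<in> path_image (\<Gamma> ! i)" "z \<in> path_image (\<Gamma> ! j)" using i j \<gamma> t by auto
        from i(2) consider "i < j" | "j < i" by linarith
        then show False
        proof cases
          case 1
          then have "z \<in> E" unfolding E_def using * j by blast
          then show ?thesis using z by simp
        next
          case 2
          then have "z \<in> E" unfolding E_def using * i by blast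
          then show ?thesis using z by simp
        qed
      qed
    qed
    note other = this
    have "\<exists>B c. open B \<and> \<gamma> t \<in> B \<and> (\<forall>w\<in>B - frontier \<Omega>. boundary_winding \<Gamma> w - of_bool (w \<in> \<Omega>) = c)"
    proof (rule oriented_boundary_locally_constant[OF \<Gamma>(1-3)[OF \<gamma>(1)] _ _ fr _ tI, where d = "D \<gamma> t"])
      show "\<Gamma> = take j \<Gamma> @ \<gamma> # drop (Suc j) \<Gamma>" using id_take_nth_drop[OF j(1)] j(2) by simp
      show "path \<eta> \<and> pathfinish \<eta> = pathstart \<eta>" if "\<eta> \<in> set \<Gamma>" for \<eta> using \<Gamma>(3,4)[OF that] by simp
      show "open ({0<..<1} - X \<gamma>)" using X(1)[OF \<gamma>(1)] by (simp add: open_Diff finite_imp_closed)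
      show "continuous_on ({0<..<1} - X \<gamma>) (D \<gamma>)" using X(4)[OF \<gamma>(1)] .
      show "\<gamma> t \<notin> path_image \<eta>" if "\<eta> \<in> set (take j \<Gamma> @ drop (Suc j) \<Gamma>)" for \<eta> using other[OF that] .
    qed (use der[OF \<gamma>(1)] tI in auto)
    then show ?thesis unfolding M_def t(2) .
  qed
  have "interior (frontier \<Omega>) = {}"
  proof -
    have "interior (frontier \<Omega>) \<inter> \<Omega> = {}"
      using interior_subset[of "frontier \<Omega>"] assms(1) by (auto simp: frontier_def interior_open)
    then have "interior (frontier \<Omega>) \<inter> closure \<Omega> = {}"
      by (simp add: open_Int_closure_eq_empty)
    then show ?thesis
      using interior_subset[of "frontier \<Omega>"] by (auto simp: frontier_def)
  qed
  have "\<forall>\<gamma>\<in>set \<Gamma>. \<forall>\<^sub>F z in at_infinity. winding_number \<gamma> z = 0"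
    using \<Gamma> winding_number_zero_at_infinity unfolding eventually_at_infinity by blast
  then have "\<forall>\<^sub>F z in at_infinity. \<forall>\<gamma>\<in>set \<Gamma>. winding_number \<gamma> z = 0"
    by (intro eventually_ball_finite) auto
  moreover have "\<forall>\<^sub>F z in at_infinity. z \<notin> S" if "bounded S" for S :: "complex set"
    using that unfolding bounded_pos eventually_at_infinity by (metis add.commute less_add_one not_le order_trans le_add_same_cancel1)
  ultimately have "\<forall>\<^sub>F z in at_infinity. z \<notin> E \<and> z \<notin> closure \<Omega> \<and> (\<forall>\<gamma>\<in>set \<Gamma>. winding_number \<gamma> z = 0)"
    using \<open>finite E\<close> assms(2) by (intro eventually_conj) (auto intro!: finite_imp_bounded bounded_closure)
  then obtain q where q: "q \<notin> E" "q \<notin> closure \<Omega>" "\<forall>\<gamma>\<in>set \<Gamma>. winding_number \<gamma> q = 0"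
    using spec[of _ "of_real \<bar>_\<bar>"] unfolding eventually_at_infinity
    by (metis abs_ge_self norm_of_real abs_abs)
  have "M q = 0"
  proof -
    have "boundary_winding \<Gamma> q = 0"
      unfolding boundary_winding_def using q by (simp cong: map_cong)
    then show ?thesis using q closure_subset[of \<Omega>] by (auto simp: M_def)
  qed
  moreover have "M p = M q"
    using \<open>finite E\<close> q assms(4) \<open>interior (frontier \<Omega>) = {}\<close> \<open>E \<subseteq> frontier \<Omega>\<close> loc
    by (intro locally_constant_extends[of "frontier \<Omega>" E]) (auto simp: frontier_def)
  ultimately show ?thesis by (simp add: M_def)
qed

section \<open>The argument principle for a cycle\<close>

text \<open>Each loop is reached from the base point along a path in \<open>S\<close> that is then traversed backwards, so
  the connecting paths cancel in every integral. Winding numbers around points off \<open>S\<close> are such integrals.\<close>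

lemma join_loops:
  assumes S: "open S" "connected S" "S \<noteq> {}"
    and \<Gamma>: "\<And>\<gamma>. \<gamma> \<in> set \<Gamma> \<Longrightarrow> valid_path \<gamma> \<and> pathfinish \<gamma> = pathstart \<gamma> \<and> path_image \<gamma> \<subseteq> S"
  obtains g where "valid_path g" "pathfinish g = pathstart g" "path_image g \<subseteq> S"
    "\<And>f. f holomorphic_on S \<Longrightarrow> contour_integral g f = (\<Sum>\<gamma>\<leftarrow>\<Gamma>. contour_integral \<gamma> f)"
proof -
  obtain a where a: "a \<in> S" using S by blast
  have "\<exists>g. valid_path g \<and> pathstart g = a \<and> pathfinish g = a \<and> path_image g \<subseteq> S \<and>
    (\<forall>f. f holomorphic_on S \<longrightarrow> contour_integral g f = (\<Sum>\<gamma>\<leftarrow>\<Gamma>. contour_integral \<gamma> f))"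
    using \<Gamma>
  proof (induction \<Gamma>)
    case Nil
    show ?case
    proof (intro exI[of _ "linepath a a"] conjI allI impI)
      show "path_image (linepath a a) \<subseteq> S" using a by (simp only: path_image_linepath closed_segment_idem) simp
      show "contour_integral (linepath a a) f = (\<Sum>\<gamma>\<leftarrow>[]. contour_integral \<gamma> f)" for f
        by (simp only: contour_integral_trivial) simp
    qed (rule valid_path_linepath pathstart_linepath pathfinish_linepath)+
  next
    case (Cons \<gamma> \<Gamma>)
    then obtain g where g: "valid_path g" "pathstart g = a" "pathfinish g = a" "path_image g \<subseteq> S"
      "\<And>f. f holomorphic_on S \<Longrightarrow> contour_integral g f = (\<Sum>\<gamma>\<leftarrow>\<Gamma>. contour_integral \<gamma> f)"
      by (metis list.set_intros(2))
    have \<gamma>: "valid_path \<gamma>" "pathfinish \<gamma> = pathstart \<gamma>" "path_image \<gamma> \<subseteq> S" using Cons.prems[of \<gamma>] by auto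
    then have "pathstart \<gamma> \<in> S" by auto
    then obtain c where c: "valid_path c" "path_image c \<subseteq> S" "pathstart c = a" "pathfinish c = pathstart \<gamma>"
      using connected_open_polynomial_connected[OF S(1,2) a] valid_path_polynomial_function by metis
    define h where "h = c +++ \<gamma> +++ reversepath c +++ g"
    have "contour_integral h f = (\<Sum>\<eta>\<leftarrow>\<gamma> # \<Gamma>. contour_integral \<eta> f)" if f: "f holomorphic_on S" for f
    proof -
      have int: "f contour_integrable_on p" if "valid_path p" "path_image p \<subseteq> S" for p
        using contour_integrable_holomorphic_simple[OF f S(1) that] .
      show ?thesis
        unfolding h_def using c \<gamma> g int f
        by (simp add: contour_integral_reversepath contour_integrable_reversepath)
    qed
    moreover have "path_image h \<subseteq> S"
      unfolding h_def using c \<gamma> g by (auto simp: path_image_join)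
    ultimately show ?case using c \<gamma> g by (intro exI[of _ h]) (auto simp: h_def)
  qed
  then show ?thesis using that by metis
qed

text \<open>The zeros and poles off \<open>K\<close> may be infinite in number. They are removed from the domain, which stays
  open and connected; the winding number around them vanishes by assumption. At a pole a nicely
  meromorphic function has the value \<open>0\<close>, so the condition \<open>P p = 0\<close> covers zeros and poles.\<close>

lemma argument_principle_cycle:
  fixes P :: "complex \<Rightarrow> complex"
  assumes U: "open U" "connected U" and K: "compact K" "K \<subseteq> U"
    and \<Gamma>: "\<And>\<gamma>. \<gamma> \<in> set \<Gamma> \<Longrightarrow> valid_path \<gamma> \<and> pathfinish \<gamma> = pathstart \<gamma> \<and> path_image \<gamma> \<subseteq> K"
    and wind: "\<And>w. w \<notin> K \<Longrightarrow> boundary_winding \<Gamma> w = 0"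
    and P: "P nicely_meromorphic_on U" and sp: "{z \<in> U. P z = 0} sparse_in U"
    and nz: "\<And>\<gamma> z. \<gamma> \<in> set \<Gamma> \<Longrightarrow> z \<in> path_image \<gamma> \<Longrightarrow> P z \<noteq> 0"
  shows "(\<Sum>\<gamma>\<leftarrow>\<Gamma>. contour_integral \<gamma> (\<lambda>z. deriv P z / P z)) =
     2 * pi * \<i> * (\<Sum>p | p \<in> K \<and> P p = 0. boundary_winding \<Gamma> p * zorder P p)"
proof (cases "\<Gamma> = []")
  case True
  then show ?thesis by (simp add: boundary_winding_def)
next
  case False
  define T where "T = {z \<in> U. P z = 0}"
  have spT: "T sparse_in U" using sp by (simp add: T_def)
  have poleT: "p \<in> T" if "p \<in> U" "is_pole P p" for p
    using P that is_pole_tendsto[of P p] unfolding nicely_meromorphic_on_def T_def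
    by (metis (mono_tags, lifting) mem_Collect_eq not_tendsto_and_filterlim_at_infinity at_neq_bot is_pole_def)
  have "countable T"
    using sparse_imp_countable[OF U(1) spT] by (simp add: T_def Collect_conj_eq Int_absorb1)
  have S1: "open (U - T)" using open_diff_sparse_pts[OF U(1) spT] .
  have S2: "connected (U - T)"
    by (intro connected_open_diff_countable U \<open>countable T\<close>) simp
  have \<Gamma>T: "path_image \<gamma> \<subseteq> U - T" if "\<gamma> \<in> set \<Gamma>" for \<gamma>
    using \<Gamma>[OF that] nz[OF that] K by (auto simp: T_def)
  then have "U - T \<noteq> {}" using False path_image_nonempty[of "hd \<Gamma>"] hd_in_set[OF False] by blast
  then obtain g where g: "valid_path g" "pathfinish g = pathstart g" "path_image g \<subseteq> U - T"
    and gint: "\<And>f. f holomorphic_on (U - T) \<Longrightarrow> contour_integral g f = (\<Sum>\<gamma>\<leftarrow>\<Gamma>. contour_integral \<gamma> f)"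
    using join_loops[OF S1 S2, of \<Gamma>] \<Gamma> \<Gamma>T by metis
  have gw: "winding_number g w = boundary_winding \<Gamma> w" if w: "w \<notin> U - T" for w
  proof -
    have "(\<lambda>z. 1 / (z - w)) holomorphic_on (U - T)" using w by (auto intro!: holomorphic_intros)
    then have "contour_integral g (\<lambda>z. 1 / (z - w)) = (\<Sum>\<gamma>\<leftarrow>\<Gamma>. contour_integral \<gamma> (\<lambda>z. 1 / (z - w)))"
      by (rule gint)
    moreover have "contour_integral \<gamma> (\<lambda>z. 1 / (z - w)) = 2 * pi * \<i> * winding_number \<gamma> w" if "\<gamma> \<in> set \<Gamma>" for \<gamma>
    proof -
      have "w \<notin> path_image \<gamma>" using \<Gamma>T[OF that] w by auto
      then show ?thesis using winding_number_valid_path[of \<gamma> w] \<Gamma>[OF that] by simp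
    qed
    then have "map (\<lambda>\<gamma>. contour_integral \<gamma> (\<lambda>z. 1 / (z - w))) \<Gamma> = map (\<lambda>\<gamma>. 2 * pi * \<i> * winding_number \<gamma> w) \<Gamma>"
      by simp
    ultimately have "contour_integral g (\<lambda>z. 1 / (z - w)) = 2 * pi * \<i> * boundary_winding \<Gamma> w"
      by (simp only: boundary_winding_def sum_list_const_mult)
    then show ?thesis
    proof -
      assume *: "contour_integral g (\<lambda>z. 1 / (z - w)) = 2 * pi * \<i> * boundary_winding \<Gamma> w"
      have "w \<notin> path_image g" using g w by auto
      then show ?thesis using winding_number_valid_path[of g w] g * by simp
    qed
  qed
  have an: "P analytic_on (U - T)"
    using nicely_meromorphic_on_imp_analytic_at[OF P] poleT by (subst analytic_on_analytic_at) blast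
  then have hol: "P holomorphic_on (U - T)" by (rule analytic_imp_holomorphic)
  define S where "S = U - (T - K)"
  have KT: "finite (K \<inter> T)"
    using sparse_in_compact_finite[OF sparse_in_subset[OF spT K(2)] K(1)] .
  have oS: "open S" unfolding S_def by (intro open_diff_sparse_pts U(1) sparse_in_subset2[OF spT]) auto
  have cS: "connected S" unfolding S_def
    by (intro connected_open_diff_countable U countable_subset[OF _ \<open>countable T\<close>]) auto
  have pz: "{w \<in> S. P w = 0 \<or> w \<in> {p \<in> S. is_pole P p}} = K \<inter> T"
    using K poleT by (auto simp: S_def T_def)
  have hS: "P holomorphic_on S - {p \<in> S. is_pole P p}"
  proof -
    have "P analytic_on S - {p \<in> S. is_pole P p}"
      using nicely_meromorphic_on_imp_analytic_at[OF P] by (subst analytic_on_analytic_at) (auto simp: S_def)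
    then show ?thesis by (rule analytic_imp_holomorphic)
  qed
  have wS: "\<forall>z. z \<notin> S \<longrightarrow> winding_number g z = 0"
    using K gw wind by (auto simp: S_def)
  have gS: "path_image g \<subseteq> S - K \<inter> T" using g by (auto simp: S_def)
  have "contour_integral g (\<lambda>x. deriv P x * 1 / P x) =
      2 * pi * \<i> * (\<Sum>p\<in>K \<inter> T. winding_number g p * 1 * zorder P p)"
    by (rule argument_principle[of S P "{p \<in> S. is_pole P p}" "\<lambda>_. 1" g, unfolded pz,
          OF oS cS hS holomorphic_on_const g(1,2) gS wS KT]) auto
  also have "(\<Sum>p\<in>K \<inter> T. winding_number g p * 1 * zorder P p) = (\<Sum>p\<in>K \<inter> T. boundary_winding \<Gamma> p * zorder P p)"
    by (intro sum.cong refl) (auto simp: gw)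
  also have "K \<inter> T = {p. p \<in> K \<and> P p = 0}" using K by (auto simp: T_def)
  also have "contour_integral g (\<lambda>x. deriv P x * 1 / P x) = (\<Sum>\<gamma>\<leftarrow>\<Gamma>. contour_integral \<gamma> (\<lambda>x. deriv P x * 1 / P x))"
    using hol S1 by (intro gint holomorphic_intros) (auto simp: T_def)
  finally show ?thesis by simp
qed

section \<open>Slice-meromorphic functions\<close>

lemma slice_regular_subset:
  assumes "slice_regular D h" "sym_open E" "E \<subseteq> D"
  shows "slice_regular E h"
proof (rule slice_regularI[OF assms(2)])
  show "holo_stem E (assoc_map h)"
    using holo_stem_subset[OF slice_regular_assoc_map(2)[OF assms(1)] assms(3)] .
  show "h (slice_pt v z) = quat_val v (assoc_map h z)" if "z \<in> E" "v \<in> imag_units" for z v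
    using slice_regular_assoc_map(3)[OF assms(1) subsetD[OF assms(3) that(1)] that(2)] .
qed

lemma sym_open_Int: "sym_open D \<Longrightarrow> sym_open E \<Longrightarrow> sym_open (D \<inter> E)"
  by (auto simp: sym_open_def)

lemma sphere_order_cnj: "sphere_order f (cnj z) m n \<longleftrightarrow> sphere_order f z m n"
proof -
  have "cnj z \<in> D \<and> slice_regular D h \<and> X \<longleftrightarrow> z \<in> D \<and> slice_regular D h \<and> X" for D h X
    using slice_regular_assoc_map(1)[of D h] sym_openD(2)[of D z] sym_openD(2)[of D "cnj z"] by auto
  then show ?thesis
    unfolding sphere_order_def sphere_of_cnj complex_cnj of_real_minus power2_minus
    by (simp only: complex.sel cnj.simps of_real_minus power2_minus)
qed

lemma mult_cnj: "spherical_mult f (cnj z) = spherical_mult f z" "isolated_mult f (cnj z) = isolated_mult f z"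
  by (simp_all add: spherical_mult_def isolated_mult_def sphere_order_cnj)

text \<open>The stem of \<open>f\<close> is \<open>N / B\<close> and \<open>\<Phi>\<close> of it is \<open>A / B\<close>. For the star quotient of \<open>b\<close> by \<open>a\<close> take
  \<open>A\<close> and \<open>B\<close> as \<open>\<Phi>\<close> of the stems of \<open>b\<close> and \<open>a\<close>, and \<open>N\<close> as the conjugate stem of \<open>a\<close> times that of \<open>b\<close>. The
  last assumption says that \<open>f\<close> takes the values of its slice-regular extensions.\<close>

locale slice_quotient =
  fixes U :: "complex set" and f :: "quat \<Rightarrow> quat" and N :: "complex \<Rightarrow> complex ^ 4" and A B :: "complex \<Rightarrow> complex"
  assumes U: "sym_open U"
    and N: "holo_stem U N" and A: "A holomorphic_on U" and B: "B holomorphic_on U"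
    and A_cnj: "\<And>w. w \<in> U \<Longrightarrow> A (cnj w) = cnj (A w)" and B_cnj: "\<And>w. w \<in> U \<Longrightarrow> B (cnj w) = cnj (B w)"
    and PhiN: "\<And>w. Phi (N w) = A w * B w"
    and A_nz: "\<And>z. z \<in> U \<Longrightarrow> \<forall>\<^sub>F w in at z. A w \<noteq> 0" and B_nz: "\<And>z. z \<in> U \<Longrightarrow> \<forall>\<^sub>F w in at z. B w \<noteq> 0"
    and val: "\<And>w v. w \<in> U \<Longrightarrow> B w \<noteq> 0 \<Longrightarrow> v \<in> imag_units \<Longrightarrow> f (slice_pt v w) = quat_val v ((1 / B w) *s N w)"
    and extend: "\<And>D k q. D \<subseteq> U \<Longrightarrow> slice_regular D k \<Longrightarrow>
        (\<And>w v. w \<in> D \<Longrightarrow> B w \<noteq> 0 \<Longrightarrow> v \<in> imag_units \<Longrightarrow> k (slice_pt v w) = quat_val v ((1 / B w) *s N w)) \<Longrightarrow>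
        q \<in> axial D \<Longrightarrow> f q = k q"
begin

lemma assoc_map_quotient:
  assumes "w \<in> U" "B w \<noteq> 0"
  shows "assoc_map f w = (1 / B w) *s N w"
proof (rule assoc_map_eqI)
  show "f (slice_pt v w) = quat_val v ((1 / B w) *s N w)" if "v \<in> imag_units" for v
    using val[OF assms that] .
  have c: "cnj w \<in> U" "B (cnj w) \<noteq> 0" "N (cnj w) = vec_cnj (N w)"
    using assms U N B_cnj by (auto simp: sym_open_def holo_stem_def)
  show "f (slice_pt v (cnj w)) = quat_val v (vec_cnj ((1 / B w) *s N w))" if "v \<in> imag_units" for v
    using val[OF c(1,2) that] c(3) by (simp add: vec_cnj_scale B_cnj[OF assms(1)])
qed

lemma Phi_quotient: "w \<in> U \<Longrightarrow> B w \<noteq> 0 \<Longrightarrow> Phi (assoc_map f w) = A w / B w"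
  by (simp add: assoc_map_quotient Phi_scale PhiN power2_eq_square)

lemma slice_value: "w \<in> U \<Longrightarrow> B w \<noteq> 0 \<Longrightarrow> v \<in> imag_units \<Longrightarrow> f (slice_pt v w) = quat_val v (assoc_map f w)"
  by (simp add: val assoc_map_quotient)

lemma factor_exists:
  assumes "z \<in> U"
  obtains m n D H where "stem_factor (assoc_map f) z m n D H" "D \<subseteq> U" "\<And>w. w \<in> D - {z, cnj z} \<Longrightarrow> B w \<noteq> 0"
proof -
  have "\<forall>\<^sub>F w in at z. Phi (N w) \<noteq> 0"
    using A_nz[OF assms] B_nz[OF assms] by eventually_elim (simp add: PhiN)
  then have "\<exists>\<^sub>F w in at z. Phi (N w) \<noteq> 0" "\<exists>\<^sub>F w in at z. B w \<noteq> 0"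
    using B_nz[OF assms] by (auto intro!: eventually_frequently)
  then show ?thesis
    using stem_factor_exists[OF U assms N _ B B_cnj _ assoc_map_quotient] that by metis
qed

lemma sphere_multiplicities:
  assumes z: "z \<in> U" "Im z \<noteq> 0"
  obtains D h where "stem_factor (assoc_map f) z (spherical_mult f z) (isolated_mult f z) D (assoc_map h)"
    "slice_regular D h"
proof -
  obtain m n D H where sf: "stem_factor (assoc_map f) z m n D H" and D: "D \<subseteq> U"
    and B0: "\<And>w. w \<in> D - {z, cnj z} \<Longrightarrow> B w \<noteq> 0"
    using factor_exists[OF z(1)] by metis
  have so: "sphere_order f z m n"
    by (rule sphere_order_of_stem_factor[OF z(2) sf]) (use D B0 slice_value in auto)
  have un: "m' = m \<and> n' = n" if so': "sphere_order f z m' n'" for m' n'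
  proof -
    obtain D' h where "stem_factor (assoc_map f) z m' n' D' (assoc_map h)"
      by (rule sphere_order_imp_stem_factor[OF z(2) so'])
    then show ?thesis using stem_factor_unique[OF _ sf] by blast
  qed
  have "spherical_mult f z = m"
    unfolding spherical_mult_def by (rule the_equality) (use so un in blast)+
  moreover have "isolated_mult f z = n"
    unfolding isolated_mult_def by (rule the_equality) (use so un in blast)+
  moreover obtain D' h where "stem_factor (assoc_map f) z m n D' (assoc_map h)" "slice_regular D' h"
    by (rule sphere_order_imp_stem_factor[OF z(2) so])
  ultimately show ?thesis using that by simp
qed

lemma real_multiplicity:
  assumes z: "of_real x \<in> U"
  obtains D h where "stem_factor (assoc_map f) (of_real x) (real_mult f x) 0 D (assoc_map h)"
    "slice_regular D h"
proof -
  obtain m n D H where sf: "stem_factor (assoc_map f) (of_real x) m n D H" and D: "D \<subseteq> U"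
    and B0: "\<And>w. w \<in> D - {of_real x, cnj (of_real x)} \<Longrightarrow> B w \<noteq> 0"
    using factor_exists[OF z] by metis
  have so: "real_order f x m"
    by (rule real_order_of_stem_factor[OF sf]) (use D B0 slice_value in auto)
  have un: "m' = m" if so': "real_order f x m'" for m'
  proof -
    obtain D' h where "stem_factor (assoc_map f) (of_real x) m' 0 D' (assoc_map h)"
      by (rule real_order_imp_stem_factor[OF so'])
    then show ?thesis using stem_factor_unique(1)[OF _ sf] by blast
  qed
  have "real_mult f x = m"
    unfolding real_mult_def by (rule the_equality) (use so un in blast)+
  moreover obtain D' h where "stem_factor (assoc_map f) (of_real x) m 0 D' (assoc_map h)" "slice_regular D' h"
    by (rule real_order_imp_stem_factor[OF so])
  ultimately show ?thesis using that by simp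
qed

definition order_at :: "complex \<Rightarrow> int" where
  "order_at z = zorder (\<lambda>w. Phi (assoc_map f w)) z"

lemma order_at_nonreal:
  assumes "z \<in> U" "Im z \<noteq> 0"
  shows "order_at z = 2 * spherical_mult f z + int (isolated_mult f z)"
  unfolding order_at_def by (rule sphere_multiplicities[OF assms]) (rule stem_factor_zorder)

lemma order_at_real:
  assumes "of_real x \<in> U"
  shows "order_at (of_real x) = 2 * real_mult f x"
  unfolding order_at_def by (rule real_multiplicity[OF assms]) (drule stem_factor_zorder, simp)

lemma factor_of_regular_point:
  assumes "z \<in> U" "A z \<noteq> 0" "B z \<noteq> 0"
  shows "stem_factor (assoc_map f) z 0 0 (U \<inter> B -` (- {0})) (assoc_map f)"
proof -
  let ?D = "U \<inter> B -` (- {0})"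
  have D: "sym_open ?D"
    using continuous_open_preimage[OF holomorphic_on_imp_continuous_on[OF B] sym_openD(1)[OF U], of "- {0}"] U B_cnj
    by (auto simp: sym_open_def)
  have "(\<lambda>w. 1 / B w) holomorphic_on ?D"
    using B by (auto intro!: holomorphic_intros elim: holomorphic_on_subset)
  then have "holo_stem ?D (\<lambda>w. (1 / B w) *s N w)"
    by (intro holo_stem_scale holo_stem_subset[OF N]) (auto simp: B_cnj)
  then have h: "holo_stem ?D (assoc_map f)"
    unfolding holo_stem_def assoc_map_cnj
  proof (intro conjI allI ballI refl)
    fix i
    assume "(\<forall>i. (\<lambda>w. ((1 / B w) *s N w) $ i) holomorphic_on ?D) \<and>
      (\<forall>w\<in>?D. (1 / B (cnj w)) *s N (cnj w) = vec_cnj ((1 / B w) *s N w))"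
    then have "(\<lambda>w. ((1 / B w) *s N w) $ i) holomorphic_on ?D" by blast
    then show "(\<lambda>w. assoc_map f w $ i) holomorphic_on ?D"
      by (rule holomorphic_transform) (simp add: assoc_map_quotient)
  qed
  have P0: "Phi (assoc_map f z) \<noteq> 0" using Phi_quotient[OF assms(1,3)] assms by simp
  then have "assoc_map f z \<noteq> 0" by (auto simp: Phi_def)
  then show ?thesis
    unfolding stem_factor_def using D h P0 assms Phi_holomorphic[OF h]
    by (auto intro!: exI[of _ "\<lambda>w. Phi (assoc_map f w)"])
qed

lemma regular_point_not_zero_or_pole:
  assumes "z \<in> U" "A z \<noteq> 0" "B z \<noteq> 0"
  shows "\<not> zero_or_pole f z"
proof (cases "Im z = 0")
  case True
  then have z: "z = of_real (Re z)" by (simp add: complex_eq_iff)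
  then have "of_real (Re z) \<in> U" using assms(1) by simp
  then obtain D h where "stem_factor (assoc_map f) (of_real (Re z)) (real_mult f (Re z)) 0 D (assoc_map h)"
    by (rule real_multiplicity)
  then have "stem_factor (assoc_map f) z (real_mult f (Re z)) 0 D (assoc_map h)" using z by simp
  then have "real_mult f (Re z) = 0"
    using stem_factor_unique(1) factor_of_regular_point[OF assms] by blast
  then show ?thesis using True by (simp add: zero_or_pole_def)
next
  case False
  obtain D h where "stem_factor (assoc_map f) z (spherical_mult f z) (isolated_mult f z) D (assoc_map h)"
    by (rule sphere_multiplicities[OF assms(1) False])
  from stem_factor_unique[OF this factor_of_regular_point[OF assms]]
  show ?thesis using False by (simp add: zero_or_pole_def)
qed

text \<open>If \<open>f\<close> has neither a zero nor a pole at \<open>z\<close>, both exponents are zero, and the factor \<open>h\<close> is a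
  slice-regular extension of the quotient across the sphere of \<open>z\<close>. By the condition on removable
  singularities \<open>f\<close> agrees with it there. Thus the boundary of \<open>\<Omega>\<close> lies in the regularity domain of \<open>f\<close>.\<close>

lemma regular_near_nonzero:
  assumes "z \<in> U" "\<not> zero_or_pole f z"
  obtains D where "z \<in> D" "D \<subseteq> U" "slice_regular D f" "Phi (assoc_map f z) \<noteq> 0"
proof -
  obtain D h where sf: "stem_factor (assoc_map f) z 0 0 D (assoc_map h)" and h: "slice_regular D h"
  proof (cases "Im z = 0")
    case True
    then have z: "of_real (Re z) = z" by (simp add: complex_eq_iff)
    moreover have "real_mult f (Re z) = 0" using assms(2) True by (simp add: zero_or_pole_def)
    ultimately show ?thesis using real_multiplicity[of "Re z"] assms(1) that by auto
  next
    case False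
    then have "spherical_mult f z = 0" "isolated_mult f z = 0" using assms(2) by (simp_all add: zero_or_pole_def)
    then show ?thesis using sphere_multiplicities[OF assms(1) False] that by auto
  qed
  define E where "E = D \<inter> U"
  have E: "sym_open E" "z \<in> E" "E \<subseteq> U" "E \<subseteq> D"
    using sf U assms(1) by (auto simp: E_def stem_factor_def intro: sym_open_Int)
  have hE: "slice_regular E h" using slice_regular_subset[OF h E(1,4)] .
  note h' = slice_regular_assoc_map[OF hE]
  have eq: "assoc_map h w = (1 / B w) *s N w" if w: "w \<in> E" "B w \<noteq> 0" for w
  proof -
    define E' where "E' = E \<inter> B -` (- {0})"
    have oE: "open E'"
      unfolding E'_def using E B
      by (intro continuous_open_preimage) (auto simp: sym_open_def intro: holomorphic_on_imp_continuous_on holomorphic_on_subset)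
    have wE: "w \<in> E'" using w by (simp add: E'_def)
    have c1: "continuous_on E' (\<lambda>w. assoc_map h w $ i)" for i
      using holo_stem_continuous[OF h'(2)] by (rule continuous_on_subset) (auto simp: E'_def)
    have c2: "continuous_on E' (\<lambda>w. ((1 / B w) *s N w) $ i)" for i
    proof -
      have "continuous_on E' B" "continuous_on E' (\<lambda>w. N w $ i)"
        using holomorphic_on_imp_continuous_on[OF B] holo_stem_continuous[OF N] E(3)
        by (auto simp: E'_def intro: continuous_on_subset)
      then show ?thesis by (auto intro!: continuous_intros simp: E'_def)
    qed
    have e: "assoc_map h x = (1 / B x) *s N x" if x: "x \<in> E' - {z, cnj z}" for x
    proof -
      have "x \<in> D - {z, cnj z}" "x \<in> U" "B x \<noteq> 0" using x by (auto simp: E'_def E_def)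
      then show ?thesis using sf assoc_map_quotient[of x] by (simp add: stem_factor_def)
    qed
    show ?thesis
      by (rule eq_off_finite_vec[where L = "\<lambda>w. (1 / B w) *s N w" and X = "{z, cnj z}", OF oE _ c1 c2 e wE]) simp
  qed
  have fh: "f q = h q" if "q \<in> axial E" for q
    by (rule extend[OF E(3) hE _ that]) (metis eq h'(3))
  have "slice_regular E f"
    by (rule slice_regularI[OF E(1) h'(2)]) (simp add: fh axialI h'(3))
  moreover have "assoc_map f z = assoc_map h z"
  proof (rule assoc_map_cong)
    have "cnj z \<in> E" using sym_openD(2)[OF E(1,2)] .
    then show "f (slice_pt v z) = h (slice_pt v z)" "f (slice_pt v (cnj z)) = h (slice_pt v (cnj z))"
      if "v \<in> imag_units" for v
      using fh[OF axialI[OF that]] E(2) by blast+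
  qed
  moreover have "Phi (assoc_map h z) \<noteq> 0"
  proof -
    obtain c where "c z \<noteq> 0" "\<forall>w\<in>D. Phi (assoc_map h w) = node z w ^ 0 * c w" "z \<in> D"
      using sf unfolding stem_factor_def by blast
    then show ?thesis by simp
  qed
  ultimately show ?thesis using that E by metis
qed

text \<open>At common zeros of \<open>A\<close> and \<open>B\<close> the quotient has the default value \<open>0\<close>; removing singularities
  gives it the correct value where it is finite.\<close>

definition P :: "complex \<Rightarrow> complex" where
  "P = remove_sings (\<lambda>w. A w / B w)"

lemma openU: "open U"
  using U by (simp add: sym_open_def)

lemma AB_analytic: "A analytic_on U" "B analytic_on U"
  using A B openU by (simp_all add: analytic_on_open)

lemma quotient_meromorphic: "(\<lambda>w. A w / B w) meromorphic_on U"
  by (intro meromorphic_on_divide analytic_on_imp_meromorphic_on AB_analytic)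

lemma P_nicely_meromorphic: "P nicely_meromorphic_on U"
  unfolding P_def by (rule remove_sings_nicely_meromorphic[OF quotient_meromorphic])

lemma P_eq:
  assumes "w \<in> U" "B w \<noteq> 0"
  shows "P w = A w / B w"
proof -
  have "A analytic_on {w}" "B analytic_on {w}"
    using AB_analytic assms(1) by (auto elim: analytic_on_subset)
  then have "(\<lambda>w. A w / B w) analytic_on {w}"
    using assms(2) by (intro analytic_on_divide) auto
  then show ?thesis unfolding P_def by (rule remove_sings_at_analytic)
qed

lemma eventually_regular:
  assumes "z \<in> U"
  shows "\<forall>\<^sub>F w in at z. w \<in> U \<and> A w \<noteq> 0 \<and> B w \<noteq> 0"
  using eventually_at_in_open'[OF openU assms] A_nz[OF assms] B_nz[OF assms] by eventually_elim auto

lemma zorder_P: "z \<in> U \<Longrightarrow> zorder P z = order_at z"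
  unfolding order_at_def by (intro zorder_cong eventually_mono[OF eventually_regular]) (auto simp: P_eq Phi_quotient)

lemma order_at_eq_0:
  assumes "z \<in> U" "P z \<noteq> 0"
  shows "order_at z = 0"
proof -
  have "\<not> is_pole P z" "P analytic_on {z}"
  proof -
    show "\<not> is_pole P z"
      using P_nicely_meromorphic assms is_pole_tendsto not_tendsto_and_filterlim_at_infinity[of "at z" P]
      unfolding nicely_meromorphic_on_def is_pole_def by (metis at_neq_bot)
    then show "P analytic_on {z}"
      using nicely_meromorphic_on_imp_analytic_at[OF P_nicely_meromorphic assms(1)] by blast
  qed
  then have "zorder P z = 0" using assms(2) by (intro zorder_eq_0I)
  then show ?thesis using zorder_P[OF assms(1)] by simp
qed

lemma sparse_irregular: "{z \<in> U. A z = 0 \<or> B z = 0} sparse_in U"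
  unfolding sparse_in_open[OF openU]
proof
  fix z assume "z \<in> U"
  from eventually_regular[OF this] show "\<not> z islimpt {z \<in> U. A z = 0 \<or> B z = 0}"
    unfolding islimpt_iff_eventually not_not by eventually_elim auto
qed

lemma P_zero_irregular: "w \<in> U \<Longrightarrow> P w = 0 \<Longrightarrow> A w = 0 \<or> B w = 0"
  using P_eq[of w] by auto

lemma P_eq_Phi:
  assumes "slice_regular D f" "D \<subseteq> U" "z \<in> D"
  shows "P z = Phi (assoc_map f z)"
proof -
  note f' = slice_regular_assoc_map[OF assms(1)]
  have "continuous_on D (\<lambda>w. Phi (assoc_map f w))"
    by (intro holomorphic_on_imp_continuous_on Phi_holomorphic f')
  then have "(\<lambda>w. Phi (assoc_map f w)) \<midarrow>z\<rightarrow> Phi (assoc_map f z)"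
    using f'(1) assms(3) by (auto simp: continuous_on_eq_continuous_at sym_open_def isCont_def)
  moreover have "\<forall>\<^sub>F w in at z. Phi (assoc_map f w) = A w / B w"
    using eventually_regular[OF subsetD[OF assms(2,3)]] by eventually_elim (simp add: Phi_quotient)
  ultimately have "(\<lambda>w. A w / B w) \<midarrow>z\<rightarrow> Phi (assoc_map f z)"
    by (rule Lim_transform_eventually)
  then show ?thesis unfolding P_def by (rule remove_sings_eqI)
qed

end

lemma sym_connected_meets_reals:
  assumes "sym_open U" "connected U" "z \<in> U"
  obtains x where "complex_of_real x \<in> U"
proof -
  have "connected (Im ` U)" using assms(2) by (intro connected_continuous_image continuous_intros)
  moreover have "Im z \<in> Im ` U" "- Im z \<in> Im ` U"
    using assms(3) sym_openD(2)[OF assms(1,3)] image_eqI[of "- Im z" Im "cnj z" U] by auto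
  ultimately have "{- \<bar>Im z\<bar>..\<bar>Im z\<bar>} \<subseteq> Im ` U"
    by (intro connected_contains_Icc) (auto simp: abs_if)
  then have "0 \<in> Im ` U" by (auto simp: subset_iff)
  then obtain w where "w \<in> U" "Im w = 0" by auto
  then have "complex_of_real (Re w) \<in> U" by (metis complex_is_Real_iff of_real_Re)
  then show ?thesis using that by blast
qed

text \<open>A stem can take values in the zero divisors on an open set, but not on the real axis, where it is
  real and \<open>\<Phi>\<close> is a sum of four squares. If \<open>\<Phi> \<circ> K\<close> vanished identically, so would \<open>K\<close> on the real
  points of \<open>U\<close> and hence on \<open>U\<close>.\<close>

lemma Phi_not_identically_zero:
  assumes U: "sym_open U" "connected U" and K: "holo_stem U K" and z: "z \<in> U" "K z \<noteq> 0"
  shows "\<exists>w\<in>U. Phi (K w) \<noteq> 0"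
proof (rule ccontr)
  assume "\<not> ?thesis"
  then have Phi0: "Phi (K w) = 0" if "w \<in> U" for w using that by blast
  obtain x where x: "complex_of_real x \<in> U" using sym_connected_meets_reals[OF U z(1)] by blast
  have real0: "K (of_real t) = 0" if "complex_of_real t \<in> U" for t
  proof -
    have "K (cnj (of_real t)) = vec_cnj (K (of_real t))" using K that unfolding holo_stem_def by blast
    then have im: "Im (K (of_real t) $ i) = 0" for i by (simp add: vec_eq_iff complex_eq_iff)
    have "Re (Phi (K (of_real t))) = (Re (K (of_real t) $ 1))\<^sup>2 + (Re (K (of_real t) $ 2))\<^sup>2
        + (Re (K (of_real t) $ 3))\<^sup>2 + (Re (K (of_real t) $ 4))\<^sup>2"
      by (simp add: Phi_def im power2_eq_square)
    then have "(Re (K (of_real t) $ 1))\<^sup>2 + (Re (K (of_real t) $ 2))\<^sup>2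
        + (Re (K (of_real t) $ 3))\<^sup>2 + (Re (K (of_real t) $ 4))\<^sup>2 = 0" using Phi0[OF that] by simp
    then have "Re (K (of_real t) $ i) = 0" for i
      using exhaust_4[of i] by (auto simp: add_nonneg_eq_0_iff)
    then show ?thesis using im by (simp add: vec_eq_iff complex_eq_iff)
  qed
  have oU: "open U" using sym_openD(1)[OF U(1)] .
  have lim: "complex_of_real x islimpt (U \<inter> \<real>)"
    unfolding islimpt_approachable
  proof (intro allI impI)
    fix e :: real assume "e > 0"
    obtain d where d: "d > 0" "ball (complex_of_real x) d \<subseteq> U" using oU x by (auto simp: open_contains_ball)
    define t where "t = min d e / 2"
    have t: "0 < t" "t < d" "t < e" using d(1) \<open>e > 0\<close> by (auto simp: t_def)
    have ds: "dist (complex_of_real (x + t)) (complex_of_real x) = t"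
      using t(1) by (simp add: dist_norm)
    then have "complex_of_real (x + t) \<in> U \<inter> \<real>"
      using d(2) t by (auto simp: dist_commute)
    moreover have "complex_of_real (x + t) \<noteq> complex_of_real x" using t(1) by simp
    ultimately show "\<exists>y\<in>U \<inter> \<real>. y \<noteq> complex_of_real x \<and> dist y (complex_of_real x) < e"
      using ds t(3) by (intro bexI[of _ "complex_of_real (x + t)"]) auto
  qed
  have "K w $ i = 0" if "w \<in> U" for w i
  proof (rule analytic_continuation[OF _ oU U(2) Int_lower1 x lim _ that])
    show "(\<lambda>w. K w $ i) holomorphic_on U" using K by (simp add: holo_stem_def)
    show "K w $ i = 0" if "w \<in> U \<inter> \<real>" for w
      using that real0 by (auto elim!: Reals_cases)
  qed
  then show False using z by (auto simp: vec_eq_iff)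
qed

lemma slice_meromorphic_quotient:
  assumes U: "sym_open U" "connected U" and f: "slice_meromorphic U f" "\<exists>q\<in>axial U. f q \<noteq> 0"
  obtains N A B where "slice_quotient U f N A B"
proof -
  obtain a b where a: "slice_regular U a" and b: "slice_regular U b" and a0: "\<exists>q\<in>axial U. a q \<noteq> 0"
    and W: "let W = {z \<in> U. Phi (assoc_map a z) \<noteq> 0} in
          (\<forall>q\<in>axial W. f q = (star_inverse a \<star> b) q) \<and>
          (\<forall>D k. D \<subseteq> U \<and> slice_regular D k \<and> (\<forall>q\<in>axial (D \<inter> W). k q = (star_inverse a \<star> b) q)
             \<longrightarrow> (\<forall>q\<in>axial D. f q = k q))"
    using f(1) unfolding slice_meromorphic_def by blast
  define W where "W = {z \<in> U. Phi (assoc_map a z) \<noteq> 0}"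
  have fW: "\<And>q. q \<in> axial W \<Longrightarrow> f q = (star_inverse a \<star> b) q"
    and ext: "\<And>D k q. D \<subseteq> U \<Longrightarrow> slice_regular D k \<Longrightarrow> (\<And>q. q \<in> axial (D \<inter> W) \<Longrightarrow> k q = (star_inverse a \<star> b) q)
             \<Longrightarrow> q \<in> axial D \<Longrightarrow> f q = k q"
    using W unfolding Let_def W_def by blast+
  note a' = slice_regular_assoc_map[OF a] and b' = slice_regular_assoc_map[OF b]
  define N where "N w = cq_mult (cq_conj (assoc_map a w)) (assoc_map b w)" for w
  define A B where "A w = Phi (assoc_map b w)" and "B w = Phi (assoc_map a w)" for w
  have quot: "(star_inverse a \<star> b) (slice_pt v w) = quat_val v ((1 / B w) *s N w)" if "v \<in> imag_units" for v w
    by (simp add: star_quat_val[OF that] assoc_map_star_inverse cq_mult_scale N_def B_def)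
  have oU: "open U" using sym_openD(1)[OF U(1)] .
  have nz: "\<forall>\<^sub>F w in at z. Phi (assoc_map g w) \<noteq> 0"
    if g: "slice_regular U g" and g0: "\<exists>z\<in>U. assoc_map g z \<noteq> 0" and z: "z \<in> U" for g z
  proof -
    note g' = slice_regular_assoc_map[OF g]
    obtain z0 where "z0 \<in> U" "assoc_map g z0 \<noteq> 0" using g0 by blast
    then obtain w where "w \<in> U" "Phi (assoc_map g w) \<noteq> 0"
      using Phi_not_identically_zero[OF U g'(2)] by blast
    then have "\<forall>\<^sub>F w in at z. Phi (assoc_map g w) \<noteq> 0 \<and> w \<in> U"
      by (rule non_zero_neighbour_alt[OF Phi_holomorphic[OF g'(2)] oU U(2) z])
    then show ?thesis by eventually_elim simp
  qed
  have az: "\<exists>z\<in>U. assoc_map a z \<noteq> 0"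
  proof -
    obtain v z where "v \<in> imag_units" "z \<in> U" "a (slice_pt v z) \<noteq> 0" using a0 by (auto simp: axial_def)
    then show ?thesis using a'(3)[of z v] by (intro bexI[of _ z]) auto
  qed
  \<comment> \<open>Otherwise the zero function is a slice-regular extension of the quotient to all of \<open>U\<close>, and \<open>f\<close>
    would vanish also on the spheres where the quotient is not defined.\<close>
  have bz: "\<exists>z\<in>U. assoc_map b z \<noteq> 0"
  proof (rule ccontr)
    assume "\<not> ?thesis"
    then have N0: "N w = 0" if "w \<in> U" for w using that by (simp add: N_def cq_mult_zero)
    have "slice_regular U (\<lambda>q. 0)"
      by (rule slice_regularI[OF U(1), of "\<lambda>w. 0"]) (auto simp: holo_stem_def vec_eq_iff)
    moreover have "0 = (star_inverse a \<star> b) q" if "q \<in> axial (U \<inter> W)" for q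
    proof -
      obtain v w where "v \<in> imag_units" "w \<in> U" "q = slice_pt v w" using \<open>q \<in> axial (U \<inter> W)\<close> by (auto simp: axial_def)
      then show ?thesis by (simp add: quot N0 vector_smult_rzero)
    qed
    ultimately have "f q = 0" if "q \<in> axial U" for q using ext[of U "\<lambda>q. 0", OF _ _ _ that] by blast
    then show False using f(2) by blast
  qed
  have "slice_quotient U f N A B"
  proof
    show "sym_open U" by fact
    show "holo_stem U N" unfolding N_def by (intro holo_stem_cq_mult holo_stem_cq_conj a' b')
    show "A holomorphic_on U" unfolding A_def by (intro Phi_holomorphic b')
    show "B holomorphic_on U" unfolding B_def by (intro Phi_holomorphic a')
    show "A (cnj w) = cnj (A w)" "B (cnj w) = cnj (B w)" for w
      by (simp_all add: A_def B_def assoc_map_cnj Phi_vec_cnj)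
    show "Phi (N w) = A w * B w" for w by (simp add: N_def A_def B_def Phi_cq_mult Phi_cq_conj)
    show "\<forall>\<^sub>F w in at z. A w \<noteq> 0" if "z \<in> U" for z unfolding A_def by (rule nz[OF b bz that])
    show "\<forall>\<^sub>F w in at z. B w \<noteq> 0" if "z \<in> U" for z unfolding B_def by (rule nz[OF a az that])
    show "f (slice_pt v w) = quat_val v ((1 / B w) *s N w)" if "w \<in> U" "B w \<noteq> 0" "v \<in> imag_units" for w v
    proof -
      have "slice_pt v w \<in> axial W" using that by (intro axialI) (simp_all add: W_def B_def)
      then show ?thesis using fW quot[OF that(3)] by simp
    qed
    fix D k q
    assume D: "D \<subseteq> U" "slice_regular D k" and q: "q \<in> axial D"
      and k: "\<And>w v. w \<in> D \<Longrightarrow> B w \<noteq> 0 \<Longrightarrow> v \<in> imag_units \<Longrightarrow> k (slice_pt v w) = quat_val v ((1 / B w) *s N w)"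
    show "f q = k q"
    proof (rule ext[OF D _ q])
      fix q assume "q \<in> axial (D \<inter> W)"
      then obtain v w where "v \<in> imag_units" "w \<in> D" "B w \<noteq> 0" "q = slice_pt v w"
        by (auto simp: axial_def W_def B_def)
      then show "k q = (star_inverse a \<star> b) q" using k quot by simp
    qed
  qed
  then show ?thesis using that by blast
qed

lemma sum_positive_plus_negative:
  fixes g :: "'a \<Rightarrow> int"
  assumes "finite R" "R \<subseteq> Z" "\<And>x. x \<in> Z \<Longrightarrow> g x \<noteq> 0 \<Longrightarrow> x \<in> R"
  shows "(\<Sum>x | x \<in> Z \<and> g x > 0. g x) - (\<Sum>x | x \<in> Z \<and> g x < 0. - g x) = (\<Sum>x\<in>R. g x)"
proof -
  have "(\<Sum>x\<in>R. g x) = (\<Sum>x\<in>{x. x \<in> Z \<and> g x > 0} \<union> {x. x \<in> Z \<and> g x < 0}. g x)"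
    using assms by (intro sum.mono_neutral_right) auto
  also have "\<dots> = (\<Sum>x | x \<in> Z \<and> g x > 0. g x) + (\<Sum>x | x \<in> Z \<and> g x < 0. g x)"
    using assms by (intro sum.union_disjoint finite_subset[OF _ assms(1)]) auto
  finally show ?thesis by (simp add: sum_negf)
qed

context slice_quotient
begin

text \<open>The points of \<open>\<Omega>\<close> where \<open>A\<close> or \<open>B\<close> vanishes are finite in number and include all zeros and poles
  of \<open>f\<close>, among them those where a pole and isolated zeros cancel in \<open>A / B\<close>. They are split into real
  points, points whose conjugate is not in \<open>\<Omega>\<close>, and conjugate pairs.\<close>

lemma sum_of_orders:
  assumes \<Omega>: "bounded \<Omega>" "closure \<Omega> \<subseteq> U"
  shows "(\<Sum>p | p \<in> \<Omega> \<and> P p = 0. order_at p) =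
    2 * isolated_zeros f (paired \<Omega>) + isolated_zeros f (unpaired \<Omega>) + 2 * real_zeros f \<Omega>
    + 4 * spherical_zeros f (paired \<Omega>) + 2 * spherical_zeros f (unpaired \<Omega>)
    - 2 * (real_poles f \<Omega> + spherical_poles f (paired \<Omega>)) - spherical_poles f (unpaired \<Omega>)"
proof -
  have \<Omega>U: "p \<in> U" if "p \<in> \<Omega>" for p using that closure_subset[of \<Omega>] \<Omega>(2) by blast
  define X where "X = {p \<in> \<Omega>. A p = 0 \<or> B p = 0}"
  have "finite (closure \<Omega> \<inter> {z \<in> U. A z = 0 \<or> B z = 0})"
    using \<Omega> by (intro sparse_in_compact_finite sparse_in_subset[OF sparse_irregular]) (auto simp: compact_closure)
  then have finX: "finite X"
    by (rule finite_subset[rotated]) (use closure_subset[of \<Omega>] \<Omega>(2) in \<open>auto simp: X_def\<close>)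
  have X: "p \<in> X" if "p \<in> \<Omega>" "zero_or_pole f p" for p
    using that regular_point_not_zero_or_pole[OF \<Omega>U[OF that(1)]] by (auto simp: X_def)
  define i s where "i z = int (isolated_mult f z)" and "s z = spherical_mult f z" for z
  have nonreal: "\<exists>p. p \<in> Z \<and> Im p = 0 \<Longrightarrow> False" if "Z \<in> {paired \<Omega>, unpaired \<Omega>}" for Z
    using that by (auto simp: paired_def unpaired_def complex_eq_iff) (metis complex_cnj complex_surj neg_0_equal_iff_equal)
  have sub: "Z \<subseteq> \<Omega>" if "Z \<in> {paired \<Omega>, unpaired \<Omega>}" for Z
    using that by (auto simp: paired_def unpaired_def)
  have Xi: "z \<in> X \<inter> Z" if "Z \<in> {paired \<Omega>, unpaired \<Omega>}" "z \<in> Z" "i z \<noteq> 0 \<or> s z \<noteq> 0" for Z z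
  proof -
    have "Im z \<noteq> 0" using nonreal[OF that(1)] that(2) by blast
    then have "zero_or_pole f z" using that(3) by (auto simp: zero_or_pole_def i_def s_def)
    then show ?thesis using X[of z] sub[OF that(1)] that(2) by blast
  qed
  have iso: "isolated_zeros f Z = (\<Sum>z\<in>X \<inter> Z. i z)" if Z: "Z \<in> {paired \<Omega>, unpaired \<Omega>}" for Z
    unfolding isolated_zeros_def i_def[symmetric]
    using Xi[OF Z] finX by (intro sum.mono_neutral_left) (auto simp: i_def)
  have sph: "2 * spherical_zeros f Z - spherical_poles f Z = (\<Sum>z\<in>X \<inter> Z. 2 * s z)" if Z: "Z \<in> {paired \<Omega>, unpaired \<Omega>}" for Z
  proof -
    have "(\<Sum>z | z \<in> Z \<and> s z > 0. s z) - (\<Sum>z | z \<in> Z \<and> s z < 0. - s z) = (\<Sum>z\<in>X \<inter> Z. s z)"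
      using finX Xi[OF Z] by (intro sum_positive_plus_negative) auto
    moreover have "spherical_poles f Z = 2 * (\<Sum>z | z \<in> Z \<and> s z < 0. - s z)"
      unfolding spherical_poles_def s_def sum_distrib_left by simp
    ultimately show ?thesis by (simp add: spherical_zeros_def s_def flip: sum_distrib_left)
  qed
  have nonreal_sum: "(\<Sum>z\<in>X \<inter> Z. order_at z) = isolated_zeros f Z + 2 * spherical_zeros f Z - spherical_poles f Z"
    if Z: "Z \<in> {paired \<Omega>, unpaired \<Omega>}" for Z
  proof -
    have "(\<Sum>z\<in>X \<inter> Z. order_at z) = (\<Sum>z\<in>X \<inter> Z. 2 * s z + i z)"
    proof (rule sum.cong[OF refl])
      fix z assume "z \<in> X \<inter> Z"
      then show "order_at z = 2 * s z + i z"
        using order_at_nonreal[of z] \<Omega>U[of z] nonreal[OF Z] by (auto simp: X_def i_def s_def)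
    qed
    then show ?thesis using iso[OF Z] sph[OF Z] by (simp add: sum.distrib)
  qed
  define R where "R = {x. complex_of_real x \<in> X}"
  have R: "finite R" "complex_of_real ` R = {p \<in> X. Im p = 0}"
  proof -
    show im: "complex_of_real ` R = {p \<in> X. Im p = 0}"
      unfolding R_def by (auto simp: image_iff) (metis complex_is_Real_iff of_real_Re)
    have "finite (complex_of_real ` R)" unfolding im using finX by simp
    then show "finite R" by (rule finite_imageD) (auto simp: inj_on_def)
  qed
  have real_sum: "(\<Sum>p | p \<in> X \<and> Im p = 0. order_at p) = 2 * (real_zeros f \<Omega> - real_poles f \<Omega>)"
  proof -
    have "(\<Sum>p | p \<in> X \<and> Im p = 0. order_at p) = (\<Sum>x\<in>R. order_at (of_real x))"
      unfolding R(2)[symmetric] by (subst sum.reindex) (auto simp: inj_on_def)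
    also have "\<dots> = (\<Sum>x\<in>R. 2 * real_mult f x)"
      using \<Omega>U by (intro sum.cong refl order_at_real) (auto simp: R_def X_def)
    also have "\<dots> = 2 * (\<Sum>x\<in>R. real_mult f x)" by (simp add: sum_distrib_left)
    also have "(\<Sum>x\<in>R. real_mult f x) = real_zeros f \<Omega> - real_poles f \<Omega>"
      using sum_positive_plus_negative[of R "{x. complex_of_real x \<in> \<Omega>}" "real_mult f"] R(1) X
      by (force simp: real_zeros_def real_poles_def R_def zero_or_pole_def X_def)
    finally show ?thesis .
  qed
  have cnjX: "cnj z \<in> X" if "z \<in> X" "cnj z \<in> \<Omega>" for z
    using that A_cnj B_cnj \<Omega>U by (auto simp: X_def)
  have lower: "(\<Sum>z\<in>cnj ` (X \<inter> paired \<Omega>). order_at z) = (\<Sum>z\<in>X \<inter> paired \<Omega>. order_at z)"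
  proof -
    have "(\<Sum>z\<in>cnj ` (X \<inter> paired \<Omega>). order_at z) = (\<Sum>z\<in>X \<inter> paired \<Omega>. order_at (cnj z))"
      by (subst sum.reindex) (auto simp: inj_on_def)
    also have "\<dots> = (\<Sum>z\<in>X \<inter> paired \<Omega>. order_at z)"
      using \<Omega>U by (intro sum.cong refl) (auto simp: paired_def order_at_nonreal mult_cnj)
    finally show ?thesis .
  qed
  have "(\<Sum>p | p \<in> \<Omega> \<and> P p = 0. order_at p) = (\<Sum>p\<in>X. order_at p)"
    using finX P_zero_irregular order_at_eq_0 \<Omega>U by (intro sum.mono_neutral_left) (auto simp: X_def)
  also have "X = {p \<in> X. Im p = 0} \<union> ((X \<inter> unpaired \<Omega>) \<union> ((X \<inter> paired \<Omega>) \<union> cnj ` (X \<inter> paired \<Omega>)))"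
  proof (intro equalityI subsetI)
    fix p assume p: "p \<in> X"
    show "p \<in> {p \<in> X. Im p = 0} \<union> ((X \<inter> unpaired \<Omega>) \<union> ((X \<inter> paired \<Omega>) \<union> cnj ` (X \<inter> paired \<Omega>)))"
    proof (cases "cnj p \<in> \<Omega> \<and> Im p < 0")
      case True
      then have "cnj p \<in> X \<inter> paired \<Omega>" using p cnjX by (auto simp: paired_def X_def)
      then have "cnj (cnj p) \<in> cnj ` (X \<inter> paired \<Omega>)" by (rule imageI)
      then show ?thesis by simp
    next
      case False
      then show ?thesis using p by (auto simp: paired_def unpaired_def X_def)
    qed
  qed (use cnjX in \<open>auto simp: paired_def\<close>)
  also have "(\<Sum>p\<in>\<dots>. order_at p) = (\<Sum>p | p \<in> X \<and> Im p = 0. order_at p) + ((\<Sum>p\<in>X \<inter> unpaired \<Omega>. order_at p)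
      + ((\<Sum>p\<in>X \<inter> paired \<Omega>. order_at p) + (\<Sum>p\<in>cnj ` (X \<inter> paired \<Omega>). order_at p)))"
  proof -
    have "{p \<in> X. Im p = 0} \<inter> ((X \<inter> unpaired \<Omega>) \<union> ((X \<inter> paired \<Omega>) \<union> cnj ` (X \<inter> paired \<Omega>))) = {}"
      using nonreal by (fastforce simp: paired_def)
    moreover have "(X \<inter> unpaired \<Omega>) \<inter> ((X \<inter> paired \<Omega>) \<union> cnj ` (X \<inter> paired \<Omega>)) = {}"
      by (auto simp: paired_def unpaired_def)
    moreover have "(X \<inter> paired \<Omega>) \<inter> cnj ` (X \<inter> paired \<Omega>) = {}"
      by (auto simp: paired_def)
    ultimately show ?thesis using finX by (simp add: sum.union_disjoint)
  qed
  finally show ?thesis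
    unfolding lower real_sum using nonreal_sum[of "paired \<Omega>"] nonreal_sum[of "unpaired \<Omega>"] by simp
qed

end

theorem theorem5p6:
  fixes f :: "quat \<Rightarrow> quat" and U V \<Omega> :: "complex set"
    and F :: "complex \<Rightarrow> complex ^ 4" and \<Gamma> :: "(real \<Rightarrow> complex) list"
    and k0 m0 k1 m1 r p0 p1 :: int
  assumes "sym_open U" and "connected U"
    and "slice_meromorphic U f" and "\<exists>q\<in>axial U. f q \<noteq> 0"
    and "V \<subseteq> U" and "slice_regular V f"
    and "\<And>W. W \<subseteq> U \<Longrightarrow> slice_regular W f \<Longrightarrow> W \<subseteq> V"
    and "\<And>z. z \<in> V \<Longrightarrow> F z = assoc_map f z"
    and "open \<Omega>" and "bounded \<Omega>" and "closure \<Omega> \<subseteq> U"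
    and "oriented_C1_boundary \<Omega> \<Gamma>"
    and "\<And>z. z \<in> frontier \<Omega> \<Longrightarrow> \<not> zero_or_pole f z"
    and "k0 = isolated_zeros f (paired \<Omega>)"
    and "m0 = spherical_zeros f (paired \<Omega>)"
    and "k1 = isolated_zeros f (unpaired \<Omega>)"
    and "m1 = spherical_zeros f (unpaired \<Omega>)"
    and "r = real_zeros f \<Omega>"
    and "p0 = real_poles f \<Omega> + spherical_poles f (paired \<Omega>)"
    and "p1 = spherical_poles f (unpaired \<Omega>)"
  shows "1 / (2 * of_real pi * \<i>) *
           (\<Sum>\<gamma>\<leftarrow>\<Gamma>. contour_integral \<gamma> (\<lambda>z. deriv (Phi \<circ> F) z / (Phi \<circ> F) z))
         = of_int (2 * k0 + k1 + 2 * r + 4 * m0 + 2 * m1 - 2 * p0 - p1)"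
proof -
  obtain N A B where "slice_quotient U f N A B"
    by (rule slice_meromorphic_quotient[OF assms(1-4)])
  then interpret slice_quotient U f N A B .
  have oV: "open V" using slice_regular_assoc_map(1)[OF assms(6)] by (simp add: sym_open_def)
  have PV: "P z = (Phi \<circ> F) z" if "z \<in> V" for z
    using P_eq_Phi[OF assms(6,5) that] assms(8)[OF that] by simp
  have fr: "frontier \<Omega> = (\<Union>\<gamma>\<in>set \<Gamma>. path_image \<gamma>)"
    using assms(12) by (simp add: oriented_C1_boundary_def)
  have frU: "frontier \<Omega> \<subseteq> closure \<Omega>" by (simp add: frontier_def)
  have bd: "z \<in> V \<and> P z \<noteq> 0" if z: "z \<in> frontier \<Omega>" for z
  proof -
    have "z \<in> U" using z frU assms(11) by blast
    then obtain D where "z \<in> D" "D \<subseteq> U" "slice_regular D f" "Phi (assoc_map f z) \<noteq> 0"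
      using regular_near_nonzero assms(13)[OF z] by metis
    then show ?thesis using assms(7)[of D] P_eq_Phi[of D z] by auto
  qed
  have loops: "valid_path \<gamma> \<and> pathfinish \<gamma> = pathstart \<gamma> \<and> path_image \<gamma> \<subseteq> closure \<Omega>" if "\<gamma> \<in> set \<Gamma>" for \<gamma>
    using assms(12) that frU fr by (auto simp: oriented_C1_boundary_def)
  have "contour_integral \<gamma> (\<lambda>z. deriv (Phi \<circ> F) z / (Phi \<circ> F) z) = contour_integral \<gamma> (\<lambda>z. deriv P z / P z)"
    if \<gamma>: "\<gamma> \<in> set \<Gamma>" for \<gamma>
  proof (rule contour_integral_cong[OF refl])
    fix z assume "z \<in> path_image \<gamma>"
    then have z: "z \<in> V" using bd fr \<gamma> by blast
    have "\<forall>\<^sub>F w in nhds z. (Phi \<circ> F) w = P w"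
      using eventually_nhds_in_open[OF oV z] by eventually_elim (simp add: PV)
    then have "deriv (Phi \<circ> F) z = deriv P z" by (intro deriv_cong_ev refl)
    then show "deriv (Phi \<circ> F) z / (Phi \<circ> F) z = deriv P z / P z" using PV[OF z] by simp
  qed
  then have "(\<Sum>\<gamma>\<leftarrow>\<Gamma>. contour_integral \<gamma> (\<lambda>z. deriv (Phi \<circ> F) z / (Phi \<circ> F) z)) = (\<Sum>\<gamma>\<leftarrow>\<Gamma>. contour_integral \<gamma> (\<lambda>z. deriv P z / P z))"
    by (simp cong: map_cong)
  also have "\<dots> = 2 * pi * \<i> * (\<Sum>p | p \<in> closure \<Omega> \<and> P p = 0. boundary_winding \<Gamma> p * zorder P p)"
  proof (rule argument_principle_cycle[OF openU assms(2) _ assms(11) loops _ P_nicely_meromorphic])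
    show "compact (closure \<Omega>)" using assms(10) by (simp add: compact_closure)
    show "boundary_winding \<Gamma> w = 0" if "w \<notin> closure \<Omega>" for w
      using boundary_winding_eq_indicator[OF assms(9,10,12), of w] that closure_subset[of \<Omega>] by (auto simp: frontier_def)
    show "{z \<in> U. P z = 0} sparse_in U"
      by (rule sparse_in_subset2[OF sparse_irregular]) (use P_zero_irregular in auto)
    show "P z \<noteq> 0" if "\<gamma> \<in> set \<Gamma>" "z \<in> path_image \<gamma>" for \<gamma> z
      using bd[of z] fr that by blast
  qed
  also have "(\<Sum>p | p \<in> closure \<Omega> \<and> P p = 0. boundary_winding \<Gamma> p * zorder P p) = (\<Sum>p | p \<in> \<Omega> \<and> P p = 0. of_int (order_at p))"
  proof (rule sum.cong)
    show "{p. p \<in> closure \<Omega> \<and> P p = 0} = {p. p \<in> \<Omega> \<and> P p = 0}"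
      using bd closure_subset[of \<Omega>] assms(9) by (auto simp: frontier_def interior_open)
    fix p assume p: "p \<in> {p. p \<in> \<Omega> \<and> P p = 0}"
    then have "p \<notin> frontier \<Omega>" "p \<in> U"
      using bd closure_subset[of \<Omega>] assms(11) by auto
    then show "boundary_winding \<Gamma> p * zorder P p = of_int (order_at p)"
      using boundary_winding_eq_indicator[OF assms(9,10,12)] p by (simp add: zorder_P)
  qed
  also have "\<dots> = of_int (2 * k0 + k1 + 2 * r + 4 * m0 + 2 * m1 - 2 * p0 - p1)"
    unfolding of_int_sum[symmetric] sum_of_orders[OF assms(10,11)] assms(14-20) by (rule refl)
  finally have total: "(\<Sum>\<gamma>\<leftarrow>\<Gamma>. contour_integral \<gamma> (\<lambda>z. deriv (Phi \<circ> F) z / (Phi \<circ> F) z)) =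
      2 * pi * \<i> * of_int (2 * k0 + k1 + 2 * r + 4 * m0 + 2 * m1 - 2 * p0 - p1)" .
  show ?thesis unfolding total by simp
qed

end
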